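(* Let $\mathcal C\subset\mathbb R^{d_u}$ be a closed convex set. There exist constants $\overline\alpha$, $\underline\beta$, $\overline\beta$ such that if the step sizes are constant, $\alpha_k=\alpha$, $\beta_k=\beta$, with $0<\alpha\le\overline\alpha$ and $\underline\beta\le\beta\le\overline\beta$, then the output of the algorithm described in the context (with $K$ upper-level iterations and $D$ lower-level iterations per upper-level iteration) satisfies, for $D\ge D^0:=D^0(\eta,\alpha)$, $$\frac1K\sum_{k=1}^{K}\mathrm{dist}^2\bigl(-\nabla F(y^k),N_{\mathcal C}(y^k)\bigr)\le \mathcal O\Bigl(\frac1K\Bigr)+\mathcal O(\lambda^D),$$ where $0<\lambda:=\lambda(\eta,\alpha)<1$ is a constant, $N_{\mathcal C}(y)=\{p\in\mathbb R^{d_u}:\langle p,y'-y\rangle\le0\ \ \forall y'\in\mathcal C\}$ is the normal cone to $\mathcal C$ at $y$, and $\mathrm{dist}(-\nabla F(y),N_{\mathcal C}(y))$ is the distance of $-\nabla F(y)$ to $N_{\mathcal C}(y)$.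
   Context: Setting. $N\ge1$, $d_1,\dots,d_N\ge1$, $d_u\ge1$ are integers, $d=\sum_i d_i$, $d^{\max}=\max_i d_i$; $\mathcal H_i=\{h_i\in\mathbb R^{d_i}:h_i\ge0,\ \mathbf 1^\top h_i=1\}$, $\mathcal H=\mathcal H_1\times\dots\times\mathcal H_N\subset\mathbb R^d$; $\mathcal C\subseteq\mathbb R^{d_u}$ is a nonempty closed convex set; $\eta>0$. $f(h,y)$ and $g(h,y)$ are real functions of $h\in\mathcal H$, $y\in\mathcal C$ having the derivatives appearing below, and $g(\cdot,y)$ is convex for every $y$. Let $\overline\psi(h)=\sum_{i=1}^N\sum_{j=1}^{d_i}(h_{i,j}\ln h_{i,j}-h_{i,j})$ and $g^\eta(h,y)=g(h,y)+\eta\,\overline\psi(h)$. For each $y$ let $h^*(y)$ be the unique minimizer of $g^\eta(\cdot,y)$ over $\mathcal H$, $R_*(y)=\partial h^*(y)/\partial y\in\mathbb R^{d\times d_u}$ its Jacobian, $F(y)=f(h^*(y),y)$, and $\nabla F(y)=\nabla_yf(h^*(y),y)+R_*(y)^\top\nabla_hf(h^*(y),y)$. $\|\cdot\|$ is the Euclidean norm for vectors and the spectral norm for matrices. Assumptions (constants uniform in all variables; $h,h'\in\mathcal H$, $y,y'\in\mathcal C$). With $z=(h,y)$: $\nabla_zf$ is $L_f$-Lipschitz on $\mathcal H\times\mathcal C$ and $\|\nabla_zf\|\le\Omega_f$. For each $y$: $\nabla_hg(\cdot,y)$ is $L_g$-Lipschitz, $\|\nabla_hg(h,y)\|\le\Omega_g$,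 $\nabla_y\nabla_hg(\cdot,y)$ is $\tau_g^h$-Lipschitz and $\nabla_h^2g(\cdot,y)$ is $\rho_g^h$-Lipschitz in $h$, $\|\nabla_h^2g(h,y)\|\le L_g$, $\|\nabla_y\nabla_hg(h,y)\|\le\Lambda_g$. For each $h$: $\nabla_y\nabla_hg(h,\cdot)$ is $\tau_g^y$-Lipschitz and $\nabla_h^2g(h,\cdot)$ is $\rho_g^y$-Lipschitz in $y$. Let $\nu^{\min}=e^{-2\Omega_g/\eta}/d^{\max}$ and $\widetilde{\mathcal H}=\{h\in\mathcal H:h_{i,j}\ge\nu^{\min}\ \forall i,j\}$. Algorithm. Inputs: integers $K,D\ge1$, step sizes $\alpha_k,\beta_k>0$, $y^0\in\mathcal C$, $h^0\in\widetilde{\mathcal H}$. For $k=0,\dots,K-1$: set $h^{0,0}=h^0$ and $h^{k,0}=h^{k-1,D}$ if $k>0$; set $R_{k,0}=0\in\mathbb R^{d\times d_u}$. For $t=0,\dots,D-1$ put $$h_i^{k,t+1}=\frac{h_i^{k,t}\circ\exp(-\alpha_k\nabla_{h_i}g^\eta(h^{k,t},y^k))}{(h_i^{k,t})^\top\exp(-\alpha_k\nabla_{h_i}g^\eta(h^{k,t},y^k))}\quad(i=1,\dots,N),$$ ($\circ$, $\exp$, and $1/h$ below are componentwise), and let $R_{k,t+1}$ be obtained by differentiating this update with respect to $y^k$ ($R_{k,t}$ standing for $\partial h^{k,t}/\partial y^k$), i.e. $R_{k,t+1}=M_{k,t}R_{k,t}+U_{k,t}$, where $B_{k,t}=\mathrm{blkdiag}_i(\mathrm{diag}(h_i^{k,t+1})-h_i^{k,t+1}(h_i^{k,t+1})^\top)$,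 $M_{k,t}=B_{k,t}[(1-\eta\alpha_k)\mathrm{diag}(1/h^{k,t})-\alpha_k\nabla_h^2g(h^{k,t},y^k)]$, $U_{k,t}=-\alpha_kB_{k,t}\nabla_y\nabla_hg(h^{k,t},y^k)$. Then set $\widehat\nabla F(y^k)=\nabla_yf(h^{k,D},y^k)+R_{k,D}^\top\nabla_hf(h^{k,D},y^k)$ and $y^{k+1}=\mathrm{Proj}_{\mathcal C}(y^k-\beta_k\widehat\nabla F(y^k))$.
   Formalization: The formal theorem additionally assumes that F is bounded below on 𝒞; without this the claim fails, e.g. for 𝒞=ℝ, f(h,y)=y, g=0, where the left side equals 1 for all K and D. *)

theory Defs
  imports "HOL-Analysis.Analysis"
begin

(* The coordinates (i,j) with j <= d_i are the elements of a finite type 'd, and blk maps (i,j)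
   to i.  For surjective blk :: 'd => 'n we have N = CARD('n), d = CARD('d), and
   d_i = card (blk -` {i}) >= 1.  The upper-level dimension d_u is CARD('u). *)

definition simplices :: "('d::finite \<Rightarrow> 'n) \<Rightarrow> (real^'d) set" where
  "simplices blk = {h. (\<forall>j. h $ j \<ge> 0) \<and> (\<forall>i. (\<Sum>j\<in>blk -` {i}. h $ j) = 1)}"

definition dmax :: "('d::finite \<Rightarrow> 'n::finite) \<Rightarrow> nat" where
  "dmax blk = Max (range (\<lambda>i. card (blk -` {i})))"

definition nu_min :: "('d::finite \<Rightarrow> 'n::finite) \<Rightarrow> real \<Rightarrow> real \<Rightarrow> real" where
  "nu_min blk \<Omega> \<eta> = exp (- 2 * \<Omega> / \<eta>) / real (dmax blk)"

definition simplices_ge_nu :: "('d::finite \<Rightarrow> 'n::finite) \<Rightarrow> real \<Rightarrow> real \<Rightarrow> (real^'d) set" where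
  "simplices_ge_nu blk \<Omega> \<eta> = {h \<in> simplices blk. \<forall>j. h $ j \<ge> nu_min blk \<Omega> \<eta>}"

(* The Isabelle norm on real^'u^'d is the Frobenius norm, hence the operator norm explicitly. *)
definition spectral_norm :: "real^'u^'d \<Rightarrow> real" where
  "spectral_norm A = onorm (\<lambda>v. A *v v)"

definition spectral_lipschitz_on ::
  "real \<Rightarrow> 'a::metric_space set \<Rightarrow> ('a \<Rightarrow> real^'u^'d) \<Rightarrow> bool" where
  "spectral_lipschitz_on L S A \<longleftrightarrow> (\<forall>x\<in>S. \<forall>x'\<in>S. spectral_norm (A x - A x') \<le> L * dist x x')"

definition normal_cone :: "'a::real_inner set \<Rightarrow> 'a \<Rightarrow> 'a set" where
  "normal_cone C y = {p. \<forall>y'\<in>C. p \<bullet> (y' - y) \<le> 0}"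

(* ln 0 = 0 in Isabelle, so the boundary convention 0 * ln 0 = 0 holds. *)
definition entropy :: "real^'d \<Rightarrow> real" where
  "entropy h = (\<Sum>j\<in>UNIV. h $ j * ln (h $ j) - h $ j)"

definition g_reg :: "real \<Rightarrow> (real^'d \<Rightarrow> real^'u \<Rightarrow> real) \<Rightarrow> real^'d \<Rightarrow> real^'u \<Rightarrow> real" where
  "g_reg \<eta> g h y = g h y + \<eta> * entropy h"

definition h_star ::
  "('d::finite \<Rightarrow> 'n) \<Rightarrow> real \<Rightarrow> (real^'d \<Rightarrow> real^'u \<Rightarrow> real) \<Rightarrow> real^'u \<Rightarrow> real^'d" where
  "h_star blk \<eta> g y = (THE h. is_arg_min (\<lambda>h. g_reg \<eta> g h y) (\<lambda>h. h \<in> simplices blk) h)"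

(* If C has empty interior, the derivative within C is not unique and jacobian picks one.  Another
   choice changes grad_F y only by a vector orthogonal to y' - y for all y' in C, which does not
   affect the distance of - grad_F y to normal_cone C y. *)
definition R_star ::
  "('d::finite \<Rightarrow> 'n) \<Rightarrow> (real^'u) set \<Rightarrow> real \<Rightarrow> (real^'d \<Rightarrow> real^'u \<Rightarrow> real) \<Rightarrow>
   real^'u \<Rightarrow> real^'u^'d" where
  "R_star blk C \<eta> g y = jacobian (h_star blk \<eta> g) (at y within C)"

definition F_upper ::
  "('d::finite \<Rightarrow> 'n) \<Rightarrow> real \<Rightarrow> (real^'d \<Rightarrow> real^'u \<Rightarrow> real) \<Rightarrow>
   (real^'d \<Rightarrow> real^'u \<Rightarrow> real) \<Rightarrow> real^'u \<Rightarrow> real" where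
  "F_upper blk \<eta> f g y = f (h_star blk \<eta> g y) y"

definition grad_F ::
  "('d::finite \<Rightarrow> 'n) \<Rightarrow> (real^'u) set \<Rightarrow> real \<Rightarrow> (real^'d \<Rightarrow> real^'u \<Rightarrow> real^'d) \<Rightarrow>
   (real^'d \<Rightarrow> real^'u \<Rightarrow> real^'u) \<Rightarrow> (real^'d \<Rightarrow> real^'u \<Rightarrow> real) \<Rightarrow> real^'u \<Rightarrow> real^'u" where
  "grad_F blk C \<eta> f_h f_y g y =
     f_y (h_star blk \<eta> g y) y
     + transpose (R_star blk C \<eta> g y) *v f_h (h_star blk \<eta> g y) y"

(* The gradient in h of g_reg: the gradient of entropy at h > 0 is the componentwise ln h. *)
definition g_reg_h ::
  "real \<Rightarrow> (real^'d \<Rightarrow> real^'u \<Rightarrow> real^'d) \<Rightarrow> real^'d \<Rightarrow> real^'u \<Rightarrow> real^'d" where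
  "g_reg_h \<eta> g_h h y = g_h h y + \<eta> *\<^sub>R (\<chi> j. ln (h $ j))"

lemma has_derivative_entropy:
  fixes h :: "real^'d"
  assumes "\<And>j. h $ j > 0"
  shows "(entropy has_derivative (\<lambda>v. (\<chi> j. ln (h $ j)) \<bullet> v)) (at h)"
proof -
  have "((\<lambda>h::real^'d. \<Sum>j\<in>UNIV. h $ j * ln (h $ j) - h $ j)
          has_derivative (\<lambda>v. \<Sum>j\<in>UNIV. ln (h $ j) * v $ j)) (at h)"
  proof (rule has_derivative_sum)
    fix j
    have "((\<lambda>x::real. x * ln x - x) has_real_derivative ln (h $ j)) (at (h $ j))"
      using assms[of j] by (auto intro!: derivative_eq_intros)
    then have outer: "((\<lambda>x::real. x * ln x - x) has_derivative (*) (ln (h $ j))) (at (h $ j))"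
      by (simp add: has_field_derivative_def)
    have "((\<lambda>h::real^'d. h $ j) has_derivative (\<lambda>v. v $ j)) (at h)"
      by (rule bounded_linear_imp_has_derivative[OF bounded_linear_vec_nth])
    from has_derivative_compose[OF this outer]
    show "((\<lambda>h::real^'d. h $ j * ln (h $ j) - h $ j)
            has_derivative (\<lambda>v. ln (h $ j) * v $ j)) (at h)" .
  qed
  then show ?thesis
    by (simp add: entropy_def[abs_def] inner_vec_def)
qed

definition md_step ::
  "('d::finite \<Rightarrow> 'n) \<Rightarrow> real \<Rightarrow> (real^'d \<Rightarrow> real^'u \<Rightarrow> real^'d) \<Rightarrow> real \<Rightarrow> real^'u \<Rightarrow>
   real^'d \<Rightarrow> real^'d" where
  "md_step blk \<eta> g_h \<alpha> y h =
     (\<chi> j. h $ j * exp (- \<alpha> * g_reg_h \<eta> g_h h y $ j) /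
           (\<Sum>l\<in>blk -` {blk j}. h $ l * exp (- \<alpha> * g_reg_h \<eta> g_h h y $ l)))"

definition diag_mat :: "real^'d \<Rightarrow> real^'d^'d" where
  "diag_mat v = (\<chi> i j. if i = j then v $ i else 0)"

definition B_mat :: "('d \<Rightarrow> 'n) \<Rightarrow> real^'d \<Rightarrow> real^'d^'d" where
  "B_mat blk h =
     diag_mat h - (\<chi> i j. if blk i = blk j then h $ i * h $ j else 0)"

primrec inner_h ::
  "('d::finite \<Rightarrow> 'n) \<Rightarrow> real \<Rightarrow> (real^'d \<Rightarrow> real^'u \<Rightarrow> real^'d) \<Rightarrow> real \<Rightarrow> real^'u \<Rightarrow>
   real^'d \<Rightarrow> nat \<Rightarrow> real^'d" where
  "inner_h blk \<eta> g_h \<alpha> y h0 0 = h0"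
| "inner_h blk \<eta> g_h \<alpha> y h0 (Suc t) = md_step blk \<eta> g_h \<alpha> y (inner_h blk \<eta> g_h \<alpha> y h0 t)"

primrec inner_R ::
  "('d::finite \<Rightarrow> 'n) \<Rightarrow> real \<Rightarrow> (real^'d \<Rightarrow> real^'u \<Rightarrow> real^'d) \<Rightarrow>
   (real^'d \<Rightarrow> real^'u \<Rightarrow> real^'d^'d) \<Rightarrow> (real^'d \<Rightarrow> real^'u \<Rightarrow> real^'u^'d) \<Rightarrow>
   real \<Rightarrow> real^'u \<Rightarrow> real^'d \<Rightarrow> nat \<Rightarrow> real^'u^'d" where
  "inner_R blk \<eta> g_h g_hh g_hy \<alpha> y h0 0 = 0"
| "inner_R blk \<eta> g_h g_hh g_hy \<alpha> y h0 (Suc t) =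
     (let h = inner_h blk \<eta> g_h \<alpha> y h0 t;
          B = B_mat blk (inner_h blk \<eta> g_h \<alpha> y h0 (Suc t));
          M = B ** ((1 - \<eta> * \<alpha>) *\<^sub>R diag_mat (\<chi> j. 1 / h $ j) - \<alpha> *\<^sub>R g_hh h y);
          U = - \<alpha> *\<^sub>R (B ** g_hy h y)
      in M ** inner_R blk \<eta> g_h g_hh g_hy \<alpha> y h0 t + U)"

definition approx_grad_F ::
  "('d::finite \<Rightarrow> 'n) \<Rightarrow> real \<Rightarrow>
   (real^'d \<Rightarrow> real^'u \<Rightarrow> real^'d) \<Rightarrow> (real^'d \<Rightarrow> real^'u \<Rightarrow> real^'u) \<Rightarrow>
   (real^'d \<Rightarrow> real^'u \<Rightarrow> real^'d) \<Rightarrow> (real^'d \<Rightarrow> real^'u \<Rightarrow> real^'d^'d) \<Rightarrow>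
   (real^'d \<Rightarrow> real^'u \<Rightarrow> real^'u^'d) \<Rightarrow> real \<Rightarrow> nat \<Rightarrow> real^'u \<Rightarrow> real^'d \<Rightarrow> real^'u" where
  "approx_grad_F blk \<eta> f_h f_y g_h g_hh g_hy \<alpha> D y h0 =
     (let hD = inner_h blk \<eta> g_h \<alpha> y h0 D
      in f_y hD y + transpose (inner_R blk \<eta> g_h g_hh g_hy \<alpha> y h0 D) *v f_h hD y)"

(* The pair (y^k, h^{k,0}); the lower level is warm-started, h^{k+1,0} = h^{k,D}.  \<alpha> and \<beta> are
   step size sequences. *)
primrec bilevel_iter ::
  "('d::finite \<Rightarrow> 'n) \<Rightarrow> (real^'u) set \<Rightarrow> real \<Rightarrow>
   (real^'d \<Rightarrow> real^'u \<Rightarrow> real^'d) \<Rightarrow> (real^'d \<Rightarrow> real^'u \<Rightarrow> real^'u) \<Rightarrow>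
   (real^'d \<Rightarrow> real^'u \<Rightarrow> real^'d) \<Rightarrow> (real^'d \<Rightarrow> real^'u \<Rightarrow> real^'d^'d) \<Rightarrow>
   (real^'d \<Rightarrow> real^'u \<Rightarrow> real^'u^'d) \<Rightarrow> (nat \<Rightarrow> real) \<Rightarrow> (nat \<Rightarrow> real) \<Rightarrow> nat \<Rightarrow>
   real^'u \<Rightarrow> real^'d \<Rightarrow> nat \<Rightarrow> (real^'u) \<times> (real^'d)" where
  "bilevel_iter blk C \<eta> f_h f_y g_h g_hh g_hy \<alpha> \<beta> D y0 h0 0 = (y0, h0)"
| "bilevel_iter blk C \<eta> f_h f_y g_h g_hh g_hy \<alpha> \<beta> D y0 h0 (Suc k) =
     (let (y, h) = bilevel_iter blk C \<eta> f_h f_y g_h g_hh g_hy \<alpha> \<beta> D y0 h0 k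
      in (closest_point C
            (y - \<beta> k *\<^sub>R approx_grad_F blk \<eta> f_h f_y g_h g_hh g_hy (\<alpha> k) D y h),
          inner_h blk \<eta> g_h (\<alpha> k) y h D))"

definition y_iter ::
  "('d::finite \<Rightarrow> 'n) \<Rightarrow> (real^'u) set \<Rightarrow> real \<Rightarrow>
   (real^'d \<Rightarrow> real^'u \<Rightarrow> real^'d) \<Rightarrow> (real^'d \<Rightarrow> real^'u \<Rightarrow> real^'u) \<Rightarrow>
   (real^'d \<Rightarrow> real^'u \<Rightarrow> real^'d) \<Rightarrow> (real^'d \<Rightarrow> real^'u \<Rightarrow> real^'d^'d) \<Rightarrow>
   (real^'d \<Rightarrow> real^'u \<Rightarrow> real^'u^'d) \<Rightarrow> (nat \<Rightarrow> real) \<Rightarrow> (nat \<Rightarrow> real) \<Rightarrow> nat \<Rightarrow>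
   real^'u \<Rightarrow> real^'d \<Rightarrow> nat \<Rightarrow> real^'u" where
  "y_iter blk C \<eta> f_h f_y g_h g_hh g_hy \<alpha> \<beta> D y0 h0 k =
     fst (bilevel_iter blk C \<eta> f_h f_y g_h g_hh g_hy \<alpha> \<beta> D y0 h0 k)"

end

theory Submission
  imports Defs
begin

text \<open>
  The upper-level iteration is a projected gradient method for the reduced objective
  \<open>F y = f (h* y) y\<close>, where \<open>h*\<close> is the lower-level solution map, with an inexact gradient.  If the
  gradient error is at most \<open>\<epsilon>\<close> in every iteration and \<open>F\<close> satisfies a quadratic upper bound along
  \<open>C\<close>, then for small step sizes the decrease of \<open>F\<close> controls the squared steps, and the residual
  of the projection exhibits a normal vector that is close to the negative gradient
  (\<open>average_stationarity_bound\<close>).  The averaged squared distance is therefore of order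
  \<open>1 / K + \<epsilon>\<^sup>2\<close>, and it remains to show that \<open>\<epsilon>\<close> decays geometrically in \<open>D\<close>, uniformly in the
  upper-level point and in the starting point of the lower-level iteration.

  Lower level.  The regularized objective is strongly convex and smooth relative to the entropy, so
  mirror descent contracts the Kullback-Leibler divergence to the solution
  (\<open>md_step_contraction\<close>).  In logarithmic coordinates the spread within each block stays bounded
  along the iteration (\<open>md_step_log_box\<close>); hence all iterates and solutions have coordinates at
  least a fixed \<open>\<kappa> > 0\<close>, and all constants below are uniform.  The solution itself is obtained
  from Brouwer's theorem as a point satisfying the first-order conditions (\<open>kkt_exists\<close>).

  Sensitivity.  Let \<open>B\<close> be the matrix \<open>blkdiag (diag h - h h^T)\<close> at the solution and let
  \<open>H\<close>, \<open>G\<close> be the second derivatives of \<open>g\<close>.  Differentiating the optimality conditions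
  gives \<open>\<eta> R + B H R = - B G\<close>.  In the local norm \<open>wnorm\<close>, with weights \<open>1 / h\<close>, the operator
  \<open>\<eta> I + B H\<close> is coercive on the tangent space of the product of simplices (\<open>wnorm_coercive\<close>),
  because \<open>\<langle>v, B x\<rangle>\<close> in the local inner product equals the Euclidean product of \<open>v\<close> and \<open>x\<close>.
  So \<open>R\<close> exists, depends Lipschitz continuously on \<open>y\<close>, and approximates the solution map up to
  second order (\<open>sens_lipschitz\<close>, \<open>hs_linearization\<close>).  This gives the quadratic upper bound for
  \<open>F\<close> and the Lipschitz continuity of its gradient.

  Differentiated iterates.  At the solution the recursion for \<open>R\<close> acts on the tangent space as
  \<open>v \<mapsto> (1 - \<alpha> \<eta>) v - \<alpha> B H v\<close>, a contraction in the local norm for small \<open>\<alpha>\<close>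
  (\<open>wnorm_contraction\<close>), and the fixed point is the sensitivity matrix.  The actual coefficients
  differ from those at the solution by the geometrically small error of the iterates, so the
  differentiated iterates converge geometrically as well (\<open>inner_R_converges\<close>).

  If \<open>C\<close> has empty interior, the derivative of the solution map within \<open>C\<close> need not be the matrix
  \<open>R\<close> above, but both agree on the directions \<open>y' - y\<close> with \<open>y' \<in> C\<close>, and the distance to the
  normal cone does not see the difference (\<open>infdist_grad_F_le\<close>).
\<close>

section \<open>Differentiation on convex sets\<close>

text \<open>The derivative need only be Lipschitz relative to the base point \<open>x\<close>.\<close>

lemma lipschitz_derivative_remainder:
  fixes \<phi> :: "'a::real_normed_vector \<Rightarrow> 'b::real_normed_vector"
  assumes S: "convex S" "x \<in> S" "x' \<in> S"
    and deriv: "\<And>z. z \<in> S \<Longrightarrow> (\<phi> has_derivative \<phi>' z) (at z within S)"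
    and lip: "\<And>z v. z \<in> S \<Longrightarrow> norm (\<phi>' z v - \<phi>' x v) \<le> L * norm (z - x) * norm v"
    and L: "L \<ge> 0"
  shows "norm (\<phi> x' - \<phi> x - \<phi>' x (x' - x)) \<le> L * (norm (x' - x))\<^sup>2"
proof -
  let ?T = "closed_segment x x'"
  have T: "?T \<subseteq> S"
    using S by (simp add: closed_segment_subset)
  have "norm (\<phi> x' - \<phi> x - \<phi>' x (x' - x)) \<le> norm (x' - x) * (L * norm (x' - x))"
  proof (rule differentiable_bound_linearization[where S = ?T])
    show "x + t *\<^sub>R (x' - x) \<in> ?T" if "t \<in> {0..1}" for t
      using that by (auto simp: in_segment algebra_simps)
    show "(\<phi> has_derivative \<phi>' z) (at z within ?T)" if "z \<in> ?T" for z
      using deriv T that has_derivative_subset by blast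
    show "onorm (\<phi>' z - \<phi>' x) \<le> L * norm (x' - x)" if z: "z \<in> ?T" for z
    proof (rule onorm_bound)
      fix v
      have "norm (\<phi>' z v - \<phi>' x v) \<le> L * norm (z - x) * norm v"
        using lip T z by blast
      also have "\<dots> \<le> L * norm (x' - x) * norm v"
        using L segment_bound1[OF z] by (intro mult_right_mono mult_left_mono) auto
      finally show "norm ((\<phi>' z - \<phi>' x) v) \<le> L * norm (x' - x) * norm v"
        by simp
    qed (use L in auto)
    show "x \<in> ?T" by simp
  qed
  then show ?thesis
    by (simp add: power2_eq_square mult_ac)
qed

lemma has_vector_derivative_along_segment:
  fixes \<phi> :: "'a::real_normed_vector \<Rightarrow> 'b::real_normed_vector"
  assumes S: "convex S" "x \<in> S" "x' \<in> S"
    and deriv: "(\<phi> has_derivative A) (at x within S)"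
  shows "((\<lambda>t. \<phi> (x + t *\<^sub>R (x' - x))) has_vector_derivative A (x' - x)) (at 0 within {0..1})"
proof -
  have seg: "(\<lambda>t. x + t *\<^sub>R (x' - x)) ` {0..1} \<subseteq> S"
  proof clarify
    fix t :: real assume "t \<in> {0..1}"
    then have "x + t *\<^sub>R (x' - x) \<in> closed_segment x x'"
      by (auto simp: in_segment algebra_simps)
    then show "x + t *\<^sub>R (x' - x) \<in> S"
      using S closed_segment_subset by blast
  qed
  have 1: "((\<lambda>t. x + t *\<^sub>R (x' - x)) has_derivative (\<lambda>t. t *\<^sub>R (x' - x))) (at 0 within {0..1})"
    by (auto intro!: derivative_eq_intros)
  have "(\<phi> has_derivative A) (at (x + 0 *\<^sub>R (x' - x)) within (\<lambda>t. x + t *\<^sub>R (x' - x)) ` {0..1})"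
    using has_derivative_subset[OF deriv seg] by simp
  from has_derivative_in_compose[OF 1 this]
  have "((\<lambda>t. \<phi> (x + t *\<^sub>R (x' - x))) has_derivative (\<lambda>t. A (t *\<^sub>R (x' - x)))) (at 0 within {0..1})" .
  moreover have "A (t *\<^sub>R (x' - x)) = t *\<^sub>R A (x' - x)" for t
    using deriv by (simp add: has_derivative_bounded_linear linear_simps(5))
  ultimately show ?thesis
    by (simp add: has_vector_derivative_def)
qed

text \<open>A derivative within a convex set with empty interior is not unique, but its values on the
  directions pointing into the set are.\<close>

lemma has_derivative_within_convex_unique:
  fixes \<phi> :: "'a::real_normed_vector \<Rightarrow> 'b::real_normed_vector"
  assumes "convex S" "x \<in> S" "x' \<in> S"
    and "(\<phi> has_derivative A) (at x within S)" "(\<phi> has_derivative A') (at x within S)"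
  shows "A (x' - x) = A' (x' - x)"
  using vector_derivative_unique_within[OF _ has_vector_derivative_along_segment[OF assms(1-4)]
      has_vector_derivative_along_segment[OF assms(1-3,5)]]
  by (simp add: at_within_Icc_at_right)

lemma has_derivative_within_convex_tendsto:
  fixes \<phi> :: "'a::real_normed_vector \<Rightarrow> real"
  assumes S: "convex S" "x \<in> S" "x' \<in> S"
    and deriv: "(\<phi> has_derivative A) (at x within S)"
  shows "((\<lambda>t. (\<phi> (x + t *\<^sub>R (x' - x)) - \<phi> x) / t) \<longlongrightarrow> A (x' - x)) (at_right 0)"
  using has_vector_derivative_along_segment[OF assms]
  by (simp add: at_within_Icc_at_right has_field_derivative_iff
      flip: has_real_derivative_iff_has_vector_derivative)

lemma convex_on_first_order:
  fixes \<phi> :: "'a::real_normed_vector \<Rightarrow> real"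
  assumes conv: "convex_on S \<phi>" and x: "x \<in> S" "x' \<in> S"
    and deriv: "(\<phi> has_derivative A) (at x within S)"
  shows "\<phi> x' \<ge> \<phi> x + A (x' - x)"
proof -
  have "\<forall>\<^sub>F t in at_right 0. (\<phi> (x + t *\<^sub>R (x' - x)) - \<phi> x) / t \<le> \<phi> x' - \<phi> x"
  proof (rule eventually_at_rightI)
    fix t :: real assume t: "t \<in> {0<..<1}"
    have "\<phi> ((1 - t) *\<^sub>R x + t *\<^sub>R x') \<le> (1 - t) * \<phi> x + t * \<phi> x'"
      using convex_onD[OF conv _ _ x, of t] t by simp
    moreover have "(1 - t) *\<^sub>R x + t *\<^sub>R x' = x + t *\<^sub>R (x' - x)"
      by (simp add: algebra_simps)
    ultimately show "(\<phi> (x + t *\<^sub>R (x' - x)) - \<phi> x) / t \<le> \<phi> x' - \<phi> x"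
      using t by (simp add: field_simps)
  qed simp
  then have "A (x' - x) \<le> \<phi> x' - \<phi> x"
    using tendsto_upperbound[OF has_derivative_within_convex_tendsto[OF _ x deriv]]
      convex_on_imp_convex[OF conv] by auto
  then show ?thesis by simp
qed

section \<open>Matrix norms and elementary inequalities\<close>

lemma norm_le_inner_bound:
  fixes u :: "'a::real_inner"
  assumes "\<And>w. u \<bullet> w \<le> c * norm w" "c \<ge> 0"
  shows "norm u \<le> c"
proof (cases "u = 0")
  case False
  have "norm u * norm u \<le> c * norm u"
    using assms(1)[of u] by (simp add: dot_square_norm power2_eq_square)
  then show ?thesis using False by simp
qed (use assms in auto)

lemma norm_matrix_vector_le_spectral_norm:
  fixes A :: "real^'u^'d"
  shows "norm (A *v v) \<le> spectral_norm A * norm v"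
  unfolding spectral_norm_def by (rule onorm[OF matrix_vector_mul_bounded_linear])

lemma spectral_lipschitz_onD:
  fixes A :: "'a::metric_space \<Rightarrow> real^'u^'d"
  assumes "spectral_lipschitz_on L S A" "x \<in> S" "x' \<in> S"
  shows "norm (A x *v v - A x' *v v) \<le> \<bar>L\<bar> * dist x x' * norm v"
proof -
  have "norm (A x *v v - A x' *v v) \<le> spectral_norm (A x - A x') * norm v"
    using norm_matrix_vector_le_spectral_norm[of "A x - A x'" v]
    by (simp add: matrix_vector_mult_diff_rdistrib)
  also have "spectral_norm (A x - A x') \<le> L * dist x x'"
    using assms unfolding spectral_lipschitz_on_def by blast
  also have "L * dist x x' \<le> \<bar>L\<bar> * dist x x'"
    by (intro mult_right_mono) auto
  finally show ?thesis
    by (simp add: mult_right_mono)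
qed

lemma inner_transpose_mult: "(transpose (R :: real^'u^'d) *v x) \<bullet> w = x \<bullet> (R *v w)"
  by (simp add: dot_lmul_matrix)

lemma square_sum3_le: "(a + b + c)\<^sup>2 \<le> 3 * (a\<^sup>2 + b\<^sup>2 + c\<^sup>2)" for a b c :: real
  using zero_le_power2[of "a - b"] zero_le_power2[of "a - c"] zero_le_power2[of "b - c"]
  by (simp add: power2_eq_square algebra_simps)

text \<open>On \<open>(0, 1]\<close> the function \<open>x ln x - x\<close> is 1-strongly convex, its second derivative being \<open>1 / x\<close>.\<close>

lemma kl_term_lower_bound:
  fixes a b :: real
  assumes "0 \<le> a" "a \<le> 1" "0 < b" "b \<le> 1"
  shows "a * (ln a - ln b) - a + b \<ge> (a - b)\<^sup>2 / 2"
proof (cases "a = 0")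
  case True
  have "b * b \<le> b * 1" using assms by (intro mult_left_mono) auto
  then show ?thesis using True assms by (simp add: power2_eq_square)
next
  case False
  define \<phi> where "\<phi> x = x * (ln x - ln b) - x + b - (x - b)\<^sup>2 / 2" for x
  have der: "(\<phi> has_real_derivative (ln x - ln b - (x - b))) (at x)" if "x > 0" for x
    unfolding \<phi>_def using that assms
    by (auto intro!: derivative_eq_intros simp: field_simps)
  have mono: "ln y - y \<le> ln x - x" if "0 < y" "y \<le> x" "x \<le> 1" for x y :: real
  proof -
    have "ln (y / x) \<le> y / x - 1" using that by (intro ln_le_minus_one) auto
    also have "\<dots> = (y - x) / x" using that by (simp add: field_simps)
    also have "\<dots> \<le> y - x"
    proof -
      have "(x - y) * x \<le> (x - y) * 1" using that by (intro mult_left_mono) auto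
      then show ?thesis using that by (simp add: field_simps)
    qed
    finally show ?thesis using that by (simp add: ln_div)
  qed
  have "\<phi> b \<le> \<phi> a"
  proof (cases "b \<le> a")
    case True
    show ?thesis
    proof (rule DERIV_nonneg_imp_nondecreasing[OF True])
      fix x assume "b \<le> x" "x \<le> a"
      then show "\<exists>y. (\<phi> has_real_derivative y) (at x) \<and> 0 \<le> y"
        using assms by (intro exI[of _ "ln x - ln b - (x - b)"] conjI der) (use mono[of b x] in auto)
    qed
  next
    case F: False
    then have "a \<le> b" by simp
    then show ?thesis
    proof (rule DERIV_nonpos_imp_nonincreasing)
      fix x assume "a \<le> x" "x \<le> b"
      then show "\<exists>y. (\<phi> has_real_derivative y) (at x) \<and> y \<le> 0"
        using assms False by (intro exI[of _ "ln x - ln b - (x - b)"] conjI der) (use mono[of x b] in auto)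
    qed
  qed
  then show ?thesis by (simp add: \<phi>_def)
qed

lemma ln_linearization_error:
  fixes a b \<kappa> :: real
  assumes "0 < \<kappa>" "\<kappa> \<le> a" "\<kappa> \<le> b"
  shows "\<bar>(a - b) / b - (ln a - ln b)\<bar> \<le> (a - b)\<^sup>2 / \<kappa>\<^sup>2"
proof -
  have ab: "a > 0" "b > 0" using assms by auto
  have 1: "ln a - ln b \<le> (a - b) / b"
    using ln_le_minus_one[of "a / b"] ab by (simp add: ln_div field_simps)
  have 2: "ln b - ln a \<le> (b - a) / a"
    using ln_le_minus_one[of "b / a"] ab by (simp add: ln_div field_simps)
  have "(a - b) / b - (ln a - ln b) \<le> (a - b) / b + (b - a) / a"
    using 2 by simp
  also have "\<dots> = (a - b)\<^sup>2 / (a * b)"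
    using ab by (simp add: field_simps power2_eq_square)
  also have "\<dots> \<le> (a - b)\<^sup>2 / \<kappa>\<^sup>2"
    using assms ab by (intro divide_left_mono) (auto simp: power2_eq_square intro!: mult_mono)
  finally show ?thesis using 1 by simp
qed

section \<open>A perturbed linear recursion\<close>

text \<open>A contraction with factor \<open>r\<close>, perturbed by terms of size \<open>r ^ t\<close>, still decays at every
  rate \<open>q > r\<close>.  The bound \<open>A\<close> depends on \<open>r\<close>, \<open>q\<close> and \<open>c\<close> only, not on the sequence.\<close>

lemma perturbed_geometric_recursion:
  fixes r q c :: real
  assumes r: "0 < r" "r < q" "q < 1" and c: "c \<ge> 0"
  shows "\<exists>A\<ge>0. \<forall>a :: nat \<Rightarrow> real. a 0 \<le> c \<longrightarrow>
           (\<forall>t. a (Suc t) \<le> r * a t + c * r ^ t * (a t + 1)) \<longrightarrow> (\<forall>t. a t \<le> A * q ^ t)"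
proof -
  define d where "d = (q - r) / 2"
  have d: "d > 0" using r by (simp add: d_def)
  have q0: "q > 0" using r by simp
  have "(\<lambda>t. c * r ^ t) \<longlonglongrightarrow> c * 0"
    using r by (intro tendsto_mult tendsto_const LIMSEQ_realpow_zero) auto
  then have "\<forall>\<^sub>F t in sequentially. c * r ^ t < d"
    using d by (intro order_tendstoD(2)[where y = "c * 0"]) auto
  then obtain T where T: "\<And>t. t \<ge> T \<Longrightarrow> c * r ^ t < d"
    by (auto simp: eventually_sequentially)
  \<comment> \<open>the extremal sequence, which dominates every other one\<close>
  define m where "m = rec_nat c (\<lambda>t x. r * x + c * r ^ t * (x + 1))"
  have m0: "m 0 = c" and mS: "m (Suc t) = r * m t + c * r ^ t * (m t + 1)" for t
    by (simp_all add: m_def)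
  have mpos: "m t \<ge> 0" for t
    by (induction t) (use r c in \<open>auto simp: m0 mS intro!: add_nonneg_nonneg mult_nonneg_nonneg\<close>)
  define A where "A = (\<Sum>t\<le>T. m t / q ^ t) + c / d"
  have A0: "A \<ge> 0"
    unfolding A_def using mpos q0 c d by (intro add_nonneg_nonneg sum_nonneg divide_nonneg_nonneg) auto
  have early: "m t \<le> A * q ^ t" if "t \<le> T" for t
  proof -
    have "m t / q ^ t \<le> (\<Sum>t\<le>T. m t / q ^ t)"
      using that mpos q0 by (intro member_le_sum) auto
    also have "\<dots> \<le> A" using c d by (simp add: A_def)
    finally show ?thesis using q0 by (simp add: field_simps)
  qed
  have late: "m t \<le> A * q ^ t" if "t \<ge> T" for t
    using that
  proof (induction t rule: dec_induct)
    case base then show ?case using early by simp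
  next
    case (step t)
    have rq: "r ^ t \<le> q ^ t" using r by (intro power_mono) auto
    have "m (Suc t) = (r + c * r ^ t) * m t + c * r ^ t"
      by (simp add: mS algebra_simps)
    also have "\<dots> \<le> (r + d) * (A * q ^ t) + c * q ^ t"
      using step T[of t] r c rq mpos[of t] d
      by (intro add_mono mult_mono mult_left_mono) auto
    also have "\<dots> \<le> (r + d) * (A * q ^ t) + (d * A) * q ^ t"
    proof -
      have "c / d \<le> A" unfolding A_def using mpos q0 by (simp add: sum_nonneg)
      then have "c \<le> d * A" using d by (simp add: field_simps)
      then show ?thesis using q0 by (intro add_left_mono mult_right_mono) auto
    qed
    also have "\<dots> = (r + 2 * d) * (A * q ^ t)" by (simp add: algebra_simps)
    also have "r + 2 * d = q" by (simp add: d_def field_simps)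
    also have "q * (A * q ^ t) = A * q ^ Suc t" by simp
    finally show ?case .
  qed
  show ?thesis
  proof (intro exI[of _ A] conjI A0 allI impI)
    fix a :: "nat \<Rightarrow> real" and t
    assume a0: "a 0 \<le> c" and aS: "\<forall>t. a (Suc t) \<le> r * a t + c * r ^ t * (a t + 1)"
    have "a t \<le> m t" for t
    proof (induction t)
      case (Suc t)
      have "a (Suc t) \<le> r * a t + c * r ^ t * (a t + 1)" using aS by blast
      also have "\<dots> \<le> m (Suc t)"
        unfolding mS using Suc r c by (intro add_mono mult_left_mono) auto
      finally show ?case .
    qed (simp add: a0 m0)
    moreover have "m t \<le> A * q ^ t" using early late by (cases "t \<le> T") auto
    ultimately show "a t \<le> A * q ^ t" by (meson order_trans)
  qed
qed

section \<open>Products of simplices and their tangent space\<close>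

text \<open>The linear space parallel to the product of simplices: all block sums vanish.\<close>

definition tangent :: "('d::finite \<Rightarrow> 'n) \<Rightarrow> (real^'d) set" where
  "tangent blk = {v. \<forall>i. (\<Sum>j\<in>blk -` {i}. v $ j) = 0}"

text \<open>The vectors that are constant on each block; they form the orthogonal complement of the
  tangent space.\<close>

definition block_constant :: "('d::finite \<Rightarrow> 'n) \<Rightarrow> real^'d \<Rightarrow> bool" where
  "block_constant blk c \<longleftrightarrow> (\<forall>j l. blk j = blk l \<longrightarrow> c $ j = c $ l)"

lemma block_constantD: "block_constant blk c \<Longrightarrow> blk j = blk l \<Longrightarrow> c $ j = c $ l"
  unfolding block_constant_def by blast

lemma block_constant_scaleR:
  assumes "block_constant blk c"
  shows "block_constant blk (r *\<^sub>R c)"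
  unfolding block_constant_def
proof (intro allI impI)
  fix j l assume "blk j = blk l"
  then have "c $ j = c $ l" by (rule block_constantD[OF assms])
  then show "(r *\<^sub>R c) $ j = (r *\<^sub>R c) $ l" by simp
qed

lemma tangent_diff: "v \<in> tangent blk \<Longrightarrow> w \<in> tangent blk \<Longrightarrow> v - w \<in> tangent blk"
  and tangent_scaleR: "v \<in> tangent blk \<Longrightarrow> c *\<^sub>R v \<in> tangent blk"
  and tangent_uminus: "v \<in> tangent blk \<Longrightarrow> - v \<in> tangent blk"
  and tangent_0: "0 \<in> tangent blk"
  by (auto simp: tangent_def sum.distrib sum_subtractf sum_negf simp flip: sum_distrib_left)

lemma simplices_diff_tangent:
  "h \<in> simplices blk \<Longrightarrow> h' \<in> simplices blk \<Longrightarrow> h - h' \<in> tangent blk"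
  by (simp add: simplices_def tangent_def sum_subtractf)

lemma sum_over_blocks:
  fixes blk :: "'d::finite \<Rightarrow> 'n::finite" and F :: "'d \<Rightarrow> real"
  shows "(\<Sum>j\<in>UNIV. F j) = (\<Sum>i\<in>UNIV. \<Sum>j\<in>blk -` {i}. F j)"
  using sum.group[of UNIV UNIV blk F] by (simp add: vimage_def)

lemma block_constant_inner_tangent:
  fixes blk :: "'d::finite \<Rightarrow> 'n::finite"
  assumes c: "block_constant blk c" and v: "v \<in> tangent blk"
  shows "c \<bullet> v = 0"
proof -
  have "(\<Sum>j\<in>blk -` {i}. c $ j * v $ j) = 0" for i
  proof (cases "blk -` {i} = {}")
    case False
    then obtain l where l: "blk l = i" by auto
    have "(\<Sum>j\<in>blk -` {i}. c $ j * v $ j) = (\<Sum>j\<in>blk -` {i}. c $ l * v $ j)"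
    proof (rule sum.cong[OF refl])
      fix j assume "j \<in> blk -` {i}"
      then have "c $ j = c $ l" using l by (intro block_constantD[OF c]) simp
      then show "c $ j * v $ j = c $ l * v $ j" by simp
    qed
    also have "\<dots> = 0" using v by (simp add: tangent_def flip: sum_distrib_left)
    finally show ?thesis .
  qed simp
  then show ?thesis
    unfolding inner_vec_def sum_over_blocks[of _ blk] by simp
qed

lemma simplices_block_sum: "h \<in> simplices blk \<Longrightarrow> (\<Sum>l\<in>blk -` {i}. h $ l) = 1"
  and simplices_nonneg: "h \<in> simplices blk \<Longrightarrow> 0 \<le> h $ j"
  by (auto simp: simplices_def)

lemma simplices_le_1:
  assumes "h \<in> simplices blk"
  shows "h $ j \<le> 1"
proof -
  have "h $ j \<le> (\<Sum>l\<in>blk -` {blk j}. h $ l)"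
    using assms by (intro member_le_sum) (auto simp: simplices_def)
  then show ?thesis using assms by (simp add: simplices_def)
qed

lemma convex_simplices: "convex (simplices blk)"
  by (rule convexI) (auto simp: simplices_def sum.distrib simp flip: sum_distrib_left)

lemma compact_simplices:
  fixes blk :: "'d::finite \<Rightarrow> 'n"
  shows "compact (simplices blk)"
proof (rule compact_eq_bounded_closed[THEN iffD2, OF conjI])
  show "bounded (simplices blk)"
  proof (rule boundedI)
    fix h assume h: "h \<in> simplices blk"
    have "norm h \<le> (\<Sum>j\<in>UNIV. \<bar>h $ j\<bar>)" by (rule norm_le_l1_cart)
    also have "\<dots> \<le> (\<Sum>j\<in>(UNIV :: 'd set). 1)"
      using simplices_nonneg[OF h] simplices_le_1[OF h] by (intro sum_mono) simp
    finally show "norm h \<le> (\<Sum>j\<in>(UNIV :: 'd set). 1)" .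
  qed
  have "simplices blk = (\<Inter>j. {h. h $ j \<ge> 0}) \<inter> (\<Inter>i. {h. (\<Sum>j\<in>blk -` {i}. h $ j) = 1})"
    by (auto simp: simplices_def)
  also have "closed \<dots>"
    by (intro closed_Int closed_INT ballI closed_Collect_le closed_Collect_eq continuous_intros)
  finally show "closed (simplices blk)" .
qed

text \<open>Normalizing positive weights inside each block gives a point of the product of simplices.\<close>

definition block_normalize :: "('d::finite \<Rightarrow> 'n) \<Rightarrow> real^'d \<Rightarrow> real^'d" where
  "block_normalize blk x = (\<chi> j. x $ j / (\<Sum>l\<in>blk -` {blk j}. x $ l))"

lemma block_normalize_pos:
  assumes "\<And>j. x $ j > 0"
  shows "block_normalize blk x $ j > 0"
  unfolding block_normalize_def using assms by (auto intro!: divide_pos_pos sum_pos)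

lemma block_normalize_in_simplices:
  assumes blk: "surj blk" and x: "\<And>j. x $ j > 0"
  shows "block_normalize blk x \<in> simplices blk"
proof -
  have "(\<Sum>j\<in>blk -` {i}. block_normalize blk x $ j) = 1" for i
  proof -
    obtain l where l: "blk l = i" using blk by (metis surjD)
    have pos: "(\<Sum>l\<in>blk -` {i}. x $ l) > 0"
      using x l by (intro sum_pos) auto
    have "(\<Sum>j\<in>blk -` {i}. block_normalize blk x $ j)
        = (\<Sum>j\<in>blk -` {i}. x $ j / (\<Sum>l\<in>blk -` {i}. x $ l))"
      by (intro sum.cong) (auto simp: block_normalize_def)
    also have "\<dots> = 1" using pos by (simp flip: sum_divide_distrib)
    finally show ?thesis .
  qed
  moreover have "block_normalize blk x $ j \<ge> 0" for j
    using block_normalize_pos[of x blk j, OF x] by simp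
  ultimately show ?thesis by (simp add: simplices_def)
qed

text \<open>The componentwise logarithm, which is the gradient of the entropy.\<close>

definition ln_vec :: "real^'d \<Rightarrow> real^'d" where
  "ln_vec h = (\<chi> j. ln (h $ j))"

lemma block_constant_ln_normalize:
  assumes x: "\<And>j. x $ j > 0"
  shows "block_constant blk (ln_vec (block_normalize blk x) - ln_vec x)"
  unfolding block_constant_def
proof (intro allI impI)
  fix j l assume jl: "blk j = blk l"
  have pos: "(\<Sum>l\<in>blk -` {blk j}. x $ l) > 0" for j
    using x by (intro sum_pos) auto
  show "(ln_vec (block_normalize blk x) - ln_vec x) $ j = (ln_vec (block_normalize blk x) - ln_vec x) $ l"
    using jl x[of j] x[of l] pos[of j] pos[of l]
    by (simp add: ln_vec_def block_normalize_def ln_div)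
qed

lemma simplices_nonempty: "surj blk \<Longrightarrow> simplices blk \<noteq> {}"
  using block_normalize_in_simplices[of blk "\<chi> j. 1"] by auto

section \<open>The matrix \<open>B\<close> and the local norm\<close>

lemma B_mat_mult_nth:
  "(B_mat blk h *v x) $ j = h $ j * (x $ j - (\<Sum>l\<in>blk -` {blk j}. h $ l * x $ l))"
proof -
  have "(B_mat blk h *v x) $ j
      = (\<Sum>l\<in>UNIV. (if j = l then h $ j * x $ l else 0))
        - (\<Sum>l\<in>UNIV. (if l \<in> blk -` {blk j} then h $ j * (h $ l * x $ l) else 0))"
    unfolding matrix_vector_mult_def B_mat_def diag_mat_def sum_subtractf[symmetric]
    by (auto intro!: sum.cong simp: algebra_simps)
  also have "\<dots> = h $ j * x $ j - (\<Sum>l\<in>blk -` {blk j}. h $ j * (h $ l * x $ l))"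
    by (subst sum.inter_restrict[symmetric]) auto
  finally show ?thesis
    by (simp add: right_diff_distrib sum_distrib_left)
qed

lemma diag_mat_mult: "diag_mat x *v v = (\<chi> j. x $ j * v $ j)"
proof -
  have "(diag_mat x *v v) $ j = (\<Sum>l\<in>UNIV. if j = l then x $ j * v $ j else 0)" for j
    unfolding matrix_vector_mult_def diag_mat_def vec_lambda_beta by (intro sum.cong) auto
  then show ?thesis by (simp add: vec_eq_iff)
qed

text \<open>The norm with weights \<open>1 / h\<close> for positive \<open>h\<close>; this is the local norm of the entropy at \<open>h\<close>, and \<open>B\<close> is
  the inverse of its Gram matrix on the tangent space.\<close>

definition wnorm :: "real^'d \<Rightarrow> real^'d \<Rightarrow> real" where
  "wnorm h v = norm (\<chi> j. v $ j / sqrt (h $ j))"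

lemma wnorm_nonneg: "wnorm h v \<ge> 0"
  by (simp add: wnorm_def)

lemma wnorm_triangle: "wnorm h (v + w) \<le> wnorm h v + wnorm h w"
proof -
  have "(\<chi> j. (v + w) $ j / sqrt (h $ j)) = (\<chi> j. v $ j / sqrt (h $ j)) + (\<chi> j. w $ j / sqrt (h $ j))"
    by (simp add: vec_eq_iff add_divide_distrib)
  then show ?thesis unfolding wnorm_def by (simp add: norm_triangle_ineq)
qed

lemma wnorm_square:
  assumes "\<And>j. h $ j > 0"
  shows "(wnorm h v)\<^sup>2 = (\<Sum>j\<in>UNIV. (v $ j)\<^sup>2 / h $ j)"
  using assms unfolding wnorm_def dot_square_norm[symmetric] inner_vec_def
  by (simp add: power2_eq_square less_imp_le)

lemma norm_le_wnorm:
  assumes "\<And>j. h $ j > 0" "\<And>j. h $ j \<le> 1"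
  shows "norm v \<le> wnorm h v"
proof (rule power2_le_imp_le[OF _ wnorm_nonneg])
  have "(norm v)\<^sup>2 = (\<Sum>j\<in>UNIV. (v $ j)\<^sup>2)"
    unfolding dot_square_norm[symmetric] inner_vec_def by (simp add: power2_eq_square)
  also have "\<dots> \<le> (\<Sum>j\<in>UNIV. (v $ j)\<^sup>2 / h $ j)"
  proof (rule sum_mono)
    fix j
    have "(v $ j)\<^sup>2 * h $ j \<le> (v $ j)\<^sup>2 * 1" using assms by (intro mult_left_mono) auto
    then show "(v $ j)\<^sup>2 \<le> (v $ j)\<^sup>2 / h $ j" using assms(1)[of j] by (simp add: field_simps)
  qed
  finally show "(norm v)\<^sup>2 \<le> (wnorm h v)\<^sup>2" using assms by (simp add: wnorm_square)
qed

lemma wnorm_le_norm: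
  assumes k: "\<kappa> > 0" "\<And>j. h $ j \<ge> \<kappa>"
  shows "wnorm h v \<le> norm v / sqrt \<kappa>"
proof -
  have "wnorm h v \<le> norm ((1 / sqrt \<kappa>) *\<^sub>R v)"
    unfolding wnorm_def
  proof (rule norm_le_componentwise_cart)
    fix j
    have s: "0 < sqrt \<kappa>" "sqrt \<kappa> \<le> sqrt (h $ j)" using k by simp_all
    have "norm ((\<chi> j. v $ j / sqrt (h $ j)) $ j) = \<bar>v $ j\<bar> / sqrt (h $ j)"
      using s by (simp only: vec_lambda_beta real_norm_def abs_divide abs_of_pos)
    also have "\<dots> \<le> \<bar>v $ j\<bar> / sqrt \<kappa>"
      by (rule divide_left_mono[OF s(2)]) (use s in auto)
    also have "\<dots> = norm (((1 / sqrt \<kappa>) *\<^sub>R v) $ j)"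
      using s(1) by (simp only: vector_scaleR_component real_norm_def abs_mult real_scaleR_def abs_divide abs_of_pos abs_one) simp
    finally show "norm ((\<chi> j. v $ j / sqrt (h $ j)) $ j) \<le> norm (((1 / sqrt \<kappa>) *\<^sub>R v) $ j)" .
  qed
  then show ?thesis using k(1) by (simp add: divide_inverse mult.commute)
qed

context
  fixes blk :: "'d::finite \<Rightarrow> 'n::finite" and h :: "real^'d"
  assumes h: "h \<in> simplices blk" and h_pos: "\<And>j. h $ j > 0"
begin

lemma B_mat_tangent: "B_mat blk h *v x \<in> tangent blk"
  unfolding tangent_def
proof (intro CollectI allI)
  fix i
  define m where "m = (\<Sum>l\<in>blk -` {i}. h $ l * x $ l)"
  have "(\<Sum>j\<in>blk -` {i}. (B_mat blk h *v x) $ j) = (\<Sum>j\<in>blk -` {i}. h $ j * x $ j - h $ j * m)"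
    by (intro sum.cong) (auto simp: B_mat_mult_nth m_def right_diff_distrib)
  also have "\<dots> = m - (\<Sum>j\<in>blk -` {i}. h $ j) * m"
    by (simp add: sum_subtractf m_def flip: sum_distrib_right)
  also have "\<dots> = 0" unfolding simplices_block_sum[OF h] by simp
  finally show "(\<Sum>j\<in>blk -` {i}. (B_mat blk h *v x) $ j) = 0" .
qed

lemma B_mat_block_constant:
  assumes "block_constant blk c"
  shows "B_mat blk h *v c = 0"
proof -
  have "(\<Sum>l\<in>blk -` {blk j}. h $ l * c $ l) = c $ j" for j
  proof -
    have "(\<Sum>l\<in>blk -` {blk j}. h $ l * c $ l) = (\<Sum>l\<in>blk -` {blk j}. h $ l * c $ j)"
    proof (rule sum.cong[OF refl])
      fix l assume "l \<in> blk -` {blk j}"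
      then have "c $ l = c $ j" by (intro block_constantD[OF assms]) simp
      then show "h $ l * c $ l = h $ l * c $ j" by simp
    qed
    also have "\<dots> = c $ j"
      unfolding sum_distrib_right[symmetric] simplices_block_sum[OF h] by simp
    finally show ?thesis .
  qed
  then show ?thesis by (simp add: vec_eq_iff B_mat_mult_nth)
qed

lemma B_mat_div_tangent:
  assumes "v \<in> tangent blk"
  shows "B_mat blk h *v (\<chi> j. v $ j / h $ j) = v"
proof -
  have "h $ l * (v $ l / h $ l) = v $ l" for l using h_pos[of l] by simp
  then show ?thesis
    using assms by (simp add: vec_eq_iff B_mat_mult_nth tangent_def right_diff_distrib)
qed

text \<open>In the local inner product, pairing a tangent vector with \<open>B x\<close> is the Euclidean pairing
  with \<open>x\<close>.\<close>

lemma weighted_inner_B_mat: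
  assumes "v \<in> tangent blk"
  shows "(\<Sum>j\<in>UNIV. v $ j * (B_mat blk h *v x) $ j / h $ j) = v \<bullet> x"
proof -
  define c where "c = (\<chi> j. \<Sum>l\<in>blk -` {blk j}. h $ l * x $ l)"
  have "v $ j * (B_mat blk h *v x) $ j / h $ j = v $ j * (x - c) $ j" for j
    using h_pos[of j] by (simp add: B_mat_mult_nth c_def)
  then have "(\<Sum>j\<in>UNIV. v $ j * (B_mat blk h *v x) $ j / h $ j) = v \<bullet> (x - c)"
    by (simp add: inner_vec_def)
  also have "\<dots> = v \<bullet> x"
    using block_constant_inner_tangent[of blk c v] assms
    by (simp add: inner_diff_right inner_commute c_def block_constant_def)
  finally show ?thesis .
qed

lemma wnorm_B_mat_le: "wnorm h (B_mat blk h *v x) \<le> norm x"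
proof (rule power2_le_imp_le)
  let ?b = "B_mat blk h *v x"
  have n: "(wnorm h ?b)\<^sup>2 = ?b \<bullet> x"
    using weighted_inner_B_mat[OF B_mat_tangent, of x x]
    unfolding wnorm_square[OF h_pos] by (simp add: power2_eq_square)
  \<comment> \<open>expand the square to compare the quadratic form of \<open>B\<close> with that of \<open>diag h\<close>\<close>
  have "0 \<le> (\<Sum>j\<in>UNIV. h $ j * (x $ j - ?b $ j / h $ j)\<^sup>2)"
    using h_pos by (intro sum_nonneg mult_nonneg_nonneg) (auto simp: less_imp_le)
  also have "\<dots> = (\<Sum>j\<in>UNIV. h $ j * (x $ j)\<^sup>2 - 2 * (?b $ j * x $ j) + (?b $ j)\<^sup>2 / h $ j)"
  proof (intro sum.cong refl)
    fix j
    show "h $ j * (x $ j - ?b $ j / h $ j)\<^sup>2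
        = h $ j * (x $ j)\<^sup>2 - 2 * (?b $ j * x $ j) + (?b $ j)\<^sup>2 / h $ j"
      using h_pos[of j] by (simp add: power2_eq_square field_simps)
  qed
  also have "\<dots> = (\<Sum>j\<in>UNIV. h $ j * (x $ j)\<^sup>2) - 2 * (?b \<bullet> x) + (wnorm h ?b)\<^sup>2"
    by (simp add: wnorm_square[OF h_pos] sum.distrib sum_subtractf inner_vec_def flip: sum_distrib_left)
  finally have "(wnorm h ?b)\<^sup>2 \<le> (\<Sum>j\<in>UNIV. h $ j * (x $ j)\<^sup>2)"
    using n by simp
  also have "\<dots> \<le> (\<Sum>j\<in>UNIV. 1 * (x $ j)\<^sup>2)"
    using simplices_le_1[OF h] by (intro sum_mono mult_right_mono) auto
  also have "\<dots> = (norm x)\<^sup>2"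
    unfolding dot_square_norm[symmetric] inner_vec_def by (simp add: power2_eq_square)
  finally show "(wnorm h ?b)\<^sup>2 \<le> (norm x)\<^sup>2" .
qed simp

text \<open>In the local norm, \<open>v \<mapsto> (1 - a \<eta>) v - a B H v\<close> contracts the tangent space for small
  \<open>a\<close> if \<open>H\<close> is positive semidefinite there; \<open>z\<close> plays the role of \<open>H v\<close>.  No symmetry is needed.\<close>

lemma wnorm_contraction:
  assumes v: "v \<in> tangent blk" and z: "v \<bullet> z \<ge> 0" "norm z \<le> L * norm v"
    and a: "a \<ge> 0" "a * \<eta> \<le> 1" "a * (\<eta>\<^sup>2 + L\<^sup>2) \<le> \<eta>" and L: "L \<ge> 0"
  shows "wnorm h ((1 - a * \<eta>) *\<^sub>R v - a *\<^sub>R (B_mat blk h *v z)) \<le> sqrt (1 - a * \<eta>) * wnorm h v"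
proof (rule power2_le_imp_le)
  let ?b = "B_mat blk h *v z" and ?s = "1 - a * \<eta>"
  have "(wnorm h (?s *\<^sub>R v - a *\<^sub>R ?b))\<^sup>2
      = (\<Sum>j\<in>UNIV. ?s\<^sup>2 * ((v $ j)\<^sup>2 / h $ j) - 2 * a * ?s * (v $ j * ?b $ j / h $ j)
          + a\<^sup>2 * ((?b $ j)\<^sup>2 / h $ j))"
    unfolding wnorm_square[OF h_pos]
  proof (intro sum.cong refl)
    fix j
    show "((?s *\<^sub>R v - a *\<^sub>R ?b) $ j)\<^sup>2 / h $ j
      = ?s\<^sup>2 * ((v $ j)\<^sup>2 / h $ j) - 2 * a * ?s * (v $ j * ?b $ j / h $ j) + a\<^sup>2 * ((?b $ j)\<^sup>2 / h $ j)"
      using h_pos[of j] by (simp add: power2_eq_square field_simps)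
  qed
  also have "\<dots> = ?s\<^sup>2 * (wnorm h v)\<^sup>2 - 2 * a * ?s * (v \<bullet> z) + a\<^sup>2 * (wnorm h ?b)\<^sup>2"
    unfolding wnorm_square[OF h_pos] weighted_inner_B_mat[OF v, symmetric]
    by (simp add: sum.distrib sum_subtractf sum_distrib_left)
  also have "\<dots> \<le> ?s\<^sup>2 * (wnorm h v)\<^sup>2 + a\<^sup>2 * (L * wnorm h v)\<^sup>2"
  proof -
    have "wnorm h ?b \<le> norm z" by (rule wnorm_B_mat_le)
    also have "\<dots> \<le> L * wnorm h v"
      using z(2) L norm_le_wnorm[OF h_pos simplices_le_1[OF h], of v]
      by (meson mult_left_mono order_trans)
    finally have "(wnorm h ?b)\<^sup>2 \<le> (L * wnorm h v)\<^sup>2"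
      by (intro power_mono wnorm_nonneg)
    moreover have "0 \<le> 2 * a * ?s * (v \<bullet> z)" using a z by simp
    then have "0 \<le> 2 * a * ?s * (v \<bullet> z)"
      by (simp only: mult_ac)
    ultimately show ?thesis
      using mult_left_mono[of "(wnorm h ?b)\<^sup>2" "(L * wnorm h v)\<^sup>2" "a\<^sup>2"]
      by (smt (verit) zero_le_power2)
  qed
  also have "\<dots> = (?s\<^sup>2 + a\<^sup>2 * L\<^sup>2) * (wnorm h v)\<^sup>2"
    by (simp add: algebra_simps power_mult_distrib)
  also have "\<dots> \<le> ?s * (wnorm h v)\<^sup>2"
  proof (rule mult_right_mono)
    have "a * (a * (\<eta>\<^sup>2 + L\<^sup>2)) \<le> a * \<eta>" using a by (intro mult_left_mono) auto
    then show "?s\<^sup>2 + a\<^sup>2 * L\<^sup>2 \<le> ?s" by (simp add: power2_eq_square algebra_simps)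
  qed simp
  also have "\<dots> = (sqrt ?s * wnorm h v)\<^sup>2"
    using a by (simp add: power_mult_distrib)
  finally show "(wnorm h (?s *\<^sub>R v - a *\<^sub>R ?b))\<^sup>2 \<le> (sqrt ?s * wnorm h v)\<^sup>2" .
qed (use a in \<open>auto intro: mult_nonneg_nonneg wnorm_nonneg\<close>)

text \<open>The operator \<open>v \<mapsto> \<eta> v + B H v\<close> is bounded below on the tangent space; again \<open>z\<close> plays the
  role of \<open>H v\<close>.\<close>

lemma wnorm_coercive:
  assumes v: "v \<in> tangent blk" and z: "v \<bullet> z \<ge> 0" and \<eta>: "\<eta> > 0"
  shows "\<eta> * wnorm h v \<le> wnorm h (\<eta> *\<^sub>R v + B_mat blk h *v z)"
proof (cases "wnorm h v = 0")
  case False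
  let ?q = "\<eta> *\<^sub>R v + B_mat blk h *v z"
  let ?sc = "\<lambda>x. (\<chi> j. x $ j / sqrt (h $ j))"
  have sq: "sqrt (h $ j) * sqrt (h $ j) = h $ j" for j using h_pos[of j] by simp
  have "\<eta> * (wnorm h v)\<^sup>2 \<le> \<eta> * (wnorm h v)\<^sup>2 + v \<bullet> z" using z by simp
  also have "\<dots> = (\<Sum>j\<in>UNIV. v $ j * ?q $ j / h $ j)"
    unfolding wnorm_square[OF h_pos] weighted_inner_B_mat[OF v, symmetric] sum_distrib_left
      sum.distrib[symmetric]
    by (intro sum.cong) (auto simp: power2_eq_square algebra_simps add_divide_distrib)
  also have "\<dots> = ?sc v \<bullet> ?sc ?q"
    by (simp add: inner_vec_def sq abs_of_pos[OF h_pos])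
  also have "\<dots> \<le> wnorm h v * wnorm h ?q"
    unfolding wnorm_def by (rule norm_cauchy_schwarz)
  finally have "wnorm h v * (\<eta> * wnorm h v) \<le> wnorm h v * wnorm h ?q"
    by (simp add: power2_eq_square mult_ac)
  then show ?thesis using False wnorm_nonneg[of h v] by simp
qed (use wnorm_nonneg in auto)

end

lemma B_mat_lipschitz:
  fixes blk :: "'d::finite \<Rightarrow> 'n::finite"
  assumes h: "h \<in> simplices blk" and h': "h' \<in> simplices blk"
  shows "norm (B_mat blk h *v x - B_mat blk h' *v x) \<le> 3 * real CARD('d) * norm (h - h') * norm x"
proof -
  define m where "m k j = (\<Sum>l\<in>blk -` {blk j}. k $ l * x $ l)" for k :: "real^'d" and j
  have xj: "\<bar>x $ j\<bar> \<le> norm x" and hj: "\<bar>(h - h') $ j\<bar> \<le> norm (h - h')" for j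
    using component_le_norm_cart by blast+
  have m1: "\<bar>m h j\<bar> \<le> norm x" for j
  proof -
    have "\<bar>m h j\<bar> \<le> (\<Sum>l\<in>blk -` {blk j}. \<bar>h $ l * x $ l\<bar>)"
      unfolding m_def by (rule sum_abs)
    also have "\<dots> \<le> (\<Sum>l\<in>blk -` {blk j}. h $ l * norm x)"
      using h xj by (intro sum_mono) (auto simp: abs_mult simplices_def intro!: mult_mono)
    also have "\<dots> = norm x"
      unfolding sum_distrib_right[symmetric] simplices_block_sum[OF h] by simp
    finally show ?thesis .
  qed
  have m2: "\<bar>m h j - m h' j\<bar> \<le> norm (h - h') * norm x" for j
  proof -
    define y where "y = (\<chi> l. if l \<in> blk -` {blk j} then x $ l else 0)"
    have "m h j - m h' j = (\<Sum>l\<in>blk -` {blk j}. (h - h') $ l * x $ l)"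
      by (simp add: m_def left_diff_distrib sum_subtractf)
    also have "\<dots> = (\<Sum>l\<in>UNIV. if l \<in> blk -` {blk j} then (h - h') $ l * x $ l else 0)"
      by (subst sum.inter_restrict[symmetric]) auto
    also have "\<dots> = (h - h') \<bullet> y"
      unfolding inner_vec_def y_def by (intro sum.cong) auto
    finally have "\<bar>m h j - m h' j\<bar> \<le> norm (h - h') * norm y"
      using Cauchy_Schwarz_ineq2 by metis
    also have "norm y \<le> norm x"
      by (rule norm_le_componentwise_cart) (auto simp: y_def)
    finally show ?thesis by (simp add: mult_left_mono)
  qed
  have "\<bar>(B_mat blk h *v x - B_mat blk h' *v x) $ j\<bar> \<le> 3 * (norm (h - h') * norm x)" for j
  proof -
    have "(B_mat blk h *v x - B_mat blk h' *v x) $ j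
        = (h - h') $ j * x $ j - (h - h') $ j * m h j - h' $ j * (m h j - m h' j)"
      by (simp add: B_mat_mult_nth m_def algebra_simps)
    moreover have "\<bar>(h - h') $ j * x $ j\<bar> \<le> norm (h - h') * norm x"
      unfolding abs_mult by (intro mult_mono xj hj) auto
    moreover have "\<bar>(h - h') $ j * m h j\<bar> \<le> norm (h - h') * norm x"
      unfolding abs_mult by (intro mult_mono m1 hj) auto
    moreover have "\<bar>h' $ j * (m h j - m h' j)\<bar> \<le> 1 * (norm (h - h') * norm x)"
      unfolding abs_mult using h' simplices_le_1[OF h', of j]
      by (intro mult_mono m2) (auto simp: simplices_def)
    ultimately show ?thesis by linarith
  qed
  then have "(\<Sum>j\<in>UNIV. \<bar>(B_mat blk h *v x - B_mat blk h' *v x) $ j\<bar>)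
      \<le> (\<Sum>j\<in>(UNIV::'d set). 3 * (norm (h - h') * norm x))"
    by (intro sum_mono)
  then show ?thesis
    using norm_le_l1_cart[of "B_mat blk h *v x - B_mat blk h' *v x"] by (simp add: mult_ac)
qed

section \<open>Entropy and Kullback-Leibler divergence\<close>

text \<open>The Bregman divergence of the entropy, in the form that is also meaningful for vectors of
  different total mass.\<close>

definition kl :: "real^'d \<Rightarrow> real^'d \<Rightarrow> real" where
  "kl a b = (\<Sum>j\<in>UNIV. a $ j * (ln (a $ j) - ln (b $ j)) - a $ j + b $ j)"

lemma kl_lower_bound:
  assumes "a \<in> simplices blk" "b \<in> simplices blk" "\<And>j. b $ j > 0"
  shows "(norm (a - b))\<^sup>2 / 2 \<le> kl a b"
proof -
  have "(norm (a - b))\<^sup>2 / 2 = (\<Sum>j\<in>UNIV. (a $ j - b $ j)\<^sup>2 / 2)"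
    unfolding dot_square_norm[symmetric] inner_vec_def
    by (simp add: power2_eq_square sum_divide_distrib)
  also have "\<dots> \<le> kl a b"
    unfolding kl_def using assms simplices_le_1
    by (intro sum_mono kl_term_lower_bound) (auto simp: simplices_def intro: simplices_le_1)
  finally show ?thesis .
qed

lemma entropy_eq_bregman: "entropy a = entropy b + ln_vec b \<bullet> (a - b) + kl a b"
  unfolding entropy_def kl_def inner_vec_def ln_vec_def sum.distrib[symmetric]
  by (intro sum.cong) (auto simp: algebra_simps)

lemma kl_three_point: "kl a b - kl a b' - kl b' b = (ln_vec b' - ln_vec b) \<bullet> (a - b')"
  unfolding kl_def inner_vec_def ln_vec_def sum_subtractf[symmetric]
  by (intro sum.cong) (auto simp: algebra_simps)

lemma ln_vec_strongly_monotone: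
  assumes "a \<in> simplices blk" "b \<in> simplices blk" "\<And>j. a $ j > 0" "\<And>j. b $ j > 0"
  shows "(norm (a - b))\<^sup>2 \<le> (ln_vec a - ln_vec b) \<bullet> (a - b)"
proof -
  have "kl a b + kl b a = (ln_vec a - ln_vec b) \<bullet> (a - b)"
    unfolding kl_def inner_vec_def ln_vec_def sum.distrib[symmetric]
    by (intro sum.cong) (auto simp: algebra_simps)
  then show ?thesis
    using kl_lower_bound[OF assms(1,2,4)] kl_lower_bound[OF assms(2,1,3)]
    by (simp add: norm_minus_commute)
qed

section \<open>Componentwise quotients\<close>

lemma norm_linearization_ln_le:
  fixes h h' :: "real^'d"
  assumes k: "0 < \<kappa>" "\<And>j. \<kappa> \<le> h $ j" "\<And>j. \<kappa> \<le> h' $ j"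
  shows "norm ((\<chi> j. (h' - h) $ j / h $ j) - (ln_vec h' - ln_vec h)) \<le> (norm (h' - h))\<^sup>2 / \<kappa>\<^sup>2"
proof -
  let ?v = "(\<chi> j. (h' - h) $ j / h $ j) - (ln_vec h' - ln_vec h)"
  have "norm ?v \<le> (\<Sum>j\<in>UNIV. \<bar>?v $ j\<bar>)" by (rule norm_le_l1_cart)
  also have "\<dots> \<le> (\<Sum>j\<in>UNIV. (h' $ j - h $ j)\<^sup>2 / \<kappa>\<^sup>2)"
    using ln_linearization_error[OF k(1) k(3) k(2)] by (intro sum_mono) (simp add: ln_vec_def)
  also have "\<dots> = (norm (h' - h))\<^sup>2 / \<kappa>\<^sup>2"
    unfolding sum_divide_distrib[symmetric] dot_square_norm[symmetric] inner_vec_def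
    by (simp add: power2_eq_square)
  finally show ?thesis .
qed

lemma norm_divide_diff_le:
  fixes h h' r :: "real^'d"
  assumes k: "0 < \<kappa>" "\<And>j. \<kappa> \<le> h $ j" "\<And>j. \<kappa> \<le> h' $ j"
  shows "norm ((\<chi> j. r $ j / h $ j) - (\<chi> j. r $ j / h' $ j)) \<le> norm (h - h') / \<kappa>\<^sup>2 * norm r"
proof -
  have "norm ((\<chi> j. r $ j / h $ j) - (\<chi> j. r $ j / h' $ j)) \<le> norm ((norm (h - h') / \<kappa>\<^sup>2) *\<^sub>R r)"
  proof (rule norm_le_componentwise_cart)
    fix j
    have p: "h $ j > 0" "h' $ j > 0" using k less_le_trans by blast+
    have "\<kappa> * \<kappa> \<le> h $ j * h' $ j" using k p by (intro mult_mono) (auto simp: less_imp_le)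
    then have "\<bar>h' $ j - h $ j\<bar> / (h $ j * h' $ j) \<le> norm (h - h') / \<kappa>\<^sup>2"
      using component_le_norm_cart[of "h - h'" j] k(1) p
      by (intro frac_le) (auto simp: power2_eq_square abs_minus_commute)
    then have "\<bar>r $ j\<bar> * (\<bar>h' $ j - h $ j\<bar> / (h $ j * h' $ j)) \<le> \<bar>r $ j\<bar> * (norm (h - h') / \<kappa>\<^sup>2)"
      by (intro mult_left_mono) auto
    moreover have "r $ j / h $ j - r $ j / h' $ j = r $ j * ((h' $ j - h $ j) / (h $ j * h' $ j))"
      using p by (simp add: field_simps)
    ultimately show "norm (((\<chi> j. r $ j / h $ j) - (\<chi> j. r $ j / h' $ j)) $ j)
        \<le> norm (((norm (h - h') / \<kappa>\<^sup>2) *\<^sub>R r) $ j)"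
      using p by (simp add: abs_mult mult_ac)
  qed
  then show ?thesis by simp
qed

lemma norm_divide_le:
  fixes h r :: "real^'d"
  assumes k: "0 < \<kappa>" "\<And>j. \<kappa> \<le> h $ j"
  shows "norm (\<chi> j. r $ j / h $ j) \<le> norm r / \<kappa>"
proof -
  have "norm (\<chi> j. r $ j / h $ j) \<le> norm ((1 / \<kappa>) *\<^sub>R r)"
  proof (rule norm_le_componentwise_cart)
    fix j
    have "0 < h $ j" using k less_le_trans by blast
    then have "\<bar>r $ j\<bar> / h $ j \<le> \<bar>r $ j\<bar> / \<kappa>"
      using k by (intro divide_left_mono) auto
    then show "norm ((\<chi> j. r $ j / h $ j) $ j) \<le> norm (((1 / \<kappa>) *\<^sub>R r) $ j)"
      using \<open>0 < h $ j\<close> k(1) by (simp add: abs_mult)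
  qed
  then show ?thesis using k(1) by simp
qed

section \<open>The lower-level problem\<close>

text \<open>The standing hypotheses on the bilevel problem.  The gradients of \<open>f\<close> are \<open>f_h\<close> and \<open>f_y\<close>, the
  lower-level gradient is \<open>g_h\<close>, and \<open>g_hh\<close>, \<open>g_hy\<close> are its derivatives.  All derivatives are taken
  within the feasible sets, which may have empty interior.\<close>

locale bilevel =
  fixes blk :: "'d::finite \<Rightarrow> 'n::finite"
    and C :: "(real^'u::finite) set"
    and f g :: "real^'d \<Rightarrow> real^'u \<Rightarrow> real"
    and f_h :: "real^'d \<Rightarrow> real^'u \<Rightarrow> real^'d"
    and f_y :: "real^'d \<Rightarrow> real^'u \<Rightarrow> real^'u"
    and g_h :: "real^'d \<Rightarrow> real^'u \<Rightarrow> real^'d"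
    and g_hh :: "real^'d \<Rightarrow> real^'u \<Rightarrow> real^'d^'d"
    and g_hy :: "real^'d \<Rightarrow> real^'u \<Rightarrow> real^'u^'d"
    and \<eta> L\<^sub>f \<Omega>\<^sub>f L\<^sub>g \<Omega>\<^sub>g \<Lambda>\<^sub>g \<tau>h \<tau>y \<rho>h \<rho>y :: real
  assumes blocks: "surj blk"
    and C: "C \<noteq> {}" "closed C" "convex C"
    and eta: "\<eta> > 0"
    and f_deriv: "\<And>h y. h \<in> simplices blk \<Longrightarrow> y \<in> C \<Longrightarrow>
          ((\<lambda>(h, y). f h y) has_derivative (\<lambda>(v, w). f_h h y \<bullet> v + f_y h y \<bullet> w))
            (at (h, y) within simplices blk \<times> C)"
    and f_lipschitz: "L\<^sub>f-lipschitz_on (simplices blk \<times> C) (\<lambda>(h, y). (f_h h y, f_y h y))"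
    and f_bound: "\<And>h y. h \<in> simplices blk \<Longrightarrow> y \<in> C \<Longrightarrow> norm (f_h h y, f_y h y) \<le> \<Omega>\<^sub>f"
    and g_convex: "\<And>y. y \<in> C \<Longrightarrow> convex_on (simplices blk) (\<lambda>h. g h y)"
    and g_deriv: "\<And>h y. h \<in> simplices blk \<Longrightarrow> y \<in> C \<Longrightarrow>
          ((\<lambda>h. g h y) has_derivative (\<lambda>v. g_h h y \<bullet> v)) (at h within simplices blk)"
    and g_h_deriv_h: "\<And>h y. h \<in> simplices blk \<Longrightarrow> y \<in> C \<Longrightarrow>
          ((\<lambda>h. g_h h y) has_derivative (\<lambda>v. g_hh h y *v v)) (at h within simplices blk)"
    and g_h_deriv_y: "\<And>h y. h \<in> simplices blk \<Longrightarrow> y \<in> C \<Longrightarrow>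
          ((\<lambda>y. g_h h y) has_derivative (\<lambda>w. g_hy h y *v w)) (at y within C)"
    and g_h_lipschitz: "\<And>y. y \<in> C \<Longrightarrow> L\<^sub>g-lipschitz_on (simplices blk) (\<lambda>h. g_h h y)"
    and g_h_bound: "\<And>h y. h \<in> simplices blk \<Longrightarrow> y \<in> C \<Longrightarrow> norm (g_h h y) \<le> \<Omega>\<^sub>g"
    and g_hy_lipschitz_h: "\<And>y. y \<in> C \<Longrightarrow> spectral_lipschitz_on \<tau>h (simplices blk) (\<lambda>h. g_hy h y)"
    and g_hh_lipschitz_h: "\<And>y. y \<in> C \<Longrightarrow> spectral_lipschitz_on \<rho>h (simplices blk) (\<lambda>h. g_hh h y)"
    and g_hh_bound: "\<And>h y. h \<in> simplices blk \<Longrightarrow> y \<in> C \<Longrightarrow> spectral_norm (g_hh h y) \<le> L\<^sub>g"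
    and g_hy_bound: "\<And>h y. h \<in> simplices blk \<Longrightarrow> y \<in> C \<Longrightarrow> spectral_norm (g_hy h y) \<le> \<Lambda>\<^sub>g"
    and g_hy_lipschitz_y: "\<And>h. h \<in> simplices blk \<Longrightarrow> spectral_lipschitz_on \<tau>y C (\<lambda>y. g_hy h y)"
    and g_hh_lipschitz_y: "\<And>h. h \<in> simplices blk \<Longrightarrow> spectral_lipschitz_on \<rho>y C (\<lambda>y. g_hh h y)"
begin

lemma constants_nonneg: "L\<^sub>f \<ge> 0" "L\<^sub>g \<ge> 0" "\<Omega>\<^sub>g \<ge> 0" "\<Lambda>\<^sub>g \<ge> 0" "\<Omega>\<^sub>f \<ge> 0"
proof -
  obtain h y where hy: "h \<in> simplices blk" "y \<in> C"
    using C simplices_nonempty[OF blocks] by auto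
  show "L\<^sub>f \<ge> 0" using f_lipschitz by (rule lipschitz_on_nonneg)
  show "L\<^sub>g \<ge> 0" using g_h_lipschitz[OF hy(2)] by (rule lipschitz_on_nonneg)
  show "\<Omega>\<^sub>g \<ge> 0" using g_h_bound[OF hy] norm_ge_zero order_trans by blast
  show "\<Omega>\<^sub>f \<ge> 0" using f_bound[OF hy] norm_ge_zero order_trans by blast
  have "0 \<le> spectral_norm (g_hy h y)"
    unfolding spectral_norm_def by (rule onorm_pos_le[OF matrix_vector_mul_bounded_linear])
  then show "\<Lambda>\<^sub>g \<ge> 0" using g_hy_bound[OF hy] by simp
qed

lemma norm_g_hh_le:
  assumes "h \<in> simplices blk" "y \<in> C"
  shows "norm (g_hh h y *v v) \<le> L\<^sub>g * norm v"
  using norm_matrix_vector_le_spectral_norm[of "g_hh h y" v] g_hh_bound[OF assms]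
  by (meson mult_right_mono norm_ge_zero order_trans)

lemma norm_g_hy_le:
  assumes "h \<in> simplices blk" "y \<in> C"
  shows "norm (g_hy h y *v w) \<le> \<Lambda>\<^sub>g * norm w"
  using norm_matrix_vector_le_spectral_norm[of "g_hy h y" w] g_hy_bound[OF assms]
  by (meson mult_right_mono norm_ge_zero order_trans)

lemma g_first_order:
  assumes "h \<in> simplices blk" "h' \<in> simplices blk" "y \<in> C"
  shows "g h' y \<ge> g h y + g_h h y \<bullet> (h' - h)"
  using convex_on_first_order[OF g_convex[OF assms(3)] assms(1,2) g_deriv[OF assms(1,3)]] .

lemma g_smooth:
  assumes "h \<in> simplices blk" "h' \<in> simplices blk" "y \<in> C"
  shows "g h' y \<le> g h y + g_h h y \<bullet> (h' - h) + L\<^sub>g * (norm (h' - h))\<^sup>2"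
proof -
  have "norm (g h' y - g h y - g_h h y \<bullet> (h' - h)) \<le> L\<^sub>g * (norm (h' - h))\<^sup>2"
  proof (rule lipschitz_derivative_remainder[OF convex_simplices assms(1,2), where \<phi>' = "\<lambda>z v. g_h z y \<bullet> v"])
    fix z v assume z: "z \<in> simplices blk"
    have "norm (g_h z y \<bullet> v - g_h h y \<bullet> v) \<le> norm (g_h z y - g_h h y) * norm v"
      unfolding inner_diff_left[symmetric] real_norm_def by (rule Cauchy_Schwarz_ineq2)
    also have "norm (g_h z y - g_h h y) \<le> L\<^sub>g * norm (z - h)"
      using lipschitz_onD[OF g_h_lipschitz[OF assms(3)] z assms(1)] by (simp add: dist_norm)
    finally show "norm (g_h z y \<bullet> v - g_h h y \<bullet> v) \<le> L\<^sub>g * norm (z - h) * norm v"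
      by (simp add: mult_right_mono)
  qed (use g_deriv assms constants_nonneg in auto)
  then show ?thesis by simp
qed

lemma g_h_monotone:
  assumes "h \<in> simplices blk" "h' \<in> simplices blk" "y \<in> C"
  shows "0 \<le> (g_h h' y - g_h h y) \<bullet> (h' - h)"
  using g_first_order[OF assms] g_first_order[OF assms(2,1,3)]
  by (simp add: inner_diff_left inner_diff_right)

text \<open>Convexity of the lower-level objective yields semidefiniteness of \<open>g_hh\<close> on the tangent space
  only, and only as a quadratic form.\<close>

lemma g_hh_psd:
  assumes h: "h \<in> simplices blk" "\<And>j. h $ j > 0" and y: "y \<in> C" and v: "v \<in> tangent blk"
  shows "0 \<le> v \<bullet> (g_hh h y *v v)"
proof -
  \<comment> \<open>a small multiple of \<open>v\<close> can be added to the interior point \<open>h\<close>\<close>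
  define m where "m = Min (range (($) h))"
  have m: "m > 0" "\<And>j. m \<le> h $ j" using h(2) by (auto simp: m_def)
  define e where "e = m / (norm v + 1)"
  have e: "e > 0" using m by (simp add: e_def add_nonneg_pos)
  define h' where "h' = h + e *\<^sub>R v"
  have h': "h' \<in> simplices blk"
  proof -
    have "h' $ j \<ge> 0" for j
    proof -
      have "\<bar>e * v $ j\<bar> \<le> e * (norm v + 1)"
        unfolding abs_mult using e component_le_norm_cart[of v j] by (intro mult_mono) auto
      also have "\<dots> = m"
      proof -
        have "norm v + 1 \<noteq> 0" using norm_ge_zero[of v] by linarith
        then show ?thesis by (simp add: e_def)
      qed
      finally show ?thesis using m(2)[of j] by (simp add: h'_def)
    qed
    then show ?thesis
      using h(1) v by (simp add: simplices_def tangent_def h'_def sum.distrib flip: sum_distrib_left)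
  qed
  define \<phi> where "\<phi> z = g_h z y \<bullet> (h' - h)" for z
  have "(\<phi> has_derivative (\<lambda>u. (g_hh h y *v u) \<bullet> (h' - h))) (at h within simplices blk)"
    unfolding \<phi>_def using g_h_deriv_h[OF h(1) y] by (rule has_derivative_inner_left)
  note lim = has_derivative_within_convex_tendsto[OF convex_simplices h(1) h' this]
  have "0 \<le> (g_hh h y *v (h' - h)) \<bullet> (h' - h)"
  proof (rule tendsto_lowerbound[OF lim])
    show "\<forall>\<^sub>F t in at_right 0. 0 \<le> (\<phi> (h + t *\<^sub>R (h' - h)) - \<phi> h) / t"
    proof (rule eventually_at_rightI)
      fix t :: real assume t: "t \<in> {0<..<1}"
      have "h + t *\<^sub>R (h' - h) = (1 - t) *\<^sub>R h + t *\<^sub>R h'" by (simp add: algebra_simps)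
      also have "\<dots> \<in> simplices blk"
        using convexD[OF convex_simplices h(1) h', of "1 - t" t] t by simp
      finally have "0 \<le> (g_h (h + t *\<^sub>R (h' - h)) y - g_h h y) \<bullet> (t *\<^sub>R (h' - h))"
        using g_h_monotone[OF h(1) _ y, of "h + t *\<^sub>R (h' - h)"] by simp
      then show "0 \<le> (\<phi> (h + t *\<^sub>R (h' - h)) - \<phi> h) / t"
        using t by (simp add: \<phi>_def zero_le_mult_iff flip: inner_diff_left)
    qed simp
  qed simp
  then have "0 \<le> e\<^sup>2 * (v \<bullet> (g_hh h y *v v))"
    by (simp add: h'_def matrix_vector_mult_scaleR power2_eq_square inner_commute mult_ac)
  then show ?thesis using e by (simp add: zero_le_mult_iff)
qed

lemma g_h_lipschitz_y:
  assumes "h \<in> simplices blk" "y \<in> C" "y' \<in> C"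
  shows "norm (g_h h y' - g_h h y) \<le> \<Lambda>\<^sub>g * norm (y' - y)"
proof (rule differentiable_bound[OF C(3) g_h_deriv_y[OF assms(1)]])
  show "onorm ((*v) (g_hy h z)) \<le> \<Lambda>\<^sub>g" if "z \<in> C" for z
    using g_hy_bound[OF assms(1) that] unfolding spectral_norm_def by simp
qed (use assms in auto)

lemma g_h_linearization:
  assumes h: "h \<in> simplices blk" "h' \<in> simplices blk" and y: "y \<in> C" "y' \<in> C"
  shows "norm (g_h h' y' - g_h h y - (g_hh h y *v (h' - h) + g_hy h y *v (y' - y)))
    \<le> \<bar>\<rho>h\<bar> * (norm (h' - h))\<^sup>2 + \<bar>\<rho>y\<bar> * norm (y' - y) * norm (h' - h) + \<bar>\<tau>y\<bar> * (norm (y' - y))\<^sup>2"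
proof -
  have 1: "norm (g_h h' y' - g_h h y' - g_hh h y' *v (h' - h)) \<le> \<bar>\<rho>h\<bar> * (norm (h' - h))\<^sup>2"
    by (rule lipschitz_derivative_remainder[OF convex_simplices h g_h_deriv_h])
      (use y h spectral_lipschitz_onD[OF g_hh_lipschitz_h] in \<open>auto simp: dist_norm\<close>)
  have 2: "norm (g_hh h y' *v (h' - h) - g_hh h y *v (h' - h)) \<le> \<bar>\<rho>y\<bar> * norm (y' - y) * norm (h' - h)"
    using spectral_lipschitz_onD[OF g_hh_lipschitz_y[OF h(1)] y(2,1)] by (simp add: dist_norm)
  have 3: "norm (g_h h y' - g_h h y - g_hy h y *v (y' - y)) \<le> \<bar>\<tau>y\<bar> * (norm (y' - y))\<^sup>2"
    by (rule lipschitz_derivative_remainder[OF C(3) y g_h_deriv_y])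
      (use y h spectral_lipschitz_onD[OF g_hy_lipschitz_y] in \<open>auto simp: dist_norm\<close>)
  have "g_h h' y' - g_h h y - (g_hh h y *v (h' - h) + g_hy h y *v (y' - y))
    = (g_h h' y' - g_h h y' - g_hh h y' *v (h' - h))
      + (g_hh h y' *v (h' - h) - g_hh h y *v (h' - h))
      + (g_h h y' - g_h h y - g_hy h y *v (y' - y))" by simp
  then show ?thesis using 1 2 3 by (smt (verit) norm_triangle_ineq)
qed

subsection \<open>Optimality conditions\<close>

text \<open>First-order optimality for the regularized lower-level problem: the gradient is orthogonal
  to the tangent space.\<close>

definition kkt :: "real^'u \<Rightarrow> real^'d \<Rightarrow> bool" where
  "kkt y h \<longleftrightarrow> h \<in> simplices blk \<and> (\<forall>j. h $ j > 0) \<and> block_constant blk (g_reg_h \<eta> g_h h y)"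

lemma g_reg_h_eq: "g_reg_h \<eta> g_h h y = g_h h y + \<eta> *\<^sub>R ln_vec h"
  by (simp add: g_reg_h_def ln_vec_def)

text \<open>The optimality conditions are the fixed-point equation of a softmax map, so that Brouwer's
  theorem provides a solution in the interior.\<close>

lemma kkt_exists:
  assumes y: "y \<in> C"
  shows "\<exists>h. kkt y h"
proof -
  define e where "e h = (\<chi> j. exp (- g_h h y $ j / \<eta>))" for h
  define T where "T h = block_normalize blk (e h)" for h
  have e_pos: "e h $ j > 0" for h j by (simp add: e_def)
  have T: "T h \<in> simplices blk" for h
    unfolding T_def by (rule block_normalize_in_simplices[OF blocks e_pos])
  have cont_g: "continuous_on (simplices blk) (\<lambda>h. g_h h y)"
    using g_h_lipschitz[OF y] by (rule lipschitz_on_continuous_on)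
  have "continuous_on (simplices blk) (\<lambda>h. e h $ j)" for j
    unfolding e_def using eta by (auto intro!: continuous_intros cont_g)
  moreover have "(\<Sum>l\<in>blk -` {blk j}. e h $ l) \<noteq> 0" for h j
  proof -
    have "(\<Sum>l\<in>blk -` {blk j}. e h $ l) > 0"
      using e_pos by (intro sum_pos) auto
    then show ?thesis by simp
  qed
  ultimately have "continuous_on (simplices blk) T"
    unfolding T_def block_normalize_def
    by (intro continuous_on_vec_lambda continuous_on_divide continuous_on_sum ballI)
  then obtain h where h: "h \<in> simplices blk" "T h = h"
    by (rule brouwer[OF compact_simplices convex_simplices simplices_nonempty[OF blocks]]) (use T in auto)
  have "block_constant blk (ln_vec h - ln_vec (e h))"
    using block_constant_ln_normalize[OF e_pos, of blk h] h(2) by (simp add: T_def)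
  moreover have "g_reg_h \<eta> g_h h y = \<eta> *\<^sub>R (ln_vec h - ln_vec (e h))"
    using eta by (simp add: g_reg_h_eq vec_eq_iff ln_vec_def e_def algebra_simps)
  ultimately have "block_constant blk (g_reg_h \<eta> g_h h y)"
    by (simp add: block_constant_scaleR)
  moreover have "h $ j > 0" for j
    using block_normalize_pos[OF e_pos, of blk h j] h(2) by (simp add: T_def)
  ultimately show ?thesis using h(1) unfolding kkt_def by blast
qed

lemma g_reg_lower_bound:
  assumes h: "h \<in> simplices blk" "h' \<in> simplices blk" and y: "y \<in> C"
  shows "g_reg \<eta> g h' y \<ge> g_reg \<eta> g h y + g_reg_h \<eta> g_h h y \<bullet> (h' - h) + \<eta> * kl h' h"
proof -
  have "\<eta> * entropy h' = \<eta> * (entropy h + ln_vec h \<bullet> (h' - h) + kl h' h)"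
    using entropy_eq_bregman[of h' h] by simp
  then show ?thesis
    using g_first_order[OF h y] by (simp add: g_reg_def g_reg_h_eq inner_add_left distrib_left)
qed

lemma kkt_growth:
  assumes k: "kkt y h" and h': "h' \<in> simplices blk" and y: "y \<in> C"
  shows "g_reg \<eta> g h' y \<ge> g_reg \<eta> g h y + \<eta> * kl h' h"
proof -
  have h: "h \<in> simplices blk" and bc: "block_constant blk (g_reg_h \<eta> g_h h y)"
    using k by (auto simp: kkt_def)
  show ?thesis
    using g_reg_lower_bound[OF h h' y]
      block_constant_inner_tangent[OF bc simplices_diff_tangent[OF h' h]] by simp
qed

lemma kl_nonneg:
  assumes "a \<in> simplices blk" "b \<in> simplices blk" "\<And>j. b $ j > 0"
  shows "0 \<le> kl a b"
  using kl_lower_bound[OF assms] by (smt (verit) divide_nonneg_nonneg zero_le_power2)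

lemma kkt_h_star:
  assumes y: "y \<in> C"
  shows "kkt y (h_star blk \<eta> g y)"
proof -
  obtain h where k: "kkt y h" using kkt_exists[OF y] by blast
  then have h: "h \<in> simplices blk" "\<And>j. h $ j > 0" by (auto simp: kkt_def)
  have "h_star blk \<eta> g y = h"
    unfolding h_star_def
  proof (rule the_equality)
    show "is_arg_min (\<lambda>h. g_reg \<eta> g h y) (\<lambda>h. h \<in> simplices blk) h"
      unfolding is_arg_min_def
    proof (intro conjI h notI)
      assume "\<exists>h'. h' \<in> simplices blk \<and> g_reg \<eta> g h' y < g_reg \<eta> g h y"
      then obtain h' where h': "h' \<in> simplices blk" "g_reg \<eta> g h' y < g_reg \<eta> g h y" by blast
      moreover have "0 \<le> \<eta> * kl h' h"
        using kl_nonneg[OF h'(1) h] eta by simp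
      ultimately show False using kkt_growth[OF k h'(1) y] by simp
    qed
  next
    fix h' assume a: "is_arg_min (\<lambda>h. g_reg \<eta> g h y) (\<lambda>h. h \<in> simplices blk) h'"
    then have h': "h' \<in> simplices blk" and le: "g_reg \<eta> g h' y \<le> g_reg \<eta> g h y"
      using h(1) by (auto simp: is_arg_min_def not_less)
    have "\<eta> * kl h' h \<le> 0" using kkt_growth[OF k h' y] le by simp
    then have "kl h' h \<le> 0" using eta by (simp add: mult_le_0_iff)
    then have "(norm (h' - h))\<^sup>2 \<le> 0" using kl_lower_bound[OF h' h] by linarith
    then show "h' = h" by simp
  qed
  then show ?thesis using k by simp
qed

text \<open>A bound for the spread of the logarithms of the coordinates within a block.\<close>

definition log_width :: real where
  "log_width = - ln (nu_min blk \<Omega>\<^sub>g \<eta>)"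

text \<open>The positive points whose coordinates within each block have logarithms differing by at most
  \<open>log_width\<close>.  The set contains all points with coordinates at least \<open>nu_min\<close>, and in contrast to
  a lower bound on the coordinates its defining condition is propagated directly by mirror descent
  steps.\<close>

definition log_box :: "(real^'d) set" where
  "log_box = {h \<in> simplices blk. (\<forall>j. h $ j > 0) \<and>
     (\<forall>j l. blk j = blk l \<longrightarrow> ln (h $ j) - ln (h $ l) \<le> log_width)}"

text \<open>A lower bound for the coordinates of the points of \<open>log_box\<close>.\<close>

definition \<kappa> :: real where
  "\<kappa> = exp (- log_width) / real CARD('d)"

lemma kappa_pos: "\<kappa> > 0"
  by (simp add: \<kappa>_def)

lemma dmax_ge_1: "dmax blk \<ge> 1"
proof -
  obtain j :: 'd where True by simp
  have "1 \<le> card (blk -` {blk j})"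
    by (simp add: Suc_le_eq card_gt_0_iff) blast
  also have "\<dots> \<le> dmax blk" unfolding dmax_def by (intro Max_ge) auto
  finally show ?thesis .
qed

lemma nu_min_pos: "nu_min blk \<Omega>\<^sub>g \<eta> > 0"
  using dmax_ge_1 by (simp add: nu_min_def)

lemma log_width_ge: "2 * \<Omega>\<^sub>g / \<eta> \<le> log_width"
  using dmax_ge_1 by (simp add: log_width_def nu_min_def ln_div)

lemma log_boxD:
  assumes "h \<in> log_box"
  shows "h \<in> simplices blk" "h $ j > 0" "h $ j \<le> 1"
    "blk j = blk l \<Longrightarrow> ln (h $ j) - ln (h $ l) \<le> log_width"
  using assms by (auto simp: log_box_def intro: simplices_le_1)

lemma log_box_ge_kappa:
  assumes "h \<in> log_box"
  shows "h $ j \<ge> \<kappa>"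
proof -
  note h = log_boxD[OF assms]
  have "h $ l \<le> h $ j * exp log_width" if "blk l = blk j" for l
  proof -
    have "ln (h $ l) \<le> ln (h $ j * exp log_width)"
      using h(4)[OF that] h(2)[of j] by (simp add: ln_mult)
    then show ?thesis using h(2) by simp
  qed
  then have "(\<Sum>l\<in>blk -` {blk j}. h $ l) \<le> (\<Sum>l\<in>blk -` {blk j}. h $ j * exp log_width)"
    by (intro sum_mono) auto
  also have "\<dots> \<le> (\<Sum>l\<in>(UNIV :: 'd set). h $ j * exp log_width)"
    using h(2)[of j] by (intro sum_mono2) auto
  finally have "1 \<le> real CARD('d) * (h $ j * exp log_width)"
    using simplices_block_sum[OF h(1)] by simp
  then show ?thesis by (simp add: \<kappa>_def exp_minus field_simps)
qed

lemma simplices_ge_nu_subset_log_box: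
  assumes "h \<in> simplices_ge_nu blk \<Omega>\<^sub>g \<eta>"
  shows "h \<in> log_box"
proof -
  have h: "h \<in> simplices blk" "\<And>j. nu_min blk \<Omega>\<^sub>g \<eta> \<le> h $ j"
    using assms by (auto simp: simplices_ge_nu_def)
  have pos: "h $ j > 0" for j using h(2)[of j] nu_min_pos by simp
  have "ln (h $ j) - ln (h $ l) \<le> log_width" for j l
  proof -
    have "ln (h $ j) \<le> 0" using pos[of j] simplices_le_1[OF h(1), of j] by simp
    moreover have "ln (nu_min blk \<Omega>\<^sub>g \<eta>) \<le> ln (h $ l)"
      using h(2)[of l] nu_min_pos pos[of l] by simp
    ultimately show ?thesis by (simp add: log_width_def)
  qed
  then show ?thesis using h pos by (simp add: log_box_def)
qed

lemma g_h_component_diff: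
  assumes "h \<in> simplices blk" "y \<in> C"
  shows "\<bar>g_h h y $ j - g_h h y $ l\<bar> \<le> 2 * \<Omega>\<^sub>g"
  using component_le_norm_cart[of "g_h h y" j] component_le_norm_cart[of "g_h h y" l] g_h_bound[OF assms]
  by linarith

lemma h_star_log_box:
  assumes y: "y \<in> C"
  shows "h_star blk \<eta> g y \<in> log_box"
proof -
  let ?h = "h_star blk \<eta> g y"
  have h: "?h \<in> simplices blk" "\<And>j. ?h $ j > 0" and bc: "block_constant blk (g_reg_h \<eta> g_h ?h y)"
    using kkt_h_star[OF y] by (auto simp: kkt_def)
  have "ln (?h $ j) - ln (?h $ l) \<le> log_width" if "blk j = blk l" for j l
  proof -
    have "\<eta> * (ln (?h $ j) - ln (?h $ l)) = g_h ?h y $ l - g_h ?h y $ j"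
      using block_constantD[OF bc that] by (simp add: g_reg_h_eq ln_vec_def algebra_simps)
    also have "\<dots> \<le> 2 * \<Omega>\<^sub>g" using g_h_component_diff[OF h(1) y, of l j] by simp
    finally have "ln (?h $ j) - ln (?h $ l) \<le> 2 * \<Omega>\<^sub>g / \<eta>"
      using eta by (simp add: field_simps)
    then show ?thesis using log_width_ge by simp
  qed
  then show ?thesis using h by (simp add: log_box_def)
qed

subsection \<open>Linear convergence of mirror descent\<close>

lemma md_step_eq_normalize:
  "md_step blk \<eta> g_h \<alpha> y h = block_normalize blk (\<chi> j. h $ j * exp (- \<alpha> * g_reg_h \<eta> g_h h y $ j))"
  by (simp add: md_step_def block_normalize_def)

lemma md_step_in_simplices:
  assumes "\<And>j. h $ j > 0"
  shows "md_step blk \<eta> g_h \<alpha> y h \<in> simplices blk" "md_step blk \<eta> g_h \<alpha> y h $ j > 0"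
  unfolding md_step_eq_normalize using assms
  by (auto intro!: block_normalize_in_simplices block_normalize_pos blocks)

text \<open>In logarithmic coordinates modulo block constants, a mirror descent step is a gradient step.\<close>

lemma block_constant_md_step:
  assumes "\<And>j. h $ j > 0"
  shows "block_constant blk
    (ln_vec (md_step blk \<eta> g_h \<alpha> y h) - ln_vec h + \<alpha> *\<^sub>R g_reg_h \<eta> g_h h y)"
proof -
  define x where "x = (\<chi> j. h $ j * exp (- \<alpha> * g_reg_h \<eta> g_h h y $ j))"
  have "ln_vec x = ln_vec h - \<alpha> *\<^sub>R g_reg_h \<eta> g_h h y"
    using assms by (simp add: x_def ln_vec_def vec_eq_iff ln_mult less_imp_neq[THEN not_sym])
  moreover have "block_constant blk (ln_vec (block_normalize blk x) - ln_vec x)"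
    using assms by (intro block_constant_ln_normalize) (simp add: x_def)
  ultimately show ?thesis
    unfolding md_step_eq_normalize x_def[symmetric] by (simp add: diff_diff_eq2 add_diff_eq diff_add_eq)
qed

lemma md_step_log_box:
  assumes h: "h \<in> log_box" and y: "y \<in> C" and \<alpha>: "\<alpha> > 0" "\<alpha> * \<eta> \<le> 1"
  shows "md_step blk \<eta> g_h \<alpha> y h \<in> log_box"
proof -
  let ?m = "md_step blk \<eta> g_h \<alpha> y h"
  have "ln (?m $ j) - ln (?m $ l) \<le> log_width" if "blk j = blk l" for j l
  proof -
    have "ln (?m $ j) - ln (?m $ l)
        = (1 - \<alpha> * \<eta>) * (ln (h $ j) - ln (h $ l)) + \<alpha> * (g_h h y $ l - g_h h y $ j)"
      using block_constantD[OF block_constant_md_step that, of h \<alpha> y] log_boxD(2)[OF h]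
      by (simp add: g_reg_h_eq ln_vec_def algebra_simps)
    also have "\<dots> \<le> (1 - \<alpha> * \<eta>) * log_width + \<alpha> * (\<eta> * log_width)"
    proof (intro add_mono mult_left_mono)
      show "g_h h y $ l - g_h h y $ j \<le> \<eta> * log_width"
        using g_h_component_diff[OF log_boxD(1)[OF h] y, of l j] log_width_ge eta
        by (simp add: field_simps)
    qed (use \<alpha> log_boxD(4)[OF h that] in auto)
    also have "\<dots> = log_width" by (simp add: algebra_simps)
    finally show ?thesis .
  qed
  then show ?thesis
    using md_step_in_simplices log_boxD(2)[OF h] by (simp add: log_box_def)
qed

text \<open>The regularized objective is \<open>\<eta>\<close>-strongly convex and \<open>(2 * L\<^sub>g + \<eta>)\<close>-smooth relative to the
  entropy, and its minimizer satisfies the first-order conditions; combined with the three-point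
  identity this gives linear convergence in divergence.\<close>

lemma md_step_contraction:
  assumes h: "h \<in> log_box" and y: "y \<in> C" and \<alpha>: "\<alpha> > 0" "\<alpha> * (2 * L\<^sub>g + \<eta>) \<le> 1"
  shows "kl (h_star blk \<eta> g y) (md_step blk \<eta> g_h \<alpha> y h)
      \<le> (1 - \<alpha> * \<eta>) * kl (h_star blk \<eta> g y) h"
proof -
  let ?s = "h_star blk \<eta> g y" and ?m = "md_step blk \<eta> g_h \<alpha> y h" and ?p = "g_reg_h \<eta> g_h h y"
  have s: "?s \<in> simplices blk" "\<And>j. ?s $ j > 0"
    using kkt_h_star[OF y] by (auto simp: kkt_def)
  note hs = log_boxD(1,2)[OF h]
  note m = md_step_in_simplices[OF hs(2), of \<alpha> y]
  have three: "kl ?s h - kl ?s ?m - kl ?m h = - \<alpha> * (?p \<bullet> (?s - ?m))"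
  proof -
    have "(ln_vec ?m - ln_vec h + \<alpha> *\<^sub>R ?p) \<bullet> (?s - ?m) = 0"
      by (rule block_constant_inner_tangent[OF block_constant_md_step[OF hs(2)] simplices_diff_tangent[OF s(1) m(1)]])
    then show ?thesis using kl_three_point[of ?s h ?m] by (simp add: inner_add_left)
  qed
  have "g_reg \<eta> g ?m y \<le> g_reg \<eta> g h y + ?p \<bullet> (?m - h) + (2 * L\<^sub>g + \<eta>) * kl ?m h"
  proof -
    have "L\<^sub>g * (norm (?m - h))\<^sup>2 \<le> L\<^sub>g * (2 * kl ?m h)"
      using kl_lower_bound[OF m(1) hs] constants_nonneg by (intro mult_left_mono) auto
    moreover have "\<eta> * entropy ?m = \<eta> * (entropy h + ln_vec h \<bullet> (?m - h) + kl ?m h)"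
      using entropy_eq_bregman[of ?m h] by simp
    ultimately show ?thesis
      using g_smooth[OF hs(1) m(1) y]
      by (simp add: g_reg_def g_reg_h_eq inner_add_left distrib_left distrib_right)
  qed
  moreover have "g_reg \<eta> g ?s y \<ge> g_reg \<eta> g h y + ?p \<bullet> (?s - h) + \<eta> * kl ?s h"
    by (rule g_reg_lower_bound[OF hs(1) s(1) y])
  moreover have "g_reg \<eta> g ?m y \<ge> g_reg \<eta> g ?s y"
    using kkt_growth[OF kkt_h_star[OF y] m(1) y] mult_nonneg_nonneg[of \<eta> "kl ?m ?s"] eta
      kl_nonneg[OF m(1) s] by linarith
  ultimately have "\<eta> * kl ?s h - (2 * L\<^sub>g + \<eta>) * kl ?m h \<le> ?p \<bullet> (?m - ?s)"
    by (simp add: inner_diff_right)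
  then have "\<alpha> * (\<eta> * kl ?s h - (2 * L\<^sub>g + \<eta>) * kl ?m h) \<le> \<alpha> * (?p \<bullet> (?m - ?s))"
    using \<alpha> by (intro mult_left_mono) auto
  moreover have "(\<alpha> * (2 * L\<^sub>g + \<eta>)) * kl ?m h \<le> 1 * kl ?m h"
    by (intro mult_right_mono \<alpha> kl_nonneg[OF m(1) hs])
  ultimately show ?thesis using three by (simp add: algebra_simps)
qed

lemma inner_h_log_box:
  assumes "h0 \<in> log_box" "y \<in> C" "\<alpha> > 0" "\<alpha> * \<eta> \<le> 1"
  shows "inner_h blk \<eta> g_h \<alpha> y h0 t \<in> log_box"
  by (induction t) (use assms md_step_log_box in auto)

text \<open>A bound for the divergence between points of \<open>log_box\<close>.\<close>

definition kl_bound :: real where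
  "kl_bound = real CARD('d) * (1 - ln \<kappa>)"

lemma kl_le_kl_bound:
  assumes a: "a \<in> log_box" and b: "b \<in> log_box"
  shows "kl a b \<le> kl_bound"
proof -
  have "a $ j * (ln (a $ j) - ln (b $ j)) - a $ j + b $ j \<le> 1 - ln \<kappa>" for j
  proof -
    have "a $ j * ln (a $ j) \<le> 0"
      using log_boxD(2,3)[OF a, of j] by (intro mult_nonneg_nonpos) auto
    moreover have "a $ j * (- ln (b $ j)) \<le> 1 * (- ln \<kappa>)"
      using log_boxD(2,3)[OF a, of j] log_boxD(2,3)[OF b, of j] log_box_ge_kappa[OF b, of j] kappa_pos
      by (intro mult_mono) auto
    ultimately show ?thesis
      using log_boxD(2,3)[OF a, of j] log_boxD(3)[OF b, of j] by (simp add: right_diff_distrib)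
  qed
  then show ?thesis
    unfolding kl_def kl_bound_def using sum_bounded_above[of "UNIV :: 'd set" _ "1 - ln \<kappa>"] by auto
qed

lemma inner_h_converges:
  assumes h: "h0 \<in> log_box" and y: "y \<in> C" and \<alpha>: "\<alpha> > 0" "\<alpha> * (2 * L\<^sub>g + \<eta>) \<le> 1"
  shows "norm (inner_h blk \<eta> g_h \<alpha> y h0 t - h_star blk \<eta> g y)
    \<le> sqrt (2 * kl_bound) * sqrt (1 - \<alpha> * \<eta>) ^ t"
proof -
  let ?s = "h_star blk \<eta> g y" and ?h = "inner_h blk \<eta> g_h \<alpha> y h0"
  have "0 \<le> \<alpha> * L\<^sub>g" using \<alpha>(1) constants_nonneg by simp
  then have ae: "\<alpha> * \<eta> \<le> 1" using \<alpha>(2) by (simp add: distrib_left)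
  note box = inner_h_log_box[OF h y \<alpha>(1) ae]
  have "kl ?s (?h t) \<le> kl_bound * (1 - \<alpha> * \<eta>) ^ t"
  proof (induction t)
    case 0
    show ?case using kl_le_kl_bound[OF h_star_log_box[OF y] h] by simp
  next
    case (Suc t)
    have "kl ?s (?h (Suc t)) \<le> (1 - \<alpha> * \<eta>) * kl ?s (?h t)"
      using md_step_contraction[OF box y \<alpha>] by simp
    also have "\<dots> \<le> (1 - \<alpha> * \<eta>) * (kl_bound * (1 - \<alpha> * \<eta>) ^ t)"
      using Suc ae by (intro mult_left_mono) auto
    finally show ?case by (simp add: mult_ac)
  qed
  moreover have "(norm (?s - ?h t))\<^sup>2 / 2 \<le> kl ?s (?h t)"
    using kl_lower_bound[OF log_boxD(1)[OF h_star_log_box[OF y]] log_boxD(1,2)[OF box]] .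
  ultimately have "(norm (?h t - ?s))\<^sup>2 \<le> 2 * kl_bound * (1 - \<alpha> * \<eta>) ^ t"
    by (simp add: norm_minus_commute)
  then have "sqrt ((norm (?h t - ?s))\<^sup>2) \<le> sqrt (2 * kl_bound * (1 - \<alpha> * \<eta>) ^ t)"
    by (rule real_sqrt_le_mono)
  then show ?thesis by (simp add: real_sqrt_mult real_sqrt_power)
qed

section \<open>Sensitivity of the lower-level solution\<close>

abbreviation hs :: "real^'u \<Rightarrow> real^'d" where
  "hs \<equiv> h_star blk \<eta> g"

abbreviation Bs :: "real^'u \<Rightarrow> real^'d \<Rightarrow> real^'d" where
  "Bs y x \<equiv> B_mat blk (hs y) *v x"

lemma hs_simplices: "y \<in> C \<Longrightarrow> hs y \<in> simplices blk"
  and hs_pos: "y \<in> C \<Longrightarrow> hs y $ j > 0"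
  and hs_le_1: "y \<in> C \<Longrightarrow> hs y $ j \<le> 1"
  and hs_ge_kappa: "y \<in> C \<Longrightarrow> hs y $ j \<ge> \<kappa>"
  using log_boxD[OF h_star_log_box] log_box_ge_kappa[OF h_star_log_box] by auto

text \<open>The operator \<open>v \<mapsto> \<eta> v + B H v\<close> of the linearized optimality conditions is bounded below on
  the tangent space, uniformly in \<open>y\<close>.\<close>

lemma coercive:
  assumes y: "y \<in> C" and v: "v \<in> tangent blk"
  shows "\<eta> * norm v \<le> wnorm (hs y) (\<eta> *\<^sub>R v + Bs y (g_hh (hs y) y *v v))"
proof -
  have "\<eta> * norm v \<le> \<eta> * wnorm (hs y) v"
    using eta norm_le_wnorm[OF hs_pos[OF y] hs_le_1[OF y]] by (intro mult_left_mono) auto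
  also have "\<dots> \<le> wnorm (hs y) (\<eta> *\<^sub>R v + Bs y (g_hh (hs y) y *v v))"
    using g_hh_psd[OF hs_simplices[OF y] hs_pos[OF y] y v]
    by (intro wnorm_coercive[OF hs_simplices[OF y] hs_pos[OF y] v _ eta])
  finally show ?thesis .
qed

lemma coercive_B:
  assumes y: "y \<in> C" and v: "v \<in> tangent blk"
    and eq: "\<eta> *\<^sub>R v + Bs y (g_hh (hs y) y *v v) = Bs y x"
  shows "norm v \<le> norm x / \<eta>"
proof -
  have "\<eta> * norm v \<le> norm x"
    using coercive[OF y v] wnorm_B_mat_le[OF hs_simplices[OF y] hs_pos[OF y], of x]
    unfolding eq by linarith
  then show ?thesis using eta by (simp add: field_simps)
qed

lemma sens_exists:
  assumes y: "y \<in> C"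
  shows "\<exists>R :: real^'u^'d. \<forall>w. \<eta> *\<^sub>R (R *v w) + Bs y (g_hh (hs y) y *v (R *v w)) = - Bs y (g_hy (hs y) y *v w)"
proof -
  define Q where "Q = \<eta> *\<^sub>R mat 1 + B_mat blk (hs y) ** g_hh (hs y) y"
  have Q: "Q *v v = \<eta> *\<^sub>R v + Bs y (g_hh (hs y) y *v v)" for v
    by (simp add: Q_def matrix_vector_mult_add_rdistrib matrix_vector_mul_assoc flip: scaleR_matrix_vector_assoc)
  \<comment> \<open>a kernel vector lies in the range of \<open>B\<close>, hence in the tangent space, where \<open>Q\<close> is coercive\<close>
  have "v = 0" if "Q *v v = 0" for v
  proof -
    have "\<eta> *\<^sub>R v = - Bs y (g_hh (hs y) y *v v)"
      using that unfolding Q by (simp add: eq_neg_iff_add_eq_0)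
    then have "v = (1 / \<eta>) *\<^sub>R (- Bs y (g_hh (hs y) y *v v))"
      using eta by (metis divide_self_if less_irrefl mult.commute real_vector.scale_one scaleR_scaleR times_divide_eq_left mult_1)
    then have "v \<in> tangent blk"
      using B_mat_tangent[OF hs_simplices[OF y] hs_pos[OF y]] by (metis tangent_scaleR tangent_uminus)
    then have "\<eta> * norm v \<le> wnorm (hs y) 0"
      using coercive[OF y] that unfolding Q by metis
    then show "v = 0" using eta by (simp add: wnorm_def mult_le_0_iff flip: zero_vec_def)
  qed
  then obtain P where "P ** Q = mat 1"
    using matrix_left_invertible_ker by blast
  then have QP: "Q ** P = mat 1" by (simp add: matrix_left_right_inverse)
  define R where "R = 0 - P ** (B_mat blk (hs y) ** g_hy (hs y) y)"
  have "Q *v (R *v w) = - Bs y (g_hy (hs y) y *v w)" for w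
  proof -
    have "R *v w = 0 - P *v (Bs y (g_hy (hs y) y *v w))"
      unfolding R_def matrix_vector_mult_diff_rdistrib by (simp add: matrix_vector_mul_assoc)
    then have "Q *v (R *v w) = 0 - (Q ** P) *v (Bs y (g_hy (hs y) y *v w))"
      by (simp only: matrix_vector_mult_diff_distrib matrix_vector_mul_assoc matrix_mul_assoc
          matrix_vector_mult_0_right)
    then show ?thesis by (simp add: QP)
  qed
  then show ?thesis unfolding Q by blast
qed

text \<open>The sensitivity matrix of the lower-level solution, obtained by differentiating the
  optimality conditions.  It is defined as a solution of the linearized conditions and shown below
  to be a derivative of the solution map.\<close>

definition sens :: "real^'u \<Rightarrow> real^'u^'d" where
  "sens y = (SOME R. \<forall>w. \<eta> *\<^sub>R (R *v w) + Bs y (g_hh (hs y) y *v (R *v w)) = - Bs y (g_hy (hs y) y *v w))"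

lemma sens_eq:
  "y \<in> C \<Longrightarrow> \<eta> *\<^sub>R (sens y *v w) + Bs y (g_hh (hs y) y *v (sens y *v w)) = - Bs y (g_hy (hs y) y *v w)"
  unfolding sens_def using someI_ex[OF sens_exists] by blast

lemma sens_tangent:
  assumes y: "y \<in> C"
  shows "sens y *v w \<in> tangent blk"
proof -
  let ?v = "sens y *v w"
  have "\<eta> *\<^sub>R ?v = - Bs y (g_hy (hs y) y *v w) - Bs y (g_hh (hs y) y *v ?v)"
    using sens_eq[OF y, of w] by (simp add: eq_diff_eq)
  also have "\<dots> \<in> tangent blk"
    by (intro tangent_diff tangent_uminus B_mat_tangent hs_simplices hs_pos y)
  finally have "(1 / \<eta>) *\<^sub>R (\<eta> *\<^sub>R ?v) \<in> tangent blk" by (rule tangent_scaleR)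
  then show ?thesis using eta by simp
qed

text \<open>A Lipschitz constant of the solution map and a bound for its sensitivity matrix.\<close>

definition lip_h :: real where "lip_h = \<Lambda>\<^sub>g / \<eta>"

lemma lip_h_nonneg: "lip_h \<ge> 0"
  using constants_nonneg eta by (simp add: lip_h_def)

lemma norm_sens_le:
  assumes y: "y \<in> C"
  shows "norm (sens y *v w) \<le> lip_h * norm w"
proof -
  have "norm (sens y *v w) \<le> norm (- (g_hy (hs y) y *v w)) / \<eta>"
    by (rule coercive_B[OF y sens_tangent[OF y]])
      (simp add: sens_eq[OF y] matrix_vector_mult_diff_distrib[of _ 0, simplified])
  also have "\<dots> \<le> \<Lambda>\<^sub>g * norm w / \<eta>"
    using norm_g_hy_le[OF hs_simplices[OF y] y] eta by (simp add: divide_right_mono)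
  finally show ?thesis by (simp add: lip_h_def)
qed

lemma hs_lipschitz:
  assumes y: "y \<in> C" and y': "y' \<in> C"
  shows "norm (hs y' - hs y) \<le> lip_h * norm (y' - y)"
proof (cases "hs y' = hs y")
  case False
  let ?d = "hs y' - hs y"
  have t: "?d \<in> tangent blk" using hs_simplices y y' by (intro simplices_diff_tangent) auto
  have "g_reg_h \<eta> g_h (hs z) z \<bullet> ?d = 0" if "z \<in> C" for z
    using block_constant_inner_tangent[OF _ t] kkt_h_star[OF that] by (auto simp: kkt_def)
  then have 0: "(g_h (hs y') y' - g_h (hs y) y) \<bullet> ?d + \<eta> * ((ln_vec (hs y') - ln_vec (hs y)) \<bullet> ?d) = 0"
    using y y' by (simp add: g_reg_h_eq inner_add_left inner_diff_left algebra_simps)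
  have 1: "0 \<le> (g_h (hs y') y' - g_h (hs y) y') \<bullet> ?d"
    using g_h_monotone hs_simplices y y' by blast
  have "\<bar>(g_h (hs y) y' - g_h (hs y) y) \<bullet> ?d\<bar> \<le> norm (g_h (hs y) y' - g_h (hs y) y) * norm ?d"
    by (rule Cauchy_Schwarz_ineq2)
  also have "\<dots> \<le> (\<Lambda>\<^sub>g * norm (y' - y)) * norm ?d"
    using g_h_lipschitz_y[OF hs_simplices[OF y] y y'] by (intro mult_right_mono) auto
  finally have 2: "\<bar>(g_h (hs y) y' - g_h (hs y) y) \<bullet> ?d\<bar> \<le> (\<Lambda>\<^sub>g * norm (y' - y)) * norm ?d" .
  have "\<eta> * (norm ?d)\<^sup>2 \<le> \<eta> * ((ln_vec (hs y') - ln_vec (hs y)) \<bullet> ?d)"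
    using ln_vec_strongly_monotone[OF hs_simplices[OF y'] hs_simplices[OF y] hs_pos[OF y'] hs_pos[OF y]] eta
    by (intro mult_left_mono) auto
  also have "\<dots> \<le> (\<Lambda>\<^sub>g * norm (y' - y)) * norm ?d"
    using 0 1 2 by (simp add: inner_diff_left)
  finally have "\<eta> * norm ?d \<le> \<Lambda>\<^sub>g * norm (y' - y)"
    using False by (simp add: power2_eq_square)
  then show ?thesis using eta by (simp add: lip_h_def field_simps)
qed (simp add: lip_h_nonneg)

text \<open>The second-order remainder below satisfies the linearized optimality conditions with a
  quadratically small right-hand side.\<close>

lemma hs_linearization:
  "\<exists>c\<ge>0. \<forall>y\<in>C. \<forall>y'\<in>C. norm (hs y' - hs y - sens y *v (y' - y)) \<le> c * (norm (y' - y))\<^sup>2"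
proof -
  define c where "c = (\<eta> * (lip_h\<^sup>2 / \<kappa>\<^sup>2) + (\<bar>\<rho>h\<bar> * lip_h\<^sup>2 + \<bar>\<rho>y\<bar> * lip_h + \<bar>\<tau>y\<bar>)) / \<eta>"
  have "norm (hs y' - hs y - sens y *v (y' - y)) \<le> c * (norm (y' - y))\<^sup>2"
    if y: "y \<in> C" and y': "y' \<in> C" for y y'
  proof -
    let ?h = "hs y" and ?h' = "hs y'" and ?w = "y' - y"
    define d where "d = ?h' - ?h"
    let ?r = "d - sens y *v ?w"
    define x1 where "x1 = (\<chi> j. d $ j / ?h $ j) - (ln_vec ?h' - ln_vec ?h)"
    define x2 where "x2 = g_h ?h' y' - g_h ?h y - (g_hh ?h y *v d + g_hy ?h y *v ?w)"
    define x where "x = \<eta> *\<^sub>R x1 - x2"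
    have dt: "d \<in> tangent blk"
      using hs_simplices y y' unfolding d_def by (intro simplices_diff_tangent) auto
    have d: "norm d \<le> lip_h * norm ?w" using hs_lipschitz[OF y y'] by (simp add: d_def)
    have d2: "(norm d)\<^sup>2 \<le> lip_h\<^sup>2 * (norm ?w)\<^sup>2"
      using power_mono[OF d norm_ge_zero, of 2] by (simp add: power_mult_distrib)
    \<comment> \<open>by optimality the regularized gradients at both points are killed by \<open>B\<close>\<close>
    have bc: "Bs y (g_reg_h \<eta> g_h (hs z) z) = 0" if "z \<in> C" for z
      using B_mat_block_constant[OF hs_simplices[OF y] hs_pos[OF y]] kkt_h_star[OF that]
      by (auto simp: kkt_def)
    have xeq: "x = \<eta> *\<^sub>R (\<chi> j. d $ j / ?h $ j) + g_hh ?h y *v d + g_hy ?h y *v ?w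
        - (g_reg_h \<eta> g_h ?h' y' - g_reg_h \<eta> g_h ?h y)"
      by (simp add: x_def x1_def x2_def g_reg_h_eq algebra_simps)
    have "Bs y x = \<eta> *\<^sub>R d + Bs y (g_hh ?h y *v d) + Bs y (g_hy ?h y *v ?w)"
      unfolding xeq matrix_vector_mult_diff_distrib matrix_vector_right_distrib matrix_vector_mult_scaleR
        bc[OF y] bc[OF y'] B_mat_div_tangent[OF hs_simplices[OF y] hs_pos[OF y] dt] by simp
    also have "\<dots> = \<eta> *\<^sub>R ?r + Bs y (g_hh ?h y *v ?r)"
      using sens_eq[OF y, of ?w]
      by (simp add: matrix_vector_mult_diff_distrib scaleR_diff_right algebra_simps)
    finally have "norm ?r \<le> norm x / \<eta>"
      by (intro coercive_B[OF y]) (auto intro: tangent_diff dt sens_tangent[OF y])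
    also have "norm x \<le> \<eta> * norm x1 + norm x2"
      unfolding x_def using norm_triangle_ineq4[of "\<eta> *\<^sub>R x1" x2] eta by simp
    also have "norm x1 \<le> (norm d)\<^sup>2 / \<kappa>\<^sup>2"
      unfolding x1_def d_def
      by (rule norm_linearization_ln_le[OF kappa_pos hs_ge_kappa[OF y] hs_ge_kappa[OF y']])
    also have "\<dots> \<le> lip_h\<^sup>2 * (norm ?w)\<^sup>2 / \<kappa>\<^sup>2"
      using d2 by (intro divide_right_mono) auto
    also have "norm x2 \<le> \<bar>\<rho>h\<bar> * (norm d)\<^sup>2 + \<bar>\<rho>y\<bar> * norm ?w * norm d + \<bar>\<tau>y\<bar> * (norm ?w)\<^sup>2"
      unfolding x2_def d_def by (rule g_h_linearization[OF hs_simplices[OF y] hs_simplices[OF y'] y y'])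
    also have "\<dots> \<le> \<bar>\<rho>h\<bar> * (lip_h\<^sup>2 * (norm ?w)\<^sup>2) + \<bar>\<rho>y\<bar> * norm ?w * (lip_h * norm ?w) + \<bar>\<tau>y\<bar> * (norm ?w)\<^sup>2"
      using d d2 by (intro add_mono mult_left_mono) auto
    also have "(\<eta> * (lip_h\<^sup>2 * (norm ?w)\<^sup>2 / \<kappa>\<^sup>2) + \<dots>) / \<eta> = c * (norm ?w)\<^sup>2"
      by (simp add: c_def power2_eq_square algebra_simps add_divide_distrib)
    finally show ?thesis
      using eta by (simp add: d_def divide_right_mono)
  qed
  moreover have "c \<ge> 0"
    unfolding c_def using eta lip_h_nonneg by simp
  ultimately show ?thesis by blast
qed

lemma g_hh_joint_lipschitz:
  assumes "h \<in> simplices blk" "h' \<in> simplices blk" "y \<in> C" "y' \<in> C"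
  shows "norm (g_hh h' y' *v v - g_hh h y *v v) \<le> (\<bar>\<rho>h\<bar> * norm (h' - h) + \<bar>\<rho>y\<bar> * norm (y' - y)) * norm v"
  using spectral_lipschitz_onD[OF g_hh_lipschitz_h[OF assms(4)] assms(2,1), of v]
    spectral_lipschitz_onD[OF g_hh_lipschitz_y[OF assms(1)] assms(4,3), of v]
    norm_triangle_ineq[of "g_hh h' y' *v v - g_hh h y' *v v" "g_hh h y' *v v - g_hh h y *v v"]
  by (simp add: dist_norm distrib_right)

lemma g_hy_joint_lipschitz:
  assumes "h \<in> simplices blk" "h' \<in> simplices blk" "y \<in> C" "y' \<in> C"
  shows "norm (g_hy h' y' *v v - g_hy h y *v v) \<le> (\<bar>\<tau>h\<bar> * norm (h' - h) + \<bar>\<tau>y\<bar> * norm (y' - y)) * norm v"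
  using spectral_lipschitz_onD[OF g_hy_lipschitz_h[OF assms(4)] assms(2,1), of v]
    spectral_lipschitz_onD[OF g_hy_lipschitz_y[OF assms(1)] assms(4,3), of v]
    norm_triangle_ineq[of "g_hy h' y' *v v - g_hy h y' *v v" "g_hy h y' *v v - g_hy h y *v v"]
  by (simp add: dist_norm distrib_right)

lemma sens_lipschitz:
  "\<exists>c\<ge>0. \<forall>y\<in>C. \<forall>y'\<in>C. \<forall>w. norm (sens y' *v w - sens y *v w) \<le> c * norm (y' - y) * norm w"
proof -
  define c1 where "c1 = (\<bar>\<rho>h\<bar> * lip_h + \<bar>\<rho>y\<bar>) * lip_h + (\<bar>\<tau>h\<bar> * lip_h + \<bar>\<tau>y\<bar>)"
  define c2 where "c2 = 3 * real CARD('d) * lip_h * (L\<^sub>g * lip_h + \<Lambda>\<^sub>g)"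
  define c where "c = (c1 + c2 / sqrt \<kappa>) / \<eta>"
  have "norm (sens y' *v w - sens y *v w) \<le> c * norm (y' - y) * norm w"
    if y: "y \<in> C" and y': "y' \<in> C" for y y' w
  proof -
    let ?h = "hs y" and ?h' = "hs y'" and ?n = "norm (y' - y)"
    define r where "r = sens y *v w"
    define r' where "r' = sens y' *v w"
    let ?X = "g_hh ?h y *v r' + g_hy ?h y *v w"
    define X' where "X' = g_hh ?h' y' *v r' + g_hy ?h' y' *v w"
    define x where "x = ?X - X'"
    define z where "z = B_mat blk ?h *v X' - B_mat blk ?h' *v X'"
    have t: "r' - r \<in> tangent blk"
      unfolding r_def r'_def using y y' by (intro tangent_diff sens_tangent)
    have r': "norm r' \<le> lip_h * norm w" unfolding r'_def by (rule norm_sens_le[OF y'])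
    have hh: "norm (?h' - ?h) \<le> lip_h * ?n" by (rule hs_lipschitz[OF y y'])
    have xb: "norm x \<le> c1 * ?n * norm w"
    proof -
      have "norm (g_hh ?h' y' *v r' - g_hh ?h y *v r')
          \<le> (\<bar>\<rho>h\<bar> * norm (?h' - ?h) + \<bar>\<rho>y\<bar> * ?n) * norm r'"
        by (rule g_hh_joint_lipschitz[OF hs_simplices[OF y] hs_simplices[OF y'] y y'])
      also have "\<dots> \<le> (\<bar>\<rho>h\<bar> * (lip_h * ?n) + \<bar>\<rho>y\<bar> * ?n) * (lip_h * norm w)"
        using hh r' lip_h_nonneg by (intro mult_mono add_mono mult_left_mono) auto
      finally have 1: "norm (g_hh ?h' y' *v r' - g_hh ?h y *v r')
          \<le> (\<bar>\<rho>h\<bar> * (lip_h * ?n) + \<bar>\<rho>y\<bar> * ?n) * (lip_h * norm w)" .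
      have "norm (g_hy ?h' y' *v w - g_hy ?h y *v w)
          \<le> (\<bar>\<tau>h\<bar> * norm (?h' - ?h) + \<bar>\<tau>y\<bar> * ?n) * norm w"
        by (rule g_hy_joint_lipschitz[OF hs_simplices[OF y] hs_simplices[OF y'] y y'])
      also have "\<dots> \<le> (\<bar>\<tau>h\<bar> * (lip_h * ?n) + \<bar>\<tau>y\<bar> * ?n) * norm w"
        using hh by (intro mult_right_mono add_mono mult_left_mono) auto
      finally have 2: "norm (g_hy ?h' y' *v w - g_hy ?h y *v w)
          \<le> (\<bar>\<tau>h\<bar> * (lip_h * ?n) + \<bar>\<tau>y\<bar> * ?n) * norm w" .
      have "norm x = norm ((g_hh ?h' y' *v r' - g_hh ?h y *v r') + (g_hy ?h' y' *v w - g_hy ?h y *v w))"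
        unfolding x_def X'_def by (subst norm_minus_cancel[symmetric]) (simp add: algebra_simps)
      also have "\<dots> \<le> (\<bar>\<rho>h\<bar> * (lip_h * ?n) + \<bar>\<rho>y\<bar> * ?n) * (lip_h * norm w)
          + (\<bar>\<tau>h\<bar> * (lip_h * ?n) + \<bar>\<tau>y\<bar> * ?n) * norm w"
        by (rule order_trans[OF norm_triangle_ineq add_mono[OF 1 2]])
      also have "\<dots> = c1 * ?n * norm w" by (simp add: c1_def algebra_simps)
      finally show ?thesis .
    qed
    have zb: "norm z \<le> c2 * ?n * norm w"
    proof -
      have "norm X' \<le> L\<^sub>g * norm r' + \<Lambda>\<^sub>g * norm w"
        unfolding X'_def using norm_g_hh_le[OF hs_simplices[OF y'] y'] norm_g_hy_le[OF hs_simplices[OF y'] y']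
        by (intro order_trans[OF norm_triangle_ineq] add_mono)
      also have "\<dots> \<le> L\<^sub>g * (lip_h * norm w) + \<Lambda>\<^sub>g * norm w"
        using r' constants_nonneg by (intro add_mono mult_left_mono) auto
      finally have X': "norm X' \<le> (L\<^sub>g * lip_h + \<Lambda>\<^sub>g) * norm w" by (simp add: algebra_simps)
      have "norm z \<le> 3 * real CARD('d) * norm (?h - ?h') * norm X'"
        unfolding z_def by (rule B_mat_lipschitz[OF hs_simplices[OF y] hs_simplices[OF y']])
      also have "\<dots> \<le> 3 * real CARD('d) * (lip_h * ?n) * ((L\<^sub>g * lip_h + \<Lambda>\<^sub>g) * norm w)"
        using hh X' lip_h_nonneg by (intro mult_mono mult_left_mono) (auto simp: norm_minus_commute)
      finally show ?thesis by (simp add: c2_def algebra_simps)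
    qed
    have e: "\<eta> *\<^sub>R r + Bs y (g_hh ?h y *v r) = - Bs y (g_hy ?h y *v w)"
      unfolding r_def by (rule sens_eq[OF y])
    have e': "\<eta> *\<^sub>R r' + Bs y' (g_hh ?h' y' *v r') = - Bs y' (g_hy ?h' y' *v w)"
      unfolding r'_def by (rule sens_eq[OF y'])
    have "\<eta> *\<^sub>R (r' - r) + Bs y (g_hh ?h y *v (r' - r))
        = (\<eta> *\<^sub>R r' + Bs y (g_hh ?h y *v r')) - (\<eta> *\<^sub>R r + Bs y (g_hh ?h y *v r))"
      by (simp add: matrix_vector_mult_diff_distrib scaleR_diff_right)
    also have "\<dots> = \<eta> *\<^sub>R r' + Bs y ?X"
      unfolding e by (simp add: matrix_vector_right_distrib)
    also have "\<eta> *\<^sub>R r' = (\<eta> *\<^sub>R r' + Bs y' (g_hh ?h' y' *v r')) - Bs y' (g_hh ?h' y' *v r')"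
      by simp
    also have "\<dots> = - Bs y' X'"
      unfolding e' X'_def by (simp add: matrix_vector_right_distrib)
    finally have *: "\<eta> *\<^sub>R (r' - r) + Bs y (g_hh ?h y *v (r' - r)) = Bs y x + z"
      by (simp add: x_def z_def matrix_vector_mult_diff_distrib)
    have "\<eta> * norm (r' - r) \<le> wnorm ?h (Bs y x + z)"
      using coercive[OF y t] unfolding * .
    also have "\<dots> \<le> norm x + norm z / sqrt \<kappa>"
      using wnorm_triangle wnorm_B_mat_le[OF hs_simplices[OF y] hs_pos[OF y]]
        wnorm_le_norm[OF kappa_pos hs_ge_kappa[OF y]]
      by (meson add_mono order_trans)
    also have "\<dots> \<le> c1 * ?n * norm w + c2 * ?n * norm w / sqrt \<kappa>"
      using xb zb kappa_pos by (intro add_mono divide_right_mono) auto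
    finally have "norm (r' - r) \<le> (c1 * ?n * norm w + c2 * ?n * norm w / sqrt \<kappa>) / \<eta>"
      using eta by (simp add: field_simps)
    also have "\<dots> = c * ?n * norm w"
      by (simp add: c_def add_divide_distrib distrib_right)
    finally show ?thesis by (simp add: r_def r'_def)
  qed
  moreover have "c \<ge> 0"
    unfolding c_def c1_def c2_def using lip_h_nonneg constants_nonneg kappa_pos eta by simp
  ultimately show ?thesis by blast
qed

lemma hs_has_derivative:
  assumes y: "y \<in> C"
  shows "(hs has_derivative (\<lambda>w. sens y *v w)) (at y within C)"
proof -
  obtain c where c: "c \<ge> 0" "\<And>y y'. y \<in> C \<Longrightarrow> y' \<in> C \<Longrightarrow>
      norm (hs y' - hs y - sens y *v (y' - y)) \<le> c * (norm (y' - y))\<^sup>2"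
    using hs_linearization by blast
  show ?thesis
    unfolding has_derivative_within_alt
  proof (intro conjI allI impI matrix_vector_mul_bounded_linear)
    fix e :: real assume e: "e > 0"
    show "\<exists>d>0. \<forall>y'\<in>C. norm (y' - y) < d \<longrightarrow> norm (hs y' - hs y - sens y *v (y' - y)) \<le> e * norm (y' - y)"
    proof (intro exI[of _ "e / (c + 1)"] conjI ballI impI)
      fix y' assume y': "y' \<in> C" and n: "norm (y' - y) < e / (c + 1)"
      have "c * norm (y' - y) \<le> (c + 1) * norm (y' - y)" by (intro mult_right_mono) auto
      also have "\<dots> \<le> e" using n c(1) by (simp add: field_simps)
      finally have "c * norm (y' - y) * norm (y' - y) \<le> e * norm (y' - y)"
        by (intro mult_right_mono) auto
      then show "norm (hs y' - hs y - sens y *v (y' - y)) \<le> e * norm (y' - y)"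
        using c(2)[OF y y'] by (simp add: power2_eq_square)
    qed (use e c in auto)
  qed
qed

lemma R_star_eq_sens_along:
  assumes y: "y \<in> C" and y': "y' \<in> C"
  shows "R_star blk C \<eta> g y *v (y' - y) = sens y *v (y' - y)"
proof -
  have "hs differentiable (at y within C)"
    using hs_has_derivative[OF y] by (auto simp: differentiable_def)
  then have "(hs has_derivative (\<lambda>w. R_star blk C \<eta> g y *v w)) (at y within C)"
    unfolding R_star_def jacobian_works .
  from has_derivative_within_convex_unique[OF C(3) y y' this hs_has_derivative[OF y]]
  show ?thesis .
qed

section \<open>Convergence of the differentiated iterates\<close>

abbreviation ih :: "real \<Rightarrow> real^'u \<Rightarrow> real^'d \<Rightarrow> nat \<Rightarrow> real^'d" where
  "ih \<equiv> inner_h blk \<eta> g_h"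

abbreviation iR :: "real \<Rightarrow> real^'u \<Rightarrow> real^'d \<Rightarrow> nat \<Rightarrow> real^'u^'d" where
  "iR \<equiv> inner_R blk \<eta> g_h g_hh g_hy"

lemma inner_R_Suc_mult:
  "iR \<alpha> y h0 (Suc t) *v w = B_mat blk (ih \<alpha> y h0 (Suc t)) *v
     ((1 - \<alpha> * \<eta>) *\<^sub>R (\<chi> j. (iR \<alpha> y h0 t *v w) $ j / ih \<alpha> y h0 t $ j)
      - \<alpha> *\<^sub>R (g_hh (ih \<alpha> y h0 t) y *v (iR \<alpha> y h0 t *v w) + g_hy (ih \<alpha> y h0 t) y *v w))"
proof -
  let ?h = "ih \<alpha> y h0 t" and ?r = "iR \<alpha> y h0 t *v w"
  define B where "B = B_mat blk (ih \<alpha> y h0 (Suc t))"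
  have "iR \<alpha> y h0 (Suc t) *v w
      = B *v (((1 - \<eta> * \<alpha>) *\<^sub>R diag_mat (\<chi> j. 1 / ?h $ j) - \<alpha> *\<^sub>R g_hh ?h y) *v ?r)
        + (- \<alpha>) *\<^sub>R (B *v (g_hy ?h y *v w))"
    by (simp add: Let_def B_def matrix_vector_mult_add_rdistrib matrix_vector_mult_diff_rdistrib
        flip: matrix_vector_mul_assoc scaleR_matrix_vector_assoc)
  also have "((1 - \<eta> * \<alpha>) *\<^sub>R diag_mat (\<chi> j. 1 / ?h $ j) - \<alpha> *\<^sub>R g_hh ?h y) *v ?r
      = (1 - \<alpha> * \<eta>) *\<^sub>R (\<chi> j. ?r $ j / ?h $ j) - \<alpha> *\<^sub>R (g_hh ?h y *v ?r)"
    by (simp add: matrix_vector_mult_diff_rdistrib diag_mat_mult mult.commute[of \<eta>]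
        flip: scaleR_matrix_vector_assoc)
  finally show ?thesis
    unfolding B_def
    by (simp add: matrix_vector_mult_diff_distrib matrix_vector_right_distrib matrix_vector_mult_scaleR
        scaleR_right_distrib)
qed

text \<open>Because of the factor \<open>B\<close> the columns of \<open>R\<close> stay in the tangent space, the only space on
  which \<open>g_hh\<close> is known to be semidefinite.\<close>

lemma inner_R_tangent:
  assumes "h0 \<in> log_box" "y \<in> C" "\<alpha> > 0" "\<alpha> * \<eta> \<le> 1"
  shows "iR \<alpha> y h0 t *v w \<in> tangent blk"
proof (cases t)
  case 0
  then show ?thesis by (simp add: tangent_0)
next
  case (Suc s)
  note box = inner_h_log_box[OF assms, of "Suc s"]
  show ?thesis
    unfolding Suc inner_R_Suc_mult by (rule B_mat_tangent[OF log_boxD(1,2)[OF box]])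
qed

text \<open>The step sizes for which the iterates and their derivatives both converge linearly.\<close>

definition step_ok :: "real \<Rightarrow> bool" where
  "step_ok \<alpha> \<longleftrightarrow> 0 < \<alpha> \<and> \<alpha> * (2 * L\<^sub>g + \<eta>) \<le> 1 \<and> \<alpha> * (\<eta>\<^sup>2 + L\<^sub>g\<^sup>2) \<le> \<eta> \<and> \<alpha> * \<eta> < 1"

text \<open>The contraction factor of the differentiated step in the local norm; its square is the
  contraction factor of the mirror descent step in divergence.\<close>

definition rate :: "real \<Rightarrow> real" where
  "rate \<alpha> = sqrt (1 - \<alpha> * \<eta>)"

lemma rate_bounds: "step_ok \<alpha> \<Longrightarrow> 0 < rate \<alpha>" "step_ok \<alpha> \<Longrightarrow> rate \<alpha> < 1"
  using eta by (auto simp: step_ok_def rate_def)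

lemma inner_h_error:
  assumes "step_ok \<alpha>" "y \<in> C" "h0 \<in> log_box"
  shows "norm (ih \<alpha> y h0 t - hs y) \<le> sqrt (2 * kl_bound) * rate \<alpha> ^ t"
  using inner_h_converges[OF assms(3,2)] assms(1) by (simp add: step_ok_def rate_def)

text \<open>The error of the differentiated iterates contracts in the local norm at the solution, up to
  perturbations proportional to the error of the iterates themselves.\<close>

lemma inner_R_error_step:
  assumes ok: "step_ok \<alpha>"
  shows "\<exists>c\<ge>0. \<forall>y\<in>C. \<forall>h0\<in>log_box. \<forall>t w.
    wnorm (hs y) (iR \<alpha> y h0 (Suc t) *v w - sens y *v w)
      \<le> rate \<alpha> * wnorm (hs y) (iR \<alpha> y h0 t *v w - sens y *v w)
        + c * rate \<alpha> ^ t * (wnorm (hs y) (iR \<alpha> y h0 t *v w - sens y *v w) + norm w)"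
proof -
  define K where "K = sqrt (2 * kl_bound)"
  define l where "l = 1 + lip_h"
  define cX where "cX = l / \<kappa> + \<alpha> * (L\<^sub>g * l + \<Lambda>\<^sub>g)"
  define c where "c = 3 * real CARD('d) * K * cX / sqrt \<kappa> + K * l / \<kappa>\<^sup>2 + \<alpha> * \<bar>\<rho>h\<bar> * K * l + \<alpha> * \<bar>\<tau>h\<bar> * K"
  have \<alpha>: "\<alpha> > 0" "\<alpha> * \<eta> \<le> 1" "\<alpha> * (\<eta>\<^sup>2 + L\<^sub>g\<^sup>2) \<le> \<eta>"
    using ok by (auto simp: step_ok_def)
  obtain y1 where "y1 \<in> C" using C by blast
  then have "0 \<le> kl_bound"
    using kl_le_kl_bound[OF h_star_log_box h_star_log_box] kl_nonneg[OF hs_simplices hs_simplices hs_pos]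
    by (meson order_trans)
  then have K0: "K \<ge> 0" by (simp add: K_def)
  have l1: "l \<ge> 1" using lip_h_nonneg by (simp add: l_def)
  have cX0: "cX \<ge> 0"
    unfolding cX_def using l1 kappa_pos \<alpha> constants_nonneg by simp
  have c0: "c \<ge> 0"
    unfolding c_def using K0 l1 cX0 kappa_pos \<alpha>
    by (intro add_nonneg_nonneg mult_nonneg_nonneg divide_nonneg_nonneg) auto
  have "wnorm (hs y) (iR \<alpha> y h0 (Suc t) *v w - sens y *v w)
      \<le> rate \<alpha> * wnorm (hs y) (iR \<alpha> y h0 t *v w - sens y *v w)
        + c * rate \<alpha> ^ t * (wnorm (hs y) (iR \<alpha> y h0 t *v w - sens y *v w) + norm w)"
    if y: "y \<in> C" and h0: "h0 \<in> log_box" for y h0 t w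
  proof -
    define h where "h = ih \<alpha> y h0 t"
    define h' where "h' = ih \<alpha> y h0 (Suc t)"
    define r where "r = iR \<alpha> y h0 t *v w"
    define x where "x = sens y *v w"
    define e where "e = r - x"
    define s where "s = wnorm (hs y) e + norm w"
    define \<delta> where "\<delta> = K * rate \<alpha> ^ t"
    have \<delta>0: "\<delta> \<ge> 0" using K0 rate_bounds[OF ok] by (simp add: \<delta>_def)
    have s0: "s \<ge> 0" "norm w \<le> s" by (simp_all add: s_def wnorm_nonneg)
    have hbox: "h \<in> log_box" and h'box: "h' \<in> log_box"
      unfolding h_def h'_def by (rule inner_h_log_box[OF h0 y \<alpha>(1,2)])+
    note hS = log_boxD(1)[OF hbox] and h'S = log_boxD(1)[OF h'box] and sS = hs_simplices[OF y]
    have h\<delta>: "norm (h - hs y) \<le> \<delta>"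
      unfolding h_def \<delta>_def K_def by (rule inner_h_error[OF ok y h0])
    have h'\<delta>: "norm (h' - hs y) \<le> \<delta>"
    proof -
      have "norm (h' - hs y) \<le> K * rate \<alpha> ^ Suc t"
        unfolding h'_def K_def by (rule inner_h_error[OF ok y h0])
      also have "\<dots> \<le> K * rate \<alpha> ^ t"
        using K0 rate_bounds[OF ok] by (intro mult_left_mono power_decreasing) auto
      finally show ?thesis by (simp add: \<delta>_def)
    qed
    have et: "e \<in> tangent blk"
      unfolding e_def r_def x_def by (intro tangent_diff inner_R_tangent[OF h0 y \<alpha>(1,2)] sens_tangent[OF y])
    have rb: "norm r \<le> l * s"
    proof -
      have "norm r \<le> norm e + norm x" unfolding e_def using norm_triangle_sub[of r x] by simp
      also have "\<dots> \<le> wnorm (hs y) e + lip_h * norm w"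
        unfolding x_def using norm_le_wnorm[OF hs_pos[OF y] hs_le_1[OF y]] norm_sens_le[OF y]
        by (intro add_mono)
      also have "\<dots> \<le> s + lip_h * s"
        using s0 lip_h_nonneg by (intro add_mono mult_left_mono) (auto simp: s_def)
      finally show ?thesis by (simp add: l_def distrib_right)
    qed
    \<comment> \<open>\<open>X\<close> is the argument of \<open>B\<close> in the recursion, and \<open>Y\<close> the error caused in it by evaluating the
      coefficients at the iterate instead of the solution\<close>
    define X where "X = (1 - \<alpha> * \<eta>) *\<^sub>R (\<chi> j. r $ j / h $ j) - \<alpha> *\<^sub>R (g_hh h y *v r + g_hy h y *v w)"
    have Xb: "norm X \<le> cX * s"
    proof -
      have "norm ((1 - \<alpha> * \<eta>) *\<^sub>R (\<chi> j. r $ j / h $ j)) \<le> 1 * (norm r / \<kappa>)"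
        unfolding norm_scaleR using \<alpha> eta norm_divide_le[OF kappa_pos log_box_ge_kappa[OF hbox]]
        by (intro mult_mono) auto
      also have "\<dots> \<le> l * s / \<kappa>" using rb kappa_pos by (simp add: divide_right_mono)
      finally have 1: "norm ((1 - \<alpha> * \<eta>) *\<^sub>R (\<chi> j. r $ j / h $ j)) \<le> l * s / \<kappa>" .
      have "norm (g_hh h y *v r + g_hy h y *v w) \<le> L\<^sub>g * norm r + \<Lambda>\<^sub>g * norm w"
        using norm_g_hh_le[OF hS y] norm_g_hy_le[OF hS y]
        by (intro order_trans[OF norm_triangle_ineq] add_mono)
      also have "\<dots> \<le> L\<^sub>g * (l * s) + \<Lambda>\<^sub>g * s"
        using rb s0 constants_nonneg by (intro add_mono mult_left_mono) auto
      finally have 2: "norm (\<alpha> *\<^sub>R (g_hh h y *v r + g_hy h y *v w)) \<le> \<alpha> * (L\<^sub>g * (l * s) + \<Lambda>\<^sub>g * s)"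
        using \<alpha> by simp
      show ?thesis
        unfolding X_def
        by (rule order_trans[OF norm_triangle_ineq4 order_trans[OF add_mono[OF 1 2]]])
          (simp add: cX_def algebra_simps)
    qed
    define Y where "Y = (1 - \<alpha> * \<eta>) *\<^sub>R ((\<chi> j. r $ j / h $ j) - (\<chi> j. r $ j / hs y $ j))
        - \<alpha> *\<^sub>R (g_hh h y *v r - g_hh (hs y) y *v r) - \<alpha> *\<^sub>R (g_hy h y *v w - g_hy (hs y) y *v w)"
    have Yb: "norm Y \<le> (K * l / \<kappa>\<^sup>2 + \<alpha> * \<bar>\<rho>h\<bar> * K * l + \<alpha> * \<bar>\<tau>h\<bar> * K) * rate \<alpha> ^ t * s"
    proof -
      have "norm ((1 - \<alpha> * \<eta>) *\<^sub>R ((\<chi> j. r $ j / h $ j) - (\<chi> j. r $ j / hs y $ j)))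
          \<le> 1 * (norm (h - hs y) / \<kappa>\<^sup>2 * norm r)"
        unfolding norm_scaleR
        using \<alpha> eta norm_divide_diff_le[OF kappa_pos log_box_ge_kappa[OF hbox] hs_ge_kappa[OF y]]
        by (intro mult_mono) auto
      also have "\<dots> \<le> 1 * (\<delta> / \<kappa>\<^sup>2 * (l * s))"
        using h\<delta> rb \<delta>0 by (intro mult_left_mono mult_mono divide_right_mono) auto
      finally have 1: "norm ((1 - \<alpha> * \<eta>) *\<^sub>R ((\<chi> j. r $ j / h $ j) - (\<chi> j. r $ j / hs y $ j)))
          \<le> \<delta> / \<kappa>\<^sup>2 * (l * s)" by simp
      have "norm (g_hh h y *v r - g_hh (hs y) y *v r) \<le> \<bar>\<rho>h\<bar> * norm (h - hs y) * norm r"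
        using g_hh_joint_lipschitz[OF sS hS y y, of r] by simp
      also have "\<dots> \<le> \<bar>\<rho>h\<bar> * \<delta> * (l * s)"
        using h\<delta> rb \<delta>0 by (intro mult_mono mult_left_mono) auto
      finally have 2: "norm (\<alpha> *\<^sub>R (g_hh h y *v r - g_hh (hs y) y *v r)) \<le> \<alpha> * (\<bar>\<rho>h\<bar> * \<delta> * (l * s))"
        using \<alpha> by simp
      have "norm (g_hy h y *v w - g_hy (hs y) y *v w) \<le> \<bar>\<tau>h\<bar> * norm (h - hs y) * norm w"
        using g_hy_joint_lipschitz[OF sS hS y y, of w] by simp
      also have "\<dots> \<le> \<bar>\<tau>h\<bar> * \<delta> * s"
        using h\<delta> s0 \<delta>0 by (intro mult_mono mult_left_mono) auto
      finally have 3: "norm (\<alpha> *\<^sub>R (g_hy h y *v w - g_hy (hs y) y *v w)) \<le> \<alpha> * (\<bar>\<tau>h\<bar> * \<delta> * s)"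
        using \<alpha> by simp
      have "norm Y \<le> \<delta> / \<kappa>\<^sup>2 * (l * s) + \<alpha> * (\<bar>\<rho>h\<bar> * \<delta> * (l * s)) + \<alpha> * (\<bar>\<tau>h\<bar> * \<delta> * s)"
        unfolding Y_def
        by (intro order_trans[OF norm_triangle_ineq4 add_mono[OF order_trans[OF norm_triangle_ineq4 add_mono[OF 1 2]] 3]] order_refl)
      also have "\<dots> = (K * l / \<kappa>\<^sup>2 + \<alpha> * \<bar>\<rho>h\<bar> * K * l + \<alpha> * \<bar>\<tau>h\<bar> * K) * rate \<alpha> ^ t * s"
        by (simp add: \<delta>_def algebra_simps)
      finally show ?thesis .
    qed
    \<comment> \<open>the error caused by evaluating \<open>B\<close> at the new iterate instead of the solution\<close>
    define Z where "Z = B_mat blk h' *v X - Bs y X"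
    have Zb: "wnorm (hs y) Z \<le> 3 * real CARD('d) * K * cX / sqrt \<kappa> * rate \<alpha> ^ t * s"
    proof -
      have "norm Z \<le> 3 * real CARD('d) * norm (h' - hs y) * norm X"
        unfolding Z_def by (rule B_mat_lipschitz[OF h'S sS])
      also have "\<dots> \<le> 3 * real CARD('d) * \<delta> * (cX * s)"
        using h'\<delta> Xb \<delta>0 by (intro mult_mono mult_left_mono) auto
      finally have "norm Z / sqrt \<kappa> \<le> 3 * real CARD('d) * \<delta> * (cX * s) / sqrt \<kappa>"
        using kappa_pos by (intro divide_right_mono) auto
      then show ?thesis
        using wnorm_le_norm[OF kappa_pos hs_ge_kappa[OF y], of Z] by (simp add: \<delta>_def mult_ac)
    qed
    have fix_eq: "x = (1 - \<alpha> * \<eta>) *\<^sub>R x - \<alpha> *\<^sub>R (Bs y (g_hh (hs y) y *v x) + Bs y (g_hy (hs y) y *v w))"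
    proof -
      have "Bs y (g_hh (hs y) y *v x) + Bs y (g_hy (hs y) y *v w) = - (\<eta> *\<^sub>R x)"
        using sens_eq[OF y, of w] unfolding x_def by (simp add: eq_neg_iff_add_eq_0 add_ac)
      then show ?thesis by (simp add: algebra_simps)
    qed
    have "iR \<alpha> y h0 (Suc t) *v w - x = Bs y X + Z - x"
      unfolding inner_R_Suc_mult Z_def X_def h_def h'_def r_def by simp
    also have "X = Y + ((1 - \<alpha> * \<eta>) *\<^sub>R (\<chi> j. r $ j / hs y $ j) - \<alpha> *\<^sub>R (g_hh (hs y) y *v r) - \<alpha> *\<^sub>R (g_hy (hs y) y *v w))"
      by (simp add: X_def Y_def algebra_simps)
    also have "Bs y \<dots> = Bs y Y + ((1 - \<alpha> * \<eta>) *\<^sub>R r - \<alpha> *\<^sub>R Bs y (g_hh (hs y) y *v r) - \<alpha> *\<^sub>R Bs y (g_hy (hs y) y *v w))"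
      unfolding matrix_vector_right_distrib matrix_vector_mult_diff_distrib matrix_vector_mult_scaleR
      using B_mat_div_tangent[OF sS hs_pos[OF y] inner_R_tangent[OF h0 y \<alpha>(1,2)], of t w]
      by (simp add: r_def)
    also have "\<dots> + Z - x = ((1 - \<alpha> * \<eta>) *\<^sub>R e - \<alpha> *\<^sub>R Bs y (g_hh (hs y) y *v e)) + (Bs y Y + Z)"
      by (subst fix_eq) (simp add: e_def matrix_vector_mult_diff_distrib scaleR_diff_right algebra_simps)
    finally have err_eq: "iR \<alpha> y h0 (Suc t) *v w - x
        = ((1 - \<alpha> * \<eta>) *\<^sub>R e - \<alpha> *\<^sub>R Bs y (g_hh (hs y) y *v e)) + (Bs y Y + Z)" .
    have "wnorm (hs y) (iR \<alpha> y h0 (Suc t) *v w - x)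
        \<le> wnorm (hs y) ((1 - \<alpha> * \<eta>) *\<^sub>R e - \<alpha> *\<^sub>R Bs y (g_hh (hs y) y *v e))
          + (wnorm (hs y) (Bs y Y) + wnorm (hs y) Z)"
      unfolding err_eq by (intro order_trans[OF wnorm_triangle] add_left_mono wnorm_triangle)
    also have "\<dots> \<le> rate \<alpha> * wnorm (hs y) e + c * rate \<alpha> ^ t * s"
    proof (rule add_mono)
      show "wnorm (hs y) ((1 - \<alpha> * \<eta>) *\<^sub>R e - \<alpha> *\<^sub>R Bs y (g_hh (hs y) y *v e)) \<le> rate \<alpha> * wnorm (hs y) e"
        unfolding rate_def
        using wnorm_contraction[OF sS hs_pos[OF y] et g_hh_psd[OF sS hs_pos[OF y] y et] norm_g_hh_le[OF sS y]] \<alpha> constants_nonneg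
        by simp
      have "wnorm (hs y) (Bs y Y) \<le> norm Y" by (rule wnorm_B_mat_le[OF sS hs_pos[OF y]])
      then have "wnorm (hs y) (Bs y Y) + wnorm (hs y) Z
        \<le> (K * l / \<kappa>\<^sup>2 + \<alpha> * \<bar>\<rho>h\<bar> * K * l + \<alpha> * \<bar>\<tau>h\<bar> * K) * rate \<alpha> ^ t * s
          + 3 * real CARD('d) * K * cX / sqrt \<kappa> * rate \<alpha> ^ t * s"
        using Yb Zb by linarith
      also have "\<dots> = c * rate \<alpha> ^ t * s" by (simp add: c_def distrib_right)
      finally show "wnorm (hs y) (Bs y Y) + wnorm (hs y) Z \<le> c * rate \<alpha> ^ t * s" .
    qed
    finally show ?thesis by (simp add: e_def r_def x_def s_def)
  qed
  then show ?thesis using c0 by blast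
qed

lemma inner_R_converges:
  assumes ok: "step_ok \<alpha>" and q: "rate \<alpha> < q" "q < 1"
  shows "\<exists>A\<ge>0. \<forall>y\<in>C. \<forall>h0\<in>log_box. \<forall>t w. norm (iR \<alpha> y h0 t *v w - sens y *v w) \<le> A * q ^ t * norm w"
proof -
  obtain c where c: "c \<ge> 0" and step: "\<And>y h0 t w. y \<in> C \<Longrightarrow> h0 \<in> log_box \<Longrightarrow>
    wnorm (hs y) (iR \<alpha> y h0 (Suc t) *v w - sens y *v w)
      \<le> rate \<alpha> * wnorm (hs y) (iR \<alpha> y h0 t *v w - sens y *v w)
        + c * rate \<alpha> ^ t * (wnorm (hs y) (iR \<alpha> y h0 t *v w - sens y *v w) + norm w)"
    using inner_R_error_step[OF ok] by blast
  define c' where "c' = c + lip_h / sqrt \<kappa>"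
  have c': "c \<le> c'" "lip_h / sqrt \<kappa> \<le> c'" "0 \<le> c'"
    using c lip_h_nonneg kappa_pos by (auto simp: c'_def)
  note rb = rate_bounds[OF ok]
  obtain A where A: "A \<ge> 0" "\<forall>a :: nat \<Rightarrow> real. a 0 \<le> c' \<longrightarrow>
      (\<forall>t. a (Suc t) \<le> rate \<alpha> * a t + c' * rate \<alpha> ^ t * (a t + 1)) \<longrightarrow> (\<forall>t. a t \<le> A * q ^ t)"
    using perturbed_geometric_recursion[OF rb(1) q c'(3)] by blast
  have "norm (iR \<alpha> y h0 t *v w - sens y *v w) \<le> A * q ^ t * norm w"
    if y: "y \<in> C" and h0: "h0 \<in> log_box" for y h0 t w
  proof (cases "w = 0")
    case False
    then have w: "norm w > 0" by simp
    define a where "a t = wnorm (hs y) (iR \<alpha> y h0 t *v w - sens y *v w) / norm w" for t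
    have a_eq: "wnorm (hs y) (iR \<alpha> y h0 t *v w - sens y *v w) = a t * norm w" for t
      using w by (simp add: a_def)
    have "a t \<le> A * q ^ t"
    proof (rule A(2)[rule_format])
      have "wnorm (hs y) (iR \<alpha> y h0 0 *v w - sens y *v w) \<le> norm (sens y *v w) / sqrt \<kappa>"
        using wnorm_le_norm[OF kappa_pos hs_ge_kappa[OF y], of "- (sens y *v w)"] by simp
      also have "\<dots> \<le> lip_h * norm w / sqrt \<kappa>"
        using norm_sens_le[OF y] kappa_pos by (intro divide_right_mono) auto
      finally have "a 0 * norm w \<le> (lip_h / sqrt \<kappa>) * norm w"
        unfolding a_eq by simp
      then have "a 0 \<le> lip_h / sqrt \<kappa>" using w by (rule mult_right_le_imp_le)
      then show "a 0 \<le> c'" using c'(2) by linarith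
      fix t
      have "a (Suc t) * norm w \<le> rate \<alpha> * (a t * norm w) + c * rate \<alpha> ^ t * (a t * norm w + norm w)"
        using step[OF y h0, of t w] unfolding a_eq .
      also have "\<dots> = (rate \<alpha> * a t + c * rate \<alpha> ^ t * (a t + 1)) * norm w"
        by (simp add: algebra_simps)
      finally have "a (Suc t) \<le> rate \<alpha> * a t + c * rate \<alpha> ^ t * (a t + 1)" using w by simp
      also have "\<dots> \<le> rate \<alpha> * a t + c' * rate \<alpha> ^ t * (a t + 1)"
        using c' rb wnorm_nonneg[of "hs y"]
        by (intro add_left_mono mult_right_mono) (auto simp: a_def intro!: add_nonneg_nonneg)
      finally show "a (Suc t) \<le> rate \<alpha> * a t + c' * rate \<alpha> ^ t * (a t + 1)" .
    qed
    then have "a t * norm w \<le> A * q ^ t * norm w" using w by (intro mult_right_mono) auto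
    then show ?thesis
      using norm_le_wnorm[OF hs_pos[OF y] hs_le_1[OF y]] a_eq order_trans by metis
  qed simp
  then show ?thesis using A(1) by (intro exI[of _ A] conjI ballI allI)
qed

section \<open>The hypergradient\<close>

text \<open>The hypergradient formed with the matrix \<open>sens\<close>.\<close>

definition hypergrad :: "real^'u \<Rightarrow> real^'u" where
  "hypergrad y = f_y (hs y) y + transpose (sens y) *v f_h (hs y) y"

lemma norm_grad_f_le:
  assumes "h \<in> simplices blk" "y \<in> C"
  shows "norm (f_h h y) \<le> \<Omega>\<^sub>f" "norm (f_y h y) \<le> \<Omega>\<^sub>f"
  using f_bound[OF assms] norm_fst_le[where x = "f_h h y" and y = "f_y h y"]
    norm_snd_le[where x = "f_h h y" and y = "f_y h y"]
  by linarith+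

lemma f_h_f_y_lipschitz:
  assumes "h \<in> simplices blk" "y \<in> C" "h' \<in> simplices blk" "y' \<in> C"
  shows "norm (f_h h y - f_h h' y') \<le> L\<^sub>f * (norm (h - h') + norm (y - y'))"
    "norm (f_y h y - f_y h' y') \<le> L\<^sub>f * (norm (h - h') + norm (y - y'))"
proof -
  have "dist (f_h h y, f_y h y) (f_h h' y', f_y h' y') \<le> L\<^sub>f * dist (h, y) (h', y')"
    using lipschitz_onD[OF f_lipschitz, of "(h, y)" "(h', y')"] assms by simp
  also have "\<dots> \<le> L\<^sub>f * (norm (h - h') + norm (y - y'))"
    using constants_nonneg norm_Pair_le[of "h - h'" "y - y'"]
    by (intro mult_left_mono) (auto simp: dist_norm)
  finally have *: "norm (f_h h y - f_h h' y', f_y h y - f_y h' y') \<le> L\<^sub>f * (norm (h - h') + norm (y - y'))"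
    by (simp add: dist_norm)
  show "norm (f_h h y - f_h h' y') \<le> L\<^sub>f * (norm (h - h') + norm (y - y'))"
    "norm (f_y h y - f_y h' y') \<le> L\<^sub>f * (norm (h - h') + norm (y - y'))"
    using * norm_fst_le[where x = "f_h h y - f_h h' y'" and y = "f_y h y - f_y h' y'"]
      norm_snd_le[where x = "f_h h y - f_h h' y'" and y = "f_y h y - f_y h' y'"] by linarith+
qed

lemma hypergrad_perturbation:
  assumes z: "h \<in> simplices blk" "y \<in> C" "h' \<in> simplices blk" "y' \<in> C"
    and R: "\<And>w. norm (R *v w) \<le> l * norm w" "\<And>w. norm (R *v w - R' *v w) \<le> \<epsilon> * norm w"
    and pos: "l \<ge> 0" "\<epsilon> \<ge> 0"
  shows "norm ((f_y h y + transpose R *v f_h h y) - (f_y h' y' + transpose R' *v f_h h' y'))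
    \<le> L\<^sub>f * (norm (h - h') + norm (y - y')) * (1 + l) + \<Omega>\<^sub>f * \<epsilon>"
proof (rule norm_le_inner_bound)
  let ?d = "L\<^sub>f * (norm (h - h') + norm (y - y'))"
  fix w
  have "((f_y h y + transpose R *v f_h h y) - (f_y h' y' + transpose R' *v f_h h' y')) \<bullet> w
     = (f_y h y - f_y h' y') \<bullet> w + (f_h h y - f_h h' y') \<bullet> (R *v w) + f_h h' y' \<bullet> (R *v w - R' *v w)"
    unfolding inner_diff_left inner_add_left inner_diff_right inner_transpose_mult by simp
  also have "\<dots> \<le> norm (f_y h y - f_y h' y') * norm w + norm (f_h h y - f_h h' y') * norm (R *v w)
      + norm (f_h h' y') * norm (R *v w - R' *v w)"
    by (intro add_mono norm_cauchy_schwarz)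
  also have "\<dots> \<le> ?d * norm w + ?d * (l * norm w) + \<Omega>\<^sub>f * (\<epsilon> * norm w)"
    using f_h_f_y_lipschitz[OF z] R norm_grad_f_le[OF z(3,4)] constants_nonneg
    by (intro add_mono mult_mono) auto
  also have "\<dots> = (?d * (1 + l) + \<Omega>\<^sub>f * \<epsilon>) * norm w" by (simp add: algebra_simps)
  finally show "((f_y h y + transpose R *v f_h h y) - (f_y h' y' + transpose R' *v f_h h' y')) \<bullet> w
    \<le> (?d * (1 + l) + \<Omega>\<^sub>f * \<epsilon>) * norm w" .
qed (use pos constants_nonneg in auto)

lemma hypergrad_lipschitz:
  "\<exists>c\<ge>0. \<forall>y\<in>C. \<forall>y'\<in>C. norm (hypergrad y' - hypergrad y) \<le> c * norm (y' - y)"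
proof -
  obtain c where c: "c \<ge> 0" "\<And>y y' w. y \<in> C \<Longrightarrow> y' \<in> C \<Longrightarrow>
      norm (sens y' *v w - sens y *v w) \<le> c * norm (y' - y) * norm w"
    using sens_lipschitz by blast
  define c' where "c' = L\<^sub>f * (lip_h + 1) * (1 + lip_h) + \<Omega>\<^sub>f * c"
  have "norm (hypergrad y' - hypergrad y) \<le> c' * norm (y' - y)" if y: "y \<in> C" "y' \<in> C" for y y'
  proof -
    have "norm (hypergrad y' - hypergrad y)
        \<le> L\<^sub>f * (norm (hs y' - hs y) + norm (y' - y)) * (1 + lip_h) + \<Omega>\<^sub>f * (c * norm (y' - y))"
      unfolding hypergrad_def
      using y c norm_sens_le[OF y(2)] lip_h_nonneg hs_simplices by (intro hypergrad_perturbation) auto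
    also have "\<dots> \<le> L\<^sub>f * (lip_h * norm (y' - y) + norm (y' - y)) * (1 + lip_h) + \<Omega>\<^sub>f * (c * norm (y' - y))"
      using hs_lipschitz[OF y] constants_nonneg lip_h_nonneg
      by (intro add_mono mult_right_mono mult_left_mono order_refl) auto
    also have "\<dots> = c' * norm (y' - y)" by (simp add: c'_def algebra_simps)
    finally show ?thesis .
  qed
  moreover have "c' \<ge> 0" unfolding c'_def using constants_nonneg lip_h_nonneg c by simp
  ultimately show ?thesis by blast
qed

lemma approx_grad_error:
  assumes ok: "step_ok \<alpha>" and q: "rate \<alpha> < q" "q < 1"
  shows "\<exists>A\<ge>0. \<forall>y\<in>C. \<forall>h0\<in>log_box. \<forall>D.
    norm (approx_grad_F blk \<eta> f_h f_y g_h g_hh g_hy \<alpha> D y h0 - hypergrad y) \<le> A * q ^ D"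
proof -
  obtain A where A: "A \<ge> 0" "\<And>y h0 t w. y \<in> C \<Longrightarrow> h0 \<in> log_box \<Longrightarrow>
      norm (iR \<alpha> y h0 t *v w - sens y *v w) \<le> A * q ^ t * norm w"
    using inner_R_converges[OF assms] by blast
  have q0: "q > 0" using rate_bounds[OF ok] q by linarith
  define A' where "A' = L\<^sub>f * \<bar>sqrt (2 * kl_bound)\<bar> * (1 + lip_h) + \<Omega>\<^sub>f * A"
  have "norm (approx_grad_F blk \<eta> f_h f_y g_h g_hh g_hy \<alpha> D y h0 - hypergrad y) \<le> A' * q ^ D"
    if y: "y \<in> C" and h0: "h0 \<in> log_box" for y h0 D
  proof -
    have box: "ih \<alpha> y h0 D \<in> log_box"
      using ok by (intro inner_h_log_box[OF h0 y]) (auto simp: step_ok_def)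
    have "norm (hypergrad y - approx_grad_F blk \<eta> f_h f_y g_h g_hh g_hy \<alpha> D y h0)
        \<le> L\<^sub>f * (norm (hs y - ih \<alpha> y h0 D) + norm (y - y)) * (1 + lip_h) + \<Omega>\<^sub>f * (A * q ^ D)"
      unfolding hypergrad_def approx_grad_F_def Let_def
      using y A(1) A(2)[OF y h0] norm_sens_le[OF y] lip_h_nonneg hs_simplices log_boxD(1)[OF box] q0
      by (intro hypergrad_perturbation) (auto simp: norm_minus_commute)
    also have "norm (hs y - ih \<alpha> y h0 D) + norm (y - y) \<le> \<bar>sqrt (2 * kl_bound)\<bar> * q ^ D"
    proof -
      have "norm (hs y - ih \<alpha> y h0 D) \<le> sqrt (2 * kl_bound) * rate \<alpha> ^ D"
        using inner_h_error[OF ok y h0] by (simp add: norm_minus_commute)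
      also have "\<dots> \<le> \<bar>sqrt (2 * kl_bound)\<bar> * q ^ D"
        using rate_bounds[OF ok] q by (intro mult_mono power_mono) auto
      finally show ?thesis by simp
    qed
    also have "L\<^sub>f * (\<bar>sqrt (2 * kl_bound)\<bar> * q ^ D) * (1 + lip_h) + \<Omega>\<^sub>f * (A * q ^ D) = A' * q ^ D"
      by (simp add: A'_def algebra_simps)
    finally show ?thesis
      using constants_nonneg lip_h_nonneg by (simp add: norm_minus_commute mult_left_mono mult_right_mono)
  qed
  moreover have "A' \<ge> 0" unfolding A'_def using constants_nonneg lip_h_nonneg A by simp
  ultimately show ?thesis by blast
qed

text \<open>The second-order remainder of the solution map gives the descent inequality directly, without
  integrating the hypergradient.\<close>

lemma F_upper_smooth:
  "\<exists>c\<ge>0. \<forall>y\<in>C. \<forall>y'\<in>C. F_upper blk \<eta> f g y' \<le> F_upper blk \<eta> f g y + hypergrad y \<bullet> (y' - y) + c * (norm (y' - y))\<^sup>2"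
proof -
  obtain c where c: "c \<ge> 0" "\<And>y y'. y \<in> C \<Longrightarrow> y' \<in> C \<Longrightarrow>
      norm (hs y' - hs y - sens y *v (y' - y)) \<le> c * (norm (y' - y))\<^sup>2"
    using hs_linearization by blast
  define c' where "c' = L\<^sub>f * (lip_h + 1)\<^sup>2 + \<Omega>\<^sub>f * c"
  have "F_upper blk \<eta> f g y' \<le> F_upper blk \<eta> f g y + hypergrad y \<bullet> (y' - y) + c' * (norm (y' - y))\<^sup>2"
    if y: "y \<in> C" "y' \<in> C" for y y'
  proof -
    let ?S = "simplices blk \<times> C" and ?z = "(hs y, y)" and ?z' = "(hs y', y')"
    let ?D = "\<lambda>z p. f_h (fst z) (snd z) \<bullet> fst p + f_y (fst z) (snd z) \<bullet> snd p"
    have zS: "?z \<in> ?S" "?z' \<in> ?S" using y hs_simplices by auto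
    have "norm ((\<lambda>(h, y). f h y) ?z' - (\<lambda>(h, y). f h y) ?z - ?D ?z (?z' - ?z)) \<le> L\<^sub>f * (norm (?z' - ?z))\<^sup>2"
    proof (rule lipschitz_derivative_remainder[where S = ?S, OF _ zS])
      show "convex ?S" by (intro convex_Times convex_simplices C)
      show "((\<lambda>(h, y). f h y) has_derivative ?D z) (at z within ?S)" if "z \<in> ?S" for z
        using f_deriv[of "fst z" "snd z"] that by (auto simp: case_prod_unfold)
      show "norm (?D z v - ?D ?z v) \<le> L\<^sub>f * norm (z - ?z) * norm v" if z: "z \<in> ?S" for z v
      proof -
        have "norm (?D z v - ?D ?z v)
          = \<bar>((f_h (fst z) (snd z), f_y (fst z) (snd z)) - (f_h (hs y) y, f_y (hs y) y)) \<bullet> v\<bar>"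
          by (cases v) (simp add: inner_diff_left algebra_simps)
        also have "\<dots> \<le> norm ((f_h (fst z) (snd z), f_y (fst z) (snd z)) - (f_h (hs y) y, f_y (hs y) y)) * norm v"
          by (rule Cauchy_Schwarz_ineq2)
        also have "\<dots> \<le> (L\<^sub>f * norm (z - ?z)) * norm v"
          using lipschitz_onD[OF f_lipschitz z zS(1)]
          by (intro mult_right_mono) (auto simp: dist_norm case_prod_beta)
        finally show ?thesis .
      qed
    qed (rule constants_nonneg)
    then have "f (hs y') y' - f (hs y) y - (f_h (hs y) y \<bullet> (hs y' - hs y) + f_y (hs y) y \<bullet> (y' - y))
        \<le> L\<^sub>f * (norm (?z' - ?z))\<^sup>2" by (simp add: abs_le_iff)
    moreover have "L\<^sub>f * (norm (?z' - ?z))\<^sup>2 \<le> L\<^sub>f * ((lip_h + 1) * norm (y' - y))\<^sup>2"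
    proof (intro mult_left_mono power_mono)
      have "norm (?z' - ?z) \<le> norm (hs y' - hs y) + norm (y' - y)"
        by (simp add: norm_Pair_le)
      then show "norm (?z' - ?z) \<le> (lip_h + 1) * norm (y' - y)"
        using hs_lipschitz[OF y] by (simp add: distrib_right)
    qed (use constants_nonneg in auto)
    moreover have "f_h (hs y) y \<bullet> (hs y' - hs y) \<le> f_h (hs y) y \<bullet> (sens y *v (y' - y)) + \<Omega>\<^sub>f * (c * (norm (y' - y))\<^sup>2)"
    proof -
      have "f_h (hs y) y \<bullet> (hs y' - hs y - sens y *v (y' - y)) \<le> norm (f_h (hs y) y) * norm (hs y' - hs y - sens y *v (y' - y))"
        by (rule norm_cauchy_schwarz)
      also have "\<dots> \<le> \<Omega>\<^sub>f * (c * (norm (y' - y))\<^sup>2)"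
        using norm_grad_f_le[OF hs_simplices[OF y(1)] y(1)] c(2)[OF y] constants_nonneg by (intro mult_mono) auto
      finally show ?thesis by (simp add: inner_diff_right)
    qed
    moreover have "hypergrad y \<bullet> (y' - y) = f_y (hs y) y \<bullet> (y' - y) + f_h (hs y) y \<bullet> (sens y *v (y' - y))"
      unfolding hypergrad_def inner_add_left inner_transpose_mult by simp
    moreover have "c' * (norm (y' - y))\<^sup>2
        = L\<^sub>f * ((lip_h + 1) * norm (y' - y))\<^sup>2 + \<Omega>\<^sub>f * (c * (norm (y' - y))\<^sup>2)"
      unfolding c'_def power_mult_distrib by (simp add: algebra_simps)
    ultimately show ?thesis unfolding F_upper_def by linarith
  qed
  moreover have "c' \<ge> 0" unfolding c'_def using constants_nonneg c by simp
  ultimately show ?thesis by blast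
qed

text \<open>Replacing the sensitivity matrix by another derivative of the solution map within \<open>C\<close> moves
  the hypergradient inside the lineality space of the normal cone.\<close>

lemma infdist_grad_F_le:
  assumes y: "y \<in> C" and p: "p \<in> normal_cone C y"
  shows "infdist (- grad_F blk C \<eta> f_h f_y g y) (normal_cone C y) \<le> norm (- hypergrad y - p)"
proof -
  let ?G = "grad_F blk C \<eta> f_h f_y g y"
  have "(hypergrad y - ?G) \<bullet> (y' - y) = 0" if "y' \<in> C" for y'
    unfolding hypergrad_def grad_F_def inner_diff_left inner_add_left inner_transpose_mult
      R_star_eq_sens_along[OF y that] by simp
  then have "p + (hypergrad y - ?G) \<in> normal_cone C y"
    using p by (simp add: normal_cone_def inner_add_left)
  then have "infdist (- ?G) (normal_cone C y) \<le> dist (- ?G) (p + (hypergrad y - ?G))"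
    by (rule infdist_le)
  also have "\<dots> = norm (- hypergrad y - p)"
    unfolding dist_norm by (rule arg_cong[where f = norm]) simp
  finally show ?thesis .
qed

section \<open>Inexact projected gradient descent\<close>

text \<open>A descent argument for projected gradient steps with gradient errors at most \<open>\<epsilon>\<close>, on a
  function that is smooth along \<open>C\<close>.\<close>

lemma average_stationarity_bound:
  assumes L: "L \<ge> 0"
    and smooth: "\<And>y y'. y \<in> C \<Longrightarrow> y' \<in> C \<Longrightarrow>
      F_upper blk \<eta> f g y' \<le> F_upper blk \<eta> f g y + hypergrad y \<bullet> (y' - y) + L * (norm (y' - y))\<^sup>2"
    and lip: "\<And>y y'. y \<in> C \<Longrightarrow> y' \<in> C \<Longrightarrow> norm (hypergrad y' - hypergrad y) \<le> M * norm (y' - y)"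
    and \<beta>: "\<beta> > 0" "\<beta> * (2 * L + 1) \<le> 1"
    and Y: "\<And>k. Y k \<in> C" "\<And>k. Y (Suc k) = closest_point C (Y k - \<beta> *\<^sub>R G k)"
    and err: "\<And>k. norm (G k - hypergrad (Y k)) \<le> \<epsilon>"
    and K: "K \<ge> 1"
    and m: "\<And>y. y \<in> C \<Longrightarrow> m \<le> F_upper blk \<eta> f g y"
  shows "1 / real K * (\<Sum>k=1..K. (infdist (- grad_F blk C \<eta> f_h f_y g (Y k)) (normal_cone C (Y k)))\<^sup>2)
    \<le> 3 * (1 / \<beta>\<^sup>2 + M\<^sup>2) * (2 * \<beta> * (F_upper blk \<eta> f g (Y 0) - m)) * (1 / real K)
      + (3 * (1 / \<beta>\<^sup>2 + M\<^sup>2) * \<beta> + 3) * \<epsilon>\<^sup>2"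
proof -
  let ?F = "F_upper blk \<eta> f g"
  define s where "s k = norm (Y (Suc k) - Y k)" for k
  have \<epsilon>0: "\<epsilon> \<ge> 0" using err[of 0] norm_ge_zero order_trans by blast
  have proj: "(Y k - \<beta> *\<^sub>R G k - Y (Suc k)) \<bullet> (y' - Y (Suc k)) \<le> 0" if "y' \<in> C" for k y'
    unfolding Y(2) by (rule closest_point_dot[OF C(3,2) that])
  have descent: "(s k)\<^sup>2 \<le> 2 * \<beta> * (?F (Y k) - ?F (Y (Suc k))) + \<beta> * \<epsilon>\<^sup>2" for k
  proof -
    let ?d = "Y (Suc k) - Y k"
    have "(Y k - \<beta> *\<^sub>R G k - Y (Suc k)) \<bullet> (Y k - Y (Suc k)) = ?d \<bullet> ?d + \<beta> * (G k \<bullet> ?d)"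
      by (simp add: inner_diff_left inner_diff_right inner_commute algebra_simps)
    then have 1: "(s k)\<^sup>2 + \<beta> * (G k \<bullet> ?d) \<le> 0"
      using proj[OF Y(1), of k k] by (simp add: s_def dot_square_norm)
    have "(hypergrad (Y k) - G k) \<bullet> ?d \<le> norm (hypergrad (Y k) - G k) * s k"
      unfolding s_def by (rule norm_cauchy_schwarz)
    also have "\<dots> \<le> \<epsilon> * s k"
      using err[of k] by (intro mult_right_mono) (auto simp: norm_minus_commute s_def)
    also have "\<dots> \<le> \<epsilon>\<^sup>2 / 2 + (s k)\<^sup>2 / 2"
      using sum_squares_bound[of \<epsilon> "s k"] by simp
    finally have "hypergrad (Y k) \<bullet> ?d \<le> G k \<bullet> ?d + \<epsilon>\<^sup>2 / 2 + (s k)\<^sup>2 / 2"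
      by (simp add: inner_diff_left)
    then have "?F (Y (Suc k)) - ?F (Y k) \<le> G k \<bullet> ?d + \<epsilon>\<^sup>2 / 2 + (s k)\<^sup>2 / 2 + L * (s k)\<^sup>2"
      using smooth[OF Y(1)[of k] Y(1)[of "Suc k"]] by (simp add: s_def)
    then have "\<beta> * (?F (Y (Suc k)) - ?F (Y k)) \<le> \<beta> * (G k \<bullet> ?d + \<epsilon>\<^sup>2 / 2 + (s k)\<^sup>2 / 2 + L * (s k)\<^sup>2)"
      using \<beta> by (intro mult_left_mono) auto
    moreover have "(\<beta> * (2 * L + 1)) * (s k)\<^sup>2 \<le> 1 * (s k)\<^sup>2"
      using \<beta> by (intro mult_right_mono) auto
    ultimately show ?thesis using 1 by (simp add: algebra_simps)
  qed
  have dist: "(infdist (- grad_F blk C \<eta> f_h f_y g (Y (Suc k))) (normal_cone C (Y (Suc k))))\<^sup>2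
      \<le> 3 * (1 / \<beta>\<^sup>2 + M\<^sup>2) * (s k)\<^sup>2 + 3 * \<epsilon>\<^sup>2" for k
  proof -
    let ?d = "Y (Suc k) - Y k"
    \<comment> \<open>the residual of the projection is a normal vector at the projected point\<close>
    define p where "p = (1 / \<beta>) *\<^sub>R (Y k - \<beta> *\<^sub>R G k - Y (Suc k))"
    have "p \<in> normal_cone C (Y (Suc k))"
      using proj[of _ k] \<beta> by (auto simp: normal_cone_def p_def mult_le_0_iff divide_le_0_iff)
    from infdist_grad_F_le[OF Y(1) this]
    have "infdist (- grad_F blk C \<eta> f_h f_y g (Y (Suc k))) (normal_cone C (Y (Suc k)))
        \<le> norm (- hypergrad (Y (Suc k)) - p)" .
    also have "- hypergrad (Y (Suc k)) - p
        = ((1 / \<beta>) *\<^sub>R ?d + (G k - hypergrad (Y k))) - (hypergrad (Y (Suc k)) - hypergrad (Y k))"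
      using \<beta> by (simp add: p_def algebra_simps)
    also have "norm \<dots> \<le> (1 / \<beta>) * s k + \<epsilon> + M * s k"
    proof -
      have "norm ((1 / \<beta>) *\<^sub>R ?d) = (1 / \<beta>) * s k" using \<beta> by (simp add: s_def)
      then show ?thesis
        using lip[OF Y(1)[of k] Y(1)[of "Suc k"]] err[of k]
          norm_triangle_ineq4[of "(1 / \<beta>) *\<^sub>R ?d + (G k - hypergrad (Y k))" "hypergrad (Y (Suc k)) - hypergrad (Y k)"]
          norm_triangle_ineq[of "(1 / \<beta>) *\<^sub>R ?d" "G k - hypergrad (Y k)"]
        unfolding s_def by linarith
    qed
    finally have "(infdist (- grad_F blk C \<eta> f_h f_y g (Y (Suc k))) (normal_cone C (Y (Suc k))))\<^sup>2
        \<le> ((1 / \<beta>) * s k + \<epsilon> + M * s k)\<^sup>2"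
      by (intro power_mono infdist_nonneg)
    also have "\<dots> \<le> 3 * (((1 / \<beta>) * s k)\<^sup>2 + \<epsilon>\<^sup>2 + (M * s k)\<^sup>2)"
      by (rule square_sum3_le)
    also have "\<dots> = 3 * (1 / \<beta>\<^sup>2 + M\<^sup>2) * (s k)\<^sup>2 + 3 * \<epsilon>\<^sup>2"
      by (simp add: power_mult_distrib power_divide algebra_simps)
    finally show ?thesis .
  qed
  define c where "c = 3 * (1 / \<beta>\<^sup>2 + M\<^sup>2)"
  have c: "c \<ge> 0" by (simp add: c_def)
  have "(\<Sum>k=1..K. (infdist (- grad_F blk C \<eta> f_h f_y g (Y k)) (normal_cone C (Y k)))\<^sup>2)
      = (\<Sum>k<K. (infdist (- grad_F blk C \<eta> f_h f_y g (Y (Suc k))) (normal_cone C (Y (Suc k))))\<^sup>2)"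
    by (simp add: sum.atLeast1_atMost_eq)
  also have "\<dots> \<le> (\<Sum>k<K. c * (2 * \<beta> * (?F (Y k) - ?F (Y (Suc k))) + \<beta> * \<epsilon>\<^sup>2) + 3 * \<epsilon>\<^sup>2)"
  proof (rule sum_mono)
    fix k
    have "c * (s k)\<^sup>2 \<le> c * (2 * \<beta> * (?F (Y k) - ?F (Y (Suc k))) + \<beta> * \<epsilon>\<^sup>2)"
      using c descent by (intro mult_left_mono)
    then show "(infdist (- grad_F blk C \<eta> f_h f_y g (Y (Suc k))) (normal_cone C (Y (Suc k))))\<^sup>2
        \<le> c * (2 * \<beta> * (?F (Y k) - ?F (Y (Suc k))) + \<beta> * \<epsilon>\<^sup>2) + 3 * \<epsilon>\<^sup>2"
      using dist[of k] by (simp add: c_def)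
  qed
  also have "\<dots> = c * (2 * \<beta> * (\<Sum>k<K. ?F (Y k) - ?F (Y (Suc k)))) + real K * ((c * \<beta> + 3) * \<epsilon>\<^sup>2)"
    by (simp add: sum.distrib distrib_left distrib_right flip: sum_distrib_left)
  also have "(\<Sum>k<K. ?F (Y k) - ?F (Y (Suc k))) = ?F (Y 0) - ?F (Y K)"
    by (rule sum_lessThan_telescope')
  also have "c * (2 * \<beta> * (?F (Y 0) - ?F (Y K))) \<le> c * (2 * \<beta> * (?F (Y 0) - m))"
    using c \<beta> m[OF Y(1)[of K]] by (intro mult_left_mono) auto
  finally have "(\<Sum>k=1..K. (infdist (- grad_F blk C \<eta> f_h f_y g (Y k)) (normal_cone C (Y k)))\<^sup>2)
      \<le> c * (2 * \<beta> * (?F (Y 0) - m)) + real K * ((c * \<beta> + 3) * \<epsilon>\<^sup>2)" by simp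
  then show ?thesis
    using K unfolding c_def[symmetric] by (simp add: field_simps)
qed

lemma bilevel_iter_invariant:
  assumes \<alpha>: "\<And>k. 0 < \<alpha> k" "\<And>k. \<alpha> k * \<eta> \<le> 1" and "y0 \<in> C" "h0 \<in> log_box"
  shows "fst (bilevel_iter blk C \<eta> f_h f_y g_h g_hh g_hy \<alpha> \<beta> D y0 h0 k) \<in> C"
    "snd (bilevel_iter blk C \<eta> f_h f_y g_h g_hh g_hy \<alpha> \<beta> D y0 h0 k) \<in> log_box"
proof (induction k)
  case (Suc k)
  {
    case 1
    show ?case using C by (simp add: case_prod_beta Let_def closest_point_in_set)
  next
    case 2
    show ?case using Suc inner_h_log_box \<alpha> by (simp add: case_prod_beta Let_def)
  }
qed (use assms in auto)

end

section \<open>Convergence of the bilevel algorithm\<close>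

theorem theorem2:
  fixes blk :: "'d::finite \<Rightarrow> 'n::finite"
    and C :: "(real^'u::finite) set"
    and f g :: "real^'d \<Rightarrow> real^'u \<Rightarrow> real"
    and f_h :: "real^'d \<Rightarrow> real^'u \<Rightarrow> real^'d"
    and f_y :: "real^'d \<Rightarrow> real^'u \<Rightarrow> real^'u"
    and g_h :: "real^'d \<Rightarrow> real^'u \<Rightarrow> real^'d"
    and g_hh :: "real^'d \<Rightarrow> real^'u \<Rightarrow> real^'d^'d"
    and g_hy :: "real^'d \<Rightarrow> real^'u \<Rightarrow> real^'u^'d"
    and \<eta> L\<^sub>f \<Omega>\<^sub>f L\<^sub>g \<Omega>\<^sub>g \<Lambda>\<^sub>g \<tau>h \<tau>y \<rho>h \<rho>y :: real
  assumes blocks: "surj blk"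
    and C: "C \<noteq> {}" "closed C" "convex C"
    and eta: "\<eta> > 0"
    and f_deriv: "\<And>h y. h \<in> simplices blk \<Longrightarrow> y \<in> C \<Longrightarrow>
          ((\<lambda>(h, y). f h y) has_derivative (\<lambda>(v, w). f_h h y \<bullet> v + f_y h y \<bullet> w))
            (at (h, y) within simplices blk \<times> C)"
    and f_lipschitz: "L\<^sub>f-lipschitz_on (simplices blk \<times> C) (\<lambda>(h, y). (f_h h y, f_y h y))"
    and f_bound: "\<And>h y. h \<in> simplices blk \<Longrightarrow> y \<in> C \<Longrightarrow> norm (f_h h y, f_y h y) \<le> \<Omega>\<^sub>f"
    and g_convex: "\<And>y. y \<in> C \<Longrightarrow> convex_on (simplices blk) (\<lambda>h. g h y)"
    and g_deriv: "\<And>h y. h \<in> simplices blk \<Longrightarrow> y \<in> C \<Longrightarrow>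
          ((\<lambda>h. g h y) has_derivative (\<lambda>v. g_h h y \<bullet> v)) (at h within simplices blk)"
    and g_h_deriv_h: "\<And>h y. h \<in> simplices blk \<Longrightarrow> y \<in> C \<Longrightarrow>
          ((\<lambda>h. g_h h y) has_derivative (\<lambda>v. g_hh h y *v v)) (at h within simplices blk)"
    and g_h_deriv_y: "\<And>h y. h \<in> simplices blk \<Longrightarrow> y \<in> C \<Longrightarrow>
          ((\<lambda>y. g_h h y) has_derivative (\<lambda>w. g_hy h y *v w)) (at y within C)"
    and g_h_lipschitz: "\<And>y. y \<in> C \<Longrightarrow> L\<^sub>g-lipschitz_on (simplices blk) (\<lambda>h. g_h h y)"
    and g_h_bound: "\<And>h y. h \<in> simplices blk \<Longrightarrow> y \<in> C \<Longrightarrow> norm (g_h h y) \<le> \<Omega>\<^sub>g"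
    and g_hy_lipschitz_h: "\<And>y. y \<in> C \<Longrightarrow> spectral_lipschitz_on \<tau>h (simplices blk) (\<lambda>h. g_hy h y)"
    and g_hh_lipschitz_h: "\<And>y. y \<in> C \<Longrightarrow> spectral_lipschitz_on \<rho>h (simplices blk) (\<lambda>h. g_hh h y)"
    and g_hh_bound: "\<And>h y. h \<in> simplices blk \<Longrightarrow> y \<in> C \<Longrightarrow> spectral_norm (g_hh h y) \<le> L\<^sub>g"
    and g_hy_bound: "\<And>h y. h \<in> simplices blk \<Longrightarrow> y \<in> C \<Longrightarrow> spectral_norm (g_hy h y) \<le> \<Lambda>\<^sub>g"
    and g_hy_lipschitz_y: "\<And>h. h \<in> simplices blk \<Longrightarrow> spectral_lipschitz_on \<tau>y C (\<lambda>y. g_hy h y)"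
    and g_hh_lipschitz_y: "\<And>h. h \<in> simplices blk \<Longrightarrow> spectral_lipschitz_on \<rho>y C (\<lambda>y. g_hh h y)"
    and F_bounded_below: "bdd_below (F_upper blk \<eta> f g ` C)"
  shows "\<exists>\<alpha>_max \<beta>_min \<beta>_max :: real. \<exists>lam :: real \<Rightarrow> real. \<exists>D0 :: real \<Rightarrow> nat.
           0 < \<alpha>_max \<and> 0 < \<beta>_min \<and> \<beta>_min < \<beta>_max \<and>
           (\<forall>\<alpha>. 0 < \<alpha> \<and> \<alpha> \<le> \<alpha>_max \<longrightarrow>
              0 < lam \<alpha> \<and> lam \<alpha> < 1 \<and>
              (\<forall>\<beta> y0 h0. \<beta>_min \<le> \<beta> \<and> \<beta> \<le> \<beta>_max \<and> y0 \<in> C \<and> h0 \<in> simplices_ge_nu blk \<Omega>\<^sub>g \<eta> \<longrightarrow>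
                 (\<exists>c1 c2 :: real. \<forall>K\<ge>1. \<forall>D\<ge>1. D \<ge> D0 \<alpha> \<longrightarrow>
                    1 / real K *
                      (\<Sum>k=1..K. (let y = y_iter blk C \<eta> f_h f_y g_h g_hh g_hy
                                            (\<lambda>_. \<alpha>) (\<lambda>_. \<beta>) D y0 h0 k
                                  in (infdist (- grad_F blk C \<eta> f_h f_y g y) (normal_cone C y))\<^sup>2))
                    \<le> c1 * (1 / real K) + c2 * lam \<alpha> ^ D)))"
proof -
  interpret bilevel blk C f g f_h f_y g_h g_hh g_hy \<eta> L\<^sub>f \<Omega>\<^sub>f L\<^sub>g \<Omega>\<^sub>g \<Lambda>\<^sub>g \<tau>h \<tau>y \<rho>h \<rho>y
    by (rule bilevel.intro) (fact assms)+
  let ?F = "F_upper blk \<eta> f g"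
  obtain L where L: "L \<ge> 0" "\<And>y y'. y \<in> C \<Longrightarrow> y' \<in> C \<Longrightarrow>
      ?F y' \<le> ?F y + hypergrad y \<bullet> (y' - y) + L * (norm (y' - y))\<^sup>2"
    using F_upper_smooth by blast
  obtain M where M: "M \<ge> 0" "\<And>y y'. y \<in> C \<Longrightarrow> y' \<in> C \<Longrightarrow> norm (hypergrad y' - hypergrad y) \<le> M * norm (y' - y)"
    using hypergrad_lipschitz by blast
  obtain m where m: "\<And>y. y \<in> C \<Longrightarrow> m \<le> ?F y"
    using F_bounded_below by (auto simp: bdd_below_def)
  define \<alpha>_max where "\<alpha>_max = min (1 / (2 * (2 * L\<^sub>g + \<eta>))) (\<eta> / (\<eta>\<^sup>2 + L\<^sub>g\<^sup>2))"
  define \<beta>_max where "\<beta>_max = 1 / (2 * L + 1)"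
  \<comment> \<open>any number strictly between the contraction factor and 1; the errors decay like its powers,
    hence the squared errors like the powers of its square\<close>
  define q where "q \<alpha> = (1 + rate \<alpha>) / 2" for \<alpha>
  have pos: "2 * L\<^sub>g + \<eta> > 0" "\<eta>\<^sup>2 + L\<^sub>g\<^sup>2 > 0"
    using eta constants_nonneg by (auto intro: add_nonneg_pos add_pos_nonneg)
  have ok: "step_ok \<alpha>" if "0 < \<alpha>" "\<alpha> \<le> \<alpha>_max" for \<alpha>
  proof -
    have "\<alpha> \<le> 1 / (2 * (2 * L\<^sub>g + \<eta>))" "\<alpha> \<le> \<eta> / (\<eta>\<^sup>2 + L\<^sub>g\<^sup>2)"
      using that by (auto simp: \<alpha>_max_def)
    then have 1: "\<alpha> * (2 * (2 * L\<^sub>g + \<eta>)) \<le> 1" and 2: "\<alpha> * (\<eta>\<^sup>2 + L\<^sub>g\<^sup>2) \<le> \<eta>"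
      using pos by (simp_all add: pos_le_divide_eq)
    have "0 \<le> \<alpha> * L\<^sub>g" "0 < \<alpha> * \<eta>" using that eta constants_nonneg by simp_all
    then show ?thesis
      using 1 2 that by (simp add: step_ok_def algebra_simps)
  qed
  have q: "rate \<alpha> < q \<alpha>" "q \<alpha> < 1" "0 < q \<alpha>" if "step_ok \<alpha>" for \<alpha>
    using rate_bounds[OF that] by (auto simp: q_def)
  \<comment> \<open>the error bound holds for every number of lower-level iterations, so the threshold for \<open>D\<close>
    can be 1\<close>
  have main: "\<exists>c1 c2 :: real. \<forall>K\<ge>1. \<forall>D\<ge>1. D \<ge> (1 :: nat) \<longrightarrow>
      1 / real K * (\<Sum>k=1..K. (let y = y_iter blk C \<eta> f_h f_y g_h g_hh g_hy (\<lambda>_. \<alpha>) (\<lambda>_. \<beta>) D y0 h0 k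
                     in (infdist (- grad_F blk C \<eta> f_h f_y g y) (normal_cone C y))\<^sup>2))
      \<le> c1 * (1 / real K) + c2 * ((q \<alpha>)\<^sup>2) ^ D"
    if \<alpha>: "0 < \<alpha>" "\<alpha> \<le> \<alpha>_max" and \<beta>: "\<beta>_max / 2 \<le> \<beta>" "\<beta> \<le> \<beta>_max"
      and y0: "y0 \<in> C" and h0: "h0 \<in> simplices_ge_nu blk \<Omega>\<^sub>g \<eta>" for \<alpha> \<beta> y0 h0
  proof -
    note ok = ok[OF \<alpha>]
    obtain A where A: "A \<ge> 0" "\<And>y h0 D. y \<in> C \<Longrightarrow> h0 \<in> log_box \<Longrightarrow>
        norm (approx_grad_F blk \<eta> f_h f_y g_h g_hh g_hy \<alpha> D y h0 - hypergrad y) \<le> A * q \<alpha> ^ D"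
      using approx_grad_error[OF ok q(1,2)[OF ok]] by blast
    have \<beta>_pos: "\<beta> > 0"
    proof -
      have "0 < \<beta>_max / 2" using L(1) by (simp add: \<beta>_max_def)
      then show ?thesis using \<beta>(1) by linarith
    qed
    have \<beta>_le: "\<beta> * (2 * L + 1) \<le> 1"
      using \<beta>(2) L(1) by (simp add: \<beta>_max_def pos_le_divide_eq)
    define c1 where "c1 = 3 * (1 / \<beta>\<^sup>2 + M\<^sup>2) * (2 * \<beta> * (?F y0 - m))"
    define c2 where "c2 = (3 * (1 / \<beta>\<^sup>2 + M\<^sup>2) * \<beta> + 3) * A\<^sup>2"
    show ?thesis
    proof (rule exI[of _ c1], rule exI[of _ c2], intro allI impI)
      fix K D :: nat assume K: "K \<ge> 1"
      define it where "it k = bilevel_iter blk C \<eta> f_h f_y g_h g_hh g_hy (\<lambda>_. \<alpha>) (\<lambda>_. \<beta>) D y0 h0 k" for k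
      have inv: "fst (it k) \<in> C" "snd (it k) \<in> log_box" for k
        unfolding it_def using ok y0 simplices_ge_nu_subset_log_box[OF h0]
        by (intro bilevel_iter_invariant; simp add: step_ok_def)+
      have "1 / real K * (\<Sum>k=1..K. (infdist (- grad_F blk C \<eta> f_h f_y g (fst (it k))) (normal_cone C (fst (it k))))\<^sup>2)
        \<le> 3 * (1 / \<beta>\<^sup>2 + M\<^sup>2) * (2 * \<beta> * (?F (fst (it 0)) - m)) * (1 / real K)
          + (3 * (1 / \<beta>\<^sup>2 + M\<^sup>2) * \<beta> + 3) * (A * q \<alpha> ^ D)\<^sup>2"
      proof (rule average_stationarity_bound[OF L M(2) \<beta>_pos \<beta>_le inv(1) _ _ K m])
        fix k
        show "fst (it (Suc k)) = closest_point C (fst (it k) - \<beta> *\<^sub>R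
            approx_grad_F blk \<eta> f_h f_y g_h g_hh g_hy \<alpha> D (fst (it k)) (snd (it k)))"
          by (simp add: it_def case_prod_beta Let_def)
        show "norm (approx_grad_F blk \<eta> f_h f_y g_h g_hh g_hy \<alpha> D (fst (it k)) (snd (it k)) - hypergrad (fst (it k)))
            \<le> A * q \<alpha> ^ D"
          by (rule A(2)[OF inv])
      qed
      also have "\<dots> = c1 * (1 / real K) + c2 * ((q \<alpha>)\<^sup>2) ^ D"
        by (simp add: c1_def c2_def it_def power_mult_distrib power_mult[symmetric] mult.commute[of D])
      finally show "1 / real K * (\<Sum>k=1..K. (let y = y_iter blk C \<eta> f_h f_y g_h g_hh g_hy (\<lambda>_. \<alpha>) (\<lambda>_. \<beta>) D y0 h0 k
                     in (infdist (- grad_F blk C \<eta> f_h f_y g y) (normal_cone C y))\<^sup>2))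
          \<le> c1 * (1 / real K) + c2 * ((q \<alpha>)\<^sup>2) ^ D"
        unfolding Let_def y_iter_def it_def[symmetric] .
    qed
  qed
  show ?thesis
  proof (rule exI[of _ \<alpha>_max], rule exI[of _ "\<beta>_max / 2"], rule exI[of _ \<beta>_max],
      rule exI[of _ "\<lambda>\<alpha>. (q \<alpha>)\<^sup>2"], rule exI[of _ "\<lambda>_. 1"], intro conjI allI impI)
    show "0 < \<alpha>_max" using pos eta by (simp add: \<alpha>_max_def)
    have "0 < \<beta>_max" using L(1) by (simp add: \<beta>_max_def)
    then show "0 < \<beta>_max / 2" "\<beta>_max / 2 < \<beta>_max" by simp_all
    fix \<alpha> assume "0 < \<alpha> \<and> \<alpha> \<le> \<alpha>_max"
    then have "0 < q \<alpha>" "q \<alpha> < 1" using q[OF ok] by auto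
    then show "0 < (q \<alpha>)\<^sup>2" "(q \<alpha>)\<^sup>2 < 1" by (simp_all add: power_less_one_iff)
  qed (use main in blast)
qed

end
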